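(* For every real $p>1$ there is a constant $\mu_0=\mu_0(p)>1$, depending only on $p$, such that the following holds. Let $0<T\le\infty$ and let $X:\mathbb{S}^1\times[0,T)\to\mathbb{R}^2$ be a smooth family of smooth convex embeddings $X(\cdot,t)$ evolving by the power curvature flow $$\frac{\partial X}{\partial t}(x,t)=-\kappa(x,t)^p\,\nu(x,t),\qquad (x,t)\in\mathbb{S}^1\times[0,T),$$ where $\nu(x,t)$ and $\kappa(x,t)$ are the outward unit normal and the curvature of the closed convex curve $M_t=X(\mathbb{S}^1,t)$ at the point $X(x,t)$. Let $\mu$ be a real number with $1\le\mu\le\mu_0$. If $M_0$ is $\mu$-non-collapsed, then $M_t$ is $\mu$-non-collapsed for every $t\in[0,T)$.
   Context: Let $M\subset\mathbb{R}^2$ be a smooth embedded closed convex curve bounding the bounded open region $\Omega$, with outward unit normal $\nu$ and curvature $\kappa\ge 0$ (sign convention: a circle of radius $r$ has curvature $1/r$ with respect to this choice). For a real number $\mu\ge 1$, the curve $M$ is called $\mu$-non-collapsed if for every $z\in M$ one has $\kappa(z)>0$ and there is an open ball (disc) $B\subset\Omega$ of radius $\frac{1}{\mu\,\kappa(z)}$ with $z\in\partial B$. Equivalently, $$\frac{2\langle z-y,\nu(z)\rangle}{|z-y|^2}\le \mu\,\kappa(z)\quad\text{for all } y,z\in M,\ y\ne z.$$ *)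

theory Defs
  imports "HOL-Analysis.Analysis"
begin

text \<open>
  The Euclidean plane is the type \<^typ>\<open>complex\<close> with its real inner product \<open>\<bullet>\<close>, and the
  parameter circle is \<open>sphere 0 1\<close> in another copy of \<^typ>\<open>complex\<close>.  Only the restriction of
  a parametrization to \<open>sphere 0 1\<close> matters in what follows.
\<close>

text \<open>
  Derivatives are taken within \<open>S\<close>, so on \<open>UNIV \<times> {0..<T}\<close> smoothness holds up to and including
  the boundary \<open>t = 0\<close> (with one-sided derivatives there).
\<close>

primrec Ck_on :: "nat \<Rightarrow> 'a::real_normed_vector set \<Rightarrow> ('a \<Rightarrow> 'b::real_normed_vector) \<Rightarrow> bool" where
  "Ck_on 0 S f \<longleftrightarrow> continuous_on S f"
| "Ck_on (Suc k) S f \<longleftrightarrow>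
     (\<exists>f'. (\<forall>z\<in>S. (f has_derivative f' z) (at z within S)) \<and>
           (\<forall>v. Ck_on k S (\<lambda>z. f' z v)))"

definition smooth_on :: "'a::real_normed_vector set \<Rightarrow> ('a \<Rightarrow> 'b::real_normed_vector) \<Rightarrow> bool" where
  "smooth_on S f \<longleftrightarrow> (\<forall>k. Ck_on k S f)"

text \<open>Derivative with respect to the angle at a point \<open>x\<close> of the unit circle.\<close>

definition circle_deriv :: "(complex \<Rightarrow> complex) \<Rightarrow> complex \<Rightarrow> complex" where
  "circle_deriv c x = vector_derivative (\<lambda>\<theta>. c (x * cis \<theta>)) (at 0)"

definition curve :: "(complex \<Rightarrow> complex) \<Rightarrow> complex set" where
  "curve c = c ` sphere 0 1"

definition region :: "(complex \<Rightarrow> complex) \<Rightarrow> complex set" where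
  "region c = inside (curve c)"

text \<open>
  A map on the circle is smooth iff its composition with the covering map \<open>cis\<close> is.  By
  compactness of the circle, an injective immersion is an embedding.
\<close>

definition smooth_embedding :: "(complex \<Rightarrow> complex) \<Rightarrow> bool" where
  "smooth_embedding c \<longleftrightarrow>
     smooth_on UNIV (\<lambda>\<theta>. c (cis \<theta>)) \<and>
     inj_on c (sphere 0 1) \<and>
     (\<forall>x\<in>sphere 0 1. circle_deriv c x \<noteq> 0)"

definition smooth_convex_embedding :: "(complex \<Rightarrow> complex) \<Rightarrow> bool" where
  "smooth_convex_embedding c \<longleftrightarrow> smooth_embedding c \<and> convex (region c)"

text \<open>
  By the Jordan curve theorem exactly one of the two unit normals points out of the region, so the
  description below is proper for every smooth embedding.
\<close>

definition outward_normal :: "(complex \<Rightarrow> complex) \<Rightarrow> complex \<Rightarrow> complex" where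
  "outward_normal c x =
     (THE n. norm n = 1 \<and> n \<bullet> circle_deriv c x = 0 \<and>
             (\<forall>\<^sub>F s in at_right 0. c x + s *\<^sub>R n \<in> outside (curve c)))"

text \<open>
  The second derivative with respect to arc length is \<open>- \<kappa> \<nu>\<close>.  In an arbitrary regular
  parametrization the second derivative divided by the squared speed differs from it only by a
  tangential vector.  A circle of radius \<open>r\<close> has \<open>\<kappa> = 1 / r\<close>, independently of the orientation.
\<close>

definition curvature :: "(complex \<Rightarrow> complex) \<Rightarrow> complex \<Rightarrow> real" where
  "curvature c x =
     - (circle_deriv (circle_deriv c) x \<bullet> outward_normal c x) / (norm (circle_deriv c x))\<^sup>2"

definition non_collapsed :: "real \<Rightarrow> (complex \<Rightarrow> complex) \<Rightarrow> bool" where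
  "non_collapsed \<mu> c \<longleftrightarrow>
     (\<forall>x\<in>sphere 0 1.
        curvature c x > 0 \<and>
        (\<exists>a. ball a (1 / (\<mu> * curvature c x)) \<subseteq> region c \<and>
             c x \<in> frontier (ball a (1 / (\<mu> * curvature c x)))))"

definition time_interval :: "ereal \<Rightarrow> real set" where
  "time_interval T = {t. 0 \<le> t \<and> ereal t < T}"

definition power_curvature_flow ::
  "real \<Rightarrow> ereal \<Rightarrow> (complex \<Rightarrow> real \<Rightarrow> complex) \<Rightarrow> bool" where
  "power_curvature_flow p T X \<longleftrightarrow>
     smooth_on (UNIV \<times> time_interval T) (\<lambda>(\<theta>, t). X (cis \<theta>) t) \<and>
     (\<forall>t\<in>time_interval T. smooth_convex_embedding (\<lambda>x. X x t)) \<and>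
     (\<forall>x\<in>sphere 0 1. \<forall>t\<in>time_interval T.
        (X x has_vector_derivative
           - (curvature (\<lambda>x. X x t) x powr p) *\<^sub>R outward_normal (\<lambda>x. X x t) x)
        (at t within time_interval T))"

end

theory Submission
  imports Defs
begin

text \<open>
  Write \<open>\<gamma>\<close>, \<open>\<nu>\<close>, \<open>\<kappa>\<close> for the position, the outward normal and the curvature, and let
  \<open>Z(x, y, t) = \<mu> \<kappa>(x) |D|\<^sup>2 / 2 - \<langle>D, \<nu>(x)\<rangle>\<close> with \<open>D = \<gamma>(x) - \<gamma>(y)\<close>, so that \<open>\<mu>\<close>-non-collapsing means \<open>\<kappa> > 0\<close>
  and \<open>Z \<ge> 0\<close>.  Positivity of \<open>\<kappa>\<close> follows from the maximum principle for
  \<open>\<kappa>\<^sub>t = (\<kappa>\<^sup>p)\<^sub>s\<^sub>s + \<kappa>\<^bsup>p+2\<^esup>\<close>.  For \<open>Z\<close>, replace \<open>\<mu>\<close> by a slightly larger value, so that \<open>Z > 0\<close> off the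
  diagonal at time 0, and consider the first zero off the diagonal.  There \<open>\<partial>\<^sub>t Z \<le> 0\<close> while the spatial Hessian is
  nonnegative.  The first-order conditions express everything by \<open>\<epsilon> = \<mu> - 1\<close>, the ratio
  \<open>u = \<kappa>(y) / \<kappa>(x)\<close> and \<open>q = sin\<^sup>2 \<alpha>\<close>, where \<open>\<alpha>\<close> is the angle between the chord and the tangent at \<open>x\<close>:
  \<open>\<partial>\<^sub>t Z\<close> minus \<open>p \<kappa>\<^bsup>p-1\<^esup>\<close> times the second derivative of \<open>Z\<close> in the direction
  \<open>\<partial>\<^sub>x + l \<partial>\<^sub>y\<close> is \<open>\<kappa>\<^sup>p\<close> times an explicit function of \<open>\<epsilon>, u, q, l\<close>.  With \<open>l = 0\<close> if \<open>u\<close> is well below 1,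
  and \<open>l = -1\<close> otherwise, that function is positive for small \<open>\<epsilon>\<close>, a contradiction.
\<close>

section \<open>The contact inequality\<close>

text \<open>The factor \<open>p * \<kappa> powr (p - 1)\<close> in the comparison is forced: the
  time derivative of \<open>Z\<close> contains the second arc length derivative of \<kappa>, about
  which nothing is known at a contact, and exactly this multiple of the second derivative in
  \<open>x\<close> removes it. Only the slope \<open>l\<close> stays free. To first order in
  \<epsilon>, at \<open>u = 1\<close> and \<open>l = -1\<close>, the remaining function is
  \<epsilon> (p (4 - 2 q) - 2 q). It decreases in \<open>q\<close>, and at \<open>q = 1\<close>,
  where the chord is perpendicular to the tangent, it equals 2 (p - 1) \<epsilon>: this is the
  margin that p > 1 provides, and it dictates how small \<epsilon> has to be. The obstacle in the
  first-zero argument is that \<open>Z\<close> vanishes on the whole diagonal, so that the zeros to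
  be excluded could accumulate there. For \<mu> > 1 and \<kappa> > 0 strict convexity in the second
  point gives a band around the diagonal, uniform in time, without other zeros. The band degenerates
  at \<mu> = 1, which is therefore reached only as a limit.\<close>

lemma orthogonal_parallel:
  fixes v n m :: complex
  assumes "v \<noteq> 0" "n \<bullet> v = 0" "m \<bullet> v = 0" "norm n = 1"
  shows "m = (m \<bullet> n) *\<^sub>R n"
proof -
  obtain a b where v: "v = Complex a b" by (cases v)
  obtain n1 n2 where n: "n = Complex n1 n2" by (cases n)
  obtain m1 m2 where m: "m = Complex m1 m2" by (cases m)
  have e: "n1*a + n2*b = 0" "m1*a + m2*b = 0" "n1^2+n2^2=1" "a \<noteq> 0 \<or> b \<noteq> 0"
    using assms by (auto simp: v n m inner_complex_def complex_norm Complex_eq_0)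
  have "(m1*n2 - m2*n1)*a = 0" "(m1*n2-m2*n1)*b = 0" using e(1,2) by algebra+
  then have "m1*n2 = m2*n1" using e(4) by auto
  then have "m1 = (m1*n1+m2*n2)*n1" "m2 = (m1*n1+m2*n2)*n2" using e(3) by algebra+
  then show ?thesis by (simp add: n m inner_complex_def complex_eq_iff)
qed


lemma powr_expansion_at_one:
  assumes "e > 0"
  obtains d where "d > 0" "\<And>u::real. \<bar>u - 1\<bar> < d \<Longrightarrow> \<bar>u powr p - 1 - p * (u - 1)\<bar> \<le> e * \<bar>u - 1\<bar>"
proof -
  have "((\<lambda>u::real. u powr p) has_real_derivative p) (at 1)"
    by (rule derivative_eq_intros | simp)+
  then have "((\<lambda>u::real. u powr p) has_derivative (*) p) (at 1)"
    by (simp add: has_field_derivative_def)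
  then obtain d where "d > 0"
      "\<And>u::real. norm (u - 1) < d \<Longrightarrow> norm (u powr p - 1 powr p - p * (u - 1)) \<le> e * norm (u - 1)"
    using assms unfolding has_derivative_at_alt by blast
  then show ?thesis by (intro that[of d]) auto
qed

text \<open>
  \<open>contact_excess p \<mu> q u l\<close> is, up to a positive factor, the time derivative of the two-point function at a
  zero minus its second derivative in the direction \<open>\<partial>\<^sub>s + l \<partial>\<^sub>r\<close> of the pair of arc lengths.
\<close>

definition contact_excess :: "real \<Rightarrow> real \<Rightarrow> real \<Rightarrow> real \<Rightarrow> real \<Rightarrow> real" where
  "contact_excess p \<mu> q u l = 1 - u powr p - 2 * q * (\<mu> - 1) / \<mu> + 2 * p * (p - 1) * (\<mu> - 1)\<^sup>2 * (1 - q) / \<mu>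
     + p * (\<mu> - 1) * (4 * (1 - q) - 2 * (1 - q) / \<mu> + 2 / \<mu> - 1)
     - 2 * l * p * (\<mu> - 1) - p * l\<^sup>2 * (\<mu> - u)"

text \<open>With \<open>l = 0\<close>, the gain \<open>1 - u powr p\<close> outweighs all losses,
  which are of order \<epsilon>, once \<open>u\<close> is far enough below 1. Near
  \<open>u = 1\<close>, the terms in \<open>l\<close> are largest at
  \<open>l = - \<epsilon> / (\<mu> - u)\<close>, which is -1 at \<open>u = 1\<close>. For
  \<open>l = -1\<close> they contribute \<open>p * \<epsilon> - p * (1 - u)\<close>, whose second
  part cancels the linear part of \<open>1 - u powr p\<close>.\<close>

lemma contact_excess_positive:
  assumes p: "p > 1"
  shows "\<exists>\<mu>1>1. \<forall>\<mu> q u. 1 < \<mu> \<longrightarrow> \<mu> \<le> \<mu>1 \<longrightarrow> 0 \<le> q \<longrightarrow> q \<le> 1 \<longrightarrow> 0 < u \<longrightarrow> u \<le> \<mu> \<longrightarrow>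
    (\<exists>l. contact_excess p \<mu> q u l > 0)"
proof -
  \<comment> \<open>The regimes are separated by \<open>u = 1 - M * \<epsilon>\<close>. Below it the
    gain is at least \<open>M * \<epsilon>\<close> and the losses are at most
    \<open>(p + 2) * \<epsilon>\<close>, so one \<epsilon> is left. Above it, \<open>e\<close> makes
    the Taylor error at most \<open>(p - 1) * \<epsilon> / 2\<close>, half of the available
    margin.\<close>
  define M where "M = p + 3"
  define e where "e = (p - 1) / (2 * M)"
  have M: "M > 4" using p by (simp add: M_def)
  have e0: "e > 0" using p M by (simp add: e_def)
  obtain d where d: "d > 0" "\<And>u::real. \<bar>u - 1\<bar> < d \<Longrightarrow> \<bar>u powr p - 1 - p * (u - 1)\<bar> \<le> e * \<bar>u - 1\<bar>"
    using powr_expansion_at_one[OF e0] by metis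
  \<comment> \<open>The bound 1 on \<epsilon> gives \<open>2 / \<mu> \<ge> 1\<close>; the bound
    \<open>d / (2 * M)\<close> puts \<open>M * \<epsilon>\<close> within the range of the Taylor
    estimate.\<close>
  define \<mu>1 where "\<mu>1 = 1 + min 1 (d / (2 * M))"
  have "\<exists>l. contact_excess p \<mu> q u l > 0"
    if \<mu>: "1 < \<mu>" "\<mu> \<le> \<mu>1" and q: "0 \<le> q" "q \<le> 1" and u: "0 < u" "u \<le> \<mu>" for \<mu> q u
  proof -
    define \<epsilon> where "\<epsilon> = \<mu> - 1"
    have \<epsilon>: "\<epsilon> > 0" "\<epsilon> \<le> 1" "\<epsilon> \<le> d / (2 * M)" using \<mu> by (auto simp: \<epsilon>_def \<mu>1_def)
    then have Md: "M * \<epsilon> < d" using M d(1) by (simp add: field_simps)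
    have \<mu>0: "\<mu> > 0" "\<mu> \<noteq> 0" using \<mu> by auto
    have sq: "2 * p * (p - 1) * (\<mu> - 1)\<^sup>2 * (1 - q) / \<mu> \<ge> 0"
      using p q \<mu>0 by simp
    have q1: "(1 - q) / \<mu> \<le> 1 - q" using q \<mu> by (simp add: divide_le_eq mult_le_cancel_left1)
    have q2: "q / \<mu> \<le> 1 / \<mu>" using q \<mu> by (simp add: divide_right_mono)
    have b: "4 * (1 - q) - 2 * (1 - q) / \<mu> + 2 / \<mu> \<ge> 2 / \<mu>"
    proof -
      define w where "w = (1 - q) / \<mu>"
      have e: "2 * (1 - q) / \<mu> = 2 * w" by (simp add: w_def)
      have "w \<le> 1 - q" using q1 by (simp add: w_def)
      then have "4 * (1 - q) - 2 * w \<ge> 0" using q mult_left_mono[of 0 "1 - q" 2] by (simp add: algebra_simps)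
      then show ?thesis unfolding e by simp
    qed
    show ?thesis
    proof (cases "u \<le> 1 - M * \<epsilon>")
      case True
      have "u powr p \<le> u powr 1" 
        by (rule powr_mono') (use p u True M \<epsilon> in \<open>auto intro: order_trans mult_nonneg_nonneg\<close>)
      then have 1: "1 - u powr p \<ge> M * \<epsilon>" using True u by simp
      have "q * (\<mu> - 1) / \<mu> \<le> \<epsilon>"
      proof -
        have "q * (\<mu> - 1) \<le> \<mu> * \<epsilon>" unfolding \<epsilon>_def using q \<mu> by (intro mult_right_mono) auto
        then show ?thesis using \<mu>0 by (simp add: divide_le_eq mult.commute)
      qed
      then have 2: "2 * q * (\<mu> - 1) / \<mu> \<le> 2 * \<epsilon>" by simp
      have "2 / \<mu> \<ge> 0" using \<mu>0 by simp
      then have "4 * (1 - q) - 2 * (1 - q) / \<mu> + 2 / \<mu> - 1 \<ge> -1" using b by linarith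
      then have "p * (\<mu> - 1) * (4 * (1 - q) - 2 * (1 - q) / \<mu> + 2 / \<mu> - 1) \<ge> p * (\<mu> - 1) * (-1)"
        by (intro mult_left_mono) (use p \<mu> in auto)
      then have 3: "p * (\<mu> - 1) * (4 * (1 - q) - 2 * (1 - q) / \<mu> + 2 / \<mu> - 1) \<ge> - p * \<epsilon>"
        by (simp add: \<epsilon>_def)
      have "M * \<epsilon> - 2 * \<epsilon> - p * \<epsilon> = \<epsilon>" by (simp add: M_def algebra_simps)
      then have "contact_excess p \<mu> q u 0 > 0" unfolding contact_excess_def using 1 2 3 sq \<epsilon>(1) by simp
      then show ?thesis by blast
    next
      case False
      have "\<epsilon> \<le> M * \<epsilon>" using M \<epsilon>(1) by simp
      moreover have "u \<le> 1 + \<epsilon>" using u by (simp add: \<epsilon>_def)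
      ultimately have "\<bar>u - 1\<bar> \<le> M * \<epsilon>" using False by (intro abs_leI) linarith+
      then have "e * \<bar>u - 1\<bar> \<le> e * (M * \<epsilon>)" "\<bar>u powr p - 1 - p * (u - 1)\<bar> \<le> e * \<bar>u - 1\<bar>"
        using e0 Md d(2) by auto
      moreover have "e * (M * \<epsilon>) = (p - 1) * \<epsilon> / 2" using M by (simp add: e_def)
      ultimately have "u powr p - 1 - p * (u - 1) \<le> (p - 1) * \<epsilon> / 2" by linarith
      then have 1: "1 - u powr p - p * (1 - u) \<ge> - (p - 1) * \<epsilon> / 2"
        by (simp add: field_simps)
      have "p * (\<mu> - 1) * (4 * (1 - q) - 2 * (1 - q) / \<mu> + 2 / \<mu>) \<ge> p * (\<mu> - 1) * (2 / \<mu>)"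
        by (intro mult_left_mono b) (use p \<mu> in auto)
      moreover have "2 * q * (\<mu> - 1) / \<mu> \<le> 2 * (\<mu> - 1) / \<mu>"
      proof -
        have "q * (\<mu> - 1) \<le> 1 * (\<mu> - 1)" using q \<mu> by (intro mult_right_mono) auto
        then have "2 * q * (\<mu> - 1) \<le> 2 * (\<mu> - 1)" by linarith
        then show ?thesis using \<mu>0 by (intro divide_right_mono) auto
      qed
      moreover have "contact_excess p \<mu> q u (-1) = (1 - u powr p - p * (1 - u))
          + 2 * p * (p - 1) * (\<mu> - 1)\<^sup>2 * (1 - q) / \<mu>
          + p * (\<mu> - 1) * (4 * (1 - q) - 2 * (1 - q) / \<mu> + 2 / \<mu>) - 2 * q * (\<mu> - 1) / \<mu>"
        unfolding contact_excess_def by (simp add: algebra_simps)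
      ultimately have "contact_excess p \<mu> q u (-1) \<ge> - (p - 1) * \<epsilon> / 2 + p * (\<mu> - 1) * (2 / \<mu>) - 2 * (\<mu> - 1) / \<mu>"
        using 1 sq by linarith
      also have "- (p - 1) * \<epsilon> / 2 + p * (\<mu> - 1) * (2 / \<mu>) - 2 * (\<mu> - 1) / \<mu> = (p - 1) * \<epsilon> * (2 / \<mu> - 1 / 2)"
        using \<mu>0 by (simp add: \<epsilon>_def field_simps)
      finally have *: "contact_excess p \<mu> q u (-1) \<ge> (p - 1) * \<epsilon> * (2 / \<mu> - 1 / 2)" .
      have "2 / \<mu> \<ge> 1" using \<mu>0 \<epsilon>(2) by (simp add: \<epsilon>_def)
      then have "(p - 1) * \<epsilon> * (2 / \<mu> - 1 / 2) > 0" using p \<epsilon>(1) by (intro mult_pos_pos) auto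
      then show ?thesis using * by (intro exI[of _ "-1"]) linarith
    qed
  qed
  moreover have "\<mu>1 > 1" using d(1) M by (simp add: \<mu>1_def)
  ultimately show ?thesis by blast
qed

text \<open>
  Here \<open>d = |D|\<^sup>2\<close>, \<open>P\<close> and \<open>N\<close> are the tangential and normal components of \<open>D\<close> at the first
  point, and the second point has curvature \<open>u * \<kappa>\<close>; \<open>k1\<close> and \<open>k2\<close> are the arc length
  derivatives of \<open>\<kappa>\<close>.
\<close>

lemma two_point_identity:
  fixes \<mu> \<kappa> k1 k2 d P N p u l :: real
  defines "f \<equiv> \<kappa> powr p"
  assumes pos: "\<mu> > 0" "\<kappa> > 0" "d > 0" "u > 0"
    and N: "N = \<mu> * \<kappa> * d / 2" and PN: "P\<^sup>2 + N\<^sup>2 = d"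
    and k1: "\<mu> * k1 * d = - 2 * (\<mu> - 1) * \<kappa> * P"
  shows "\<mu> * d / 2 * (p * \<kappa> powr (p - 1) * k2 + p * (p - 1) * \<kappa> powr (p - 2) * k1\<^sup>2 + \<kappa>\<^sup>2 * f)
      - f * (\<mu> * \<kappa>) * N + f - (u * \<kappa>) powr p - p * \<kappa> powr (p - 1) * k1 * P
    = p * \<kappa> powr (p - 1) * ((\<mu> * k2 * d / 2 + (2 * \<mu> - 1) * k1 * P + (\<mu> - 1) * \<kappa> * (1 - \<kappa> * N))
        + 2 * l * ((\<mu> - 1) * \<kappa>) + l\<^sup>2 * (\<mu> * \<kappa> - u * \<kappa>))
      + f * contact_excess p \<mu> (\<mu> * \<kappa> * N / 2) u l"
proof -
  define q where "q = \<mu> * \<kappa> * N / 2"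
  have f1: "\<kappa> powr (p - 1) = f / \<kappa>" and f2: "\<kappa> powr (p - 2) = f / \<kappa>\<^sup>2"
    using pos by (simp_all add: f_def powr_diff powr_numeral)
  have f3: "(u * \<kappa>) powr p = u powr p * f" using pos by (simp add: f_def powr_mult)
  have d: "\<kappa>\<^sup>2 * d = 4 * q / \<mu>\<^sup>2" using pos by (simp add: q_def N field_simps power2_eq_square)
  have P2: "P\<^sup>2 = d * (1 - q)" using PN by (simp add: q_def N field_simps power2_eq_square)
  have k1': "k1 = - 2 * (\<mu> - 1) * \<kappa> * P / (\<mu> * d)" using k1 pos by (simp add: field_simps)
  have k1P: "k1 * P = - 2 * (\<mu> - 1) * \<kappa> * (1 - q) / \<mu>"
  proof -
    have "k1 * P = - 2 * (\<mu> - 1) * \<kappa> * P\<^sup>2 / (\<mu> * d)" by (simp add: k1' power2_eq_square)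
    then show ?thesis using pos by (simp add: P2)
  qed
  have k1k1: "d * k1\<^sup>2 = 4 * (\<mu> - 1)\<^sup>2 * \<kappa>\<^sup>2 * (1 - q) / \<mu>\<^sup>2"
  proof -
    have "(- 2 * (\<mu> - 1) * \<kappa> * P)\<^sup>2 = 4 * (\<mu> - 1)\<^sup>2 * \<kappa>\<^sup>2 * P\<^sup>2"
      by (simp add: power2_eq_square algebra_simps)
    then have "d * k1\<^sup>2 = d * (4 * (\<mu> - 1)\<^sup>2 * \<kappa>\<^sup>2 * P\<^sup>2) / (\<mu> * d)\<^sup>2"
      unfolding k1' power_divide by simp
    also have "\<dots> = d * (4 * (\<mu> - 1)\<^sup>2 * \<kappa>\<^sup>2 * (d * (1 - q))) / (\<mu> * d)\<^sup>2" by (simp only: P2)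
    also have "\<dots> = 4 * (\<mu> - 1)\<^sup>2 * \<kappa>\<^sup>2 * (1 - q) / \<mu>\<^sup>2"
      using pos by (simp add: power2_eq_square)
    finally show ?thesis .
  qed
  have \<kappa>N: "\<kappa> * N = 2 * q / \<mu>" using pos by (simp add: q_def)
  have "\<mu> * d / 2 * (p * (f / \<kappa>) * k2 + p * (p - 1) * (f / \<kappa>\<^sup>2) * k1\<^sup>2 + \<kappa>\<^sup>2 * f)
      = p * (f / \<kappa>) * (\<mu> * k2 * d / 2) + p * (p - 1) * (f / \<kappa>\<^sup>2) * \<mu> / 2 * (d * k1\<^sup>2) + \<mu> / 2 * f * (\<kappa>\<^sup>2 * d)"
    using pos by (simp add: field_simps)
  also have "\<dots> = p * (f / \<kappa>) * (\<mu> * k2 * d / 2)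
      + f * (2 * p * (p - 1) * (\<mu> - 1)\<^sup>2 * (1 - q) / \<mu>) + f * (2 * q / \<mu>)"
    unfolding k1k1 d using pos by (simp add: field_simps power2_eq_square)
  finally have A: "\<mu> * d / 2 * (p * (f / \<kappa>) * k2 + p * (p - 1) * (f / \<kappa>\<^sup>2) * k1\<^sup>2 + \<kappa>\<^sup>2 * f) = \<dots>" .
  have B: "p * (f / \<kappa>) * k1 * P = f * (p * (- 2 * (\<mu> - 1) * (1 - q) / \<mu>))"
    using pos k1P by (simp add: mult.assoc)
  have C: "f * (\<mu> * \<kappa>) * N = f * (2 * q)" by (simp add: q_def)
  have E: "p * (f / \<kappa>) * ((\<mu> * k2 * d / 2 + (2 * \<mu> - 1) * k1 * P + (\<mu> - 1) * \<kappa> * (1 - \<kappa> * N))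
        + 2 * l * ((\<mu> - 1) * \<kappa>) + l\<^sup>2 * (\<mu> * \<kappa> - u * \<kappa>))
      = p * (f / \<kappa>) * (\<mu> * k2 * d / 2) + f * (p * ((2 * \<mu> - 1) * (- 2 * (\<mu> - 1) * (1 - q) / \<mu>)
        + (\<mu> - 1) * (1 - 2 * q / \<mu>) + 2 * l * (\<mu> - 1) + l\<^sup>2 * (\<mu> - u)))"
  proof -
    define r t where "r = - 2 * (\<mu> - 1) * (1 - q) / \<mu>" and "t = 2 * q / \<mu>"
    have "k1 * P = \<kappa> * r" using k1P by (simp add: r_def)
    then have "(2 * \<mu> - 1) * k1 * P = \<kappa> * ((2 * \<mu> - 1) * r)" by (simp add: mult.assoc)
    then have "(\<mu> * k2 * d / 2 + (2 * \<mu> - 1) * k1 * P + (\<mu> - 1) * \<kappa> * (1 - \<kappa> * N))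
        + 2 * l * ((\<mu> - 1) * \<kappa>) + l\<^sup>2 * (\<mu> * \<kappa> - u * \<kappa>) = \<mu> * k2 * d / 2
        + \<kappa> * ((2 * \<mu> - 1) * r + (\<mu> - 1) * (1 - t) + 2 * l * (\<mu> - 1) + l\<^sup>2 * (\<mu> - u))"
      unfolding \<kappa>N t_def[symmetric] by (simp add: algebra_simps)
    then have "p * (f / \<kappa>) * ((\<mu> * k2 * d / 2 + (2 * \<mu> - 1) * k1 * P + (\<mu> - 1) * \<kappa> * (1 - \<kappa> * N))
        + 2 * l * ((\<mu> - 1) * \<kappa>) + l\<^sup>2 * (\<mu> * \<kappa> - u * \<kappa>)) = p * (f / \<kappa>) * (\<mu> * k2 * d / 2
        + \<kappa> * ((2 * \<mu> - 1) * r + (\<mu> - 1) * (1 - t) + 2 * l * (\<mu> - 1) + l\<^sup>2 * (\<mu> - u)))"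
      by (rule arg_cong)
    also have "\<dots> = p * (f / \<kappa>) * (\<mu> * k2 * d / 2)
        + f * (p * ((2 * \<mu> - 1) * r + (\<mu> - 1) * (1 - t) + 2 * l * (\<mu> - 1) + l\<^sup>2 * (\<mu> - u)))"
      using pos by (simp only: distrib_left[of "p * (f / \<kappa>)"]) simp
    finally show ?thesis unfolding r_def t_def .
  qed
  \<comment> \<open>What remains after the \<open>k2\<close> terms cancel and \<open>f\<close> is
    factored out; \<open>contact_excess\<close> is defined so as to make this balance.\<close>
  have F: "2 * p * (p - 1) * (\<mu> - 1)\<^sup>2 * (1 - q) / \<mu> + 2 * q / \<mu> - 2 * q + 1 - u powr p
      - p * (- 2 * (\<mu> - 1) * (1 - q) / \<mu>)
    = p * ((2 * \<mu> - 1) * (- 2 * (\<mu> - 1) * (1 - q) / \<mu>)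
        + (\<mu> - 1) * (1 - 2 * q / \<mu>) + 2 * l * (\<mu> - 1) + l\<^sup>2 * (\<mu> - u)) + contact_excess p \<mu> q u l"
    unfolding contact_excess_def using pos by (simp add: field_simps)
  show ?thesis
    unfolding f1 f2 f3 A B C E q_def[symmetric] using arg_cong[OF F, of "\<lambda>z. f * z"]
    by (simp only: distrib_left right_diff_distrib mult_ac mult_1_right mult_1_left)
qed

section \<open>Two-point function of a framed curve\<close>

lemma inner_has_real_derivative:
  assumes "(f has_vector_derivative f') (at x within S)" "(g has_vector_derivative g') (at x within S)"
  shows "((\<lambda>x. f x \<bullet> g x) has_real_derivative f x \<bullet> g' + f' \<bullet> g x) (at x within S)"
  using bounded_bilinear.has_vector_derivative[OF bounded_bilinear_inner assms]
  by (simp add: has_real_derivative_iff_has_vector_derivative)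

text \<open>A negative \<open>c\<close> makes \<phi>' negative just to the right of
  \<open>x\<close>, and the mean value theorem then produces a value below the minimum.\<close>

lemma second_derivative_nonneg_at_min:
  fixes \<phi> \<phi>' :: "real \<Rightarrow> real"
  assumes d1: "\<And>h. (\<phi> has_real_derivative \<phi>' h) (at h)"
    and d2: "(\<phi>' has_real_derivative c) (at x)" and min: "\<And>h. \<phi> x \<le> \<phi> h"
  shows "\<phi>' x = 0" "c \<ge> 0"
proof -
  show z: "\<phi>' x = 0"
    by (rule DERIV_local_min[OF d1, of 1]) (use min in auto)
  show "c \<ge> 0"
  proof (rule ccontr)
    assume "\<not> c \<ge> 0"
    then obtain d where d: "d > 0" "\<And>h. 0 < h \<Longrightarrow> h < d \<Longrightarrow> \<phi>' (x + h) < \<phi>' x"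
      using DERIV_neg_dec_right[OF d2] by auto
    obtain s where s: "x < s" "s < x + d / 2" "\<phi> (x + d / 2) - \<phi> x = (x + d / 2 - x) * \<phi>' s"
      using MVT2[of x "x + d / 2" \<phi> \<phi>'] d1 d(1) by auto
    have "\<phi>' s < 0" using d(2)[of "s - x"] s z d(1) by auto
    then have "\<phi> (x + d / 2) < \<phi> x" using s(3) d(1) mult_pos_neg[of "d / 2" "\<phi>' s"] by simp
    then show False using min[of "x + d / 2"] by simp
  qed
qed

lemma rotation_inner:
  fixes \<iota> x y :: complex
  assumes "\<iota> = \<i> \<or> \<iota> = -\<i>"
  shows "(\<iota> * x) \<bullet> (\<iota> * y) = x \<bullet> y" "(\<iota> * x) \<bullet> y = - (x \<bullet> (\<iota> * y))" "(\<iota> * x) \<bullet> x = 0" "x \<bullet> (\<iota> * x) = 0"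
    "\<iota> * (\<iota> * x) = - x" "norm \<iota> = 1"
  using assms by (auto simp: inner_complex_def)

text \<open>
  A curve at a fixed time: \<open>\<iota> = \<plusminus>\<i>\<close> turns the outward normal \<open>\<nu>\<close> into the unit tangent, \<open>\<rho>\<close> is
  the speed, and \<open>k1\<close>, \<open>k2\<close> are the arc length derivatives of the curvature \<open>\<kappa>\<close>.
\<close>

locale framed_curve =
  fixes \<gamma> \<nu> :: "real \<Rightarrow> complex" and \<iota> :: complex and \<rho> \<rho>' \<kappa> k1 k2 :: "real \<Rightarrow> real"
  assumes \<iota>: "\<iota> = \<i> \<or> \<iota> = -\<i>"
    and \<rho>_pos: "\<rho> \<theta> > 0"
    and \<rho>_deriv: "(\<rho> has_real_derivative \<rho>' \<theta>) (at \<theta>)"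
    and norm_\<nu>: "norm (\<nu> \<theta>) = 1"
    and \<gamma>_deriv: "(\<gamma> has_vector_derivative \<rho> \<theta> *\<^sub>R (\<iota> * \<nu> \<theta>)) (at \<theta>)"
    and \<nu>_deriv: "(\<nu> has_vector_derivative (\<kappa> \<theta> * \<rho> \<theta>) *\<^sub>R (\<iota> * \<nu> \<theta>)) (at \<theta>)"
    and \<kappa>_deriv: "(\<kappa> has_real_derivative \<rho> \<theta> * k1 \<theta>) (at \<theta>)"
    and k1_deriv: "(k1 has_real_derivative \<rho> \<theta> * k2 \<theta>) (at \<theta>)"
begin

abbreviation "\<tau> \<theta> \<equiv> \<iota> * \<nu> \<theta>"
abbreviation "D \<theta> \<eta> \<equiv> \<gamma> \<theta> - \<gamma> \<eta>"

definition Z :: "real \<Rightarrow> real \<Rightarrow> real \<Rightarrow> real" where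
  "Z \<mu> \<theta> \<eta> = \<mu> * \<kappa> \<theta> / 2 * (D \<theta> \<eta> \<bullet> D \<theta> \<eta>) - D \<theta> \<eta> \<bullet> \<nu> \<theta>"

text \<open>
  \<open>Zs\<close> and \<open>Zr\<close> are the derivatives of \<open>Z\<close> by the arc lengths of the first and the second point;
  \<open>Hss\<close>, \<open>Hsr\<close>, \<open>Hrr\<close> below are the second ones.
\<close>

definition Zs :: "real \<Rightarrow> real \<Rightarrow> real \<Rightarrow> real" where
  "Zs \<mu> \<theta> \<eta> = \<mu> * k1 \<theta> / 2 * (D \<theta> \<eta> \<bullet> D \<theta> \<eta>) + (\<mu> - 1) * \<kappa> \<theta> * (D \<theta> \<eta> \<bullet> \<tau> \<theta>)"

definition Zr :: "real \<Rightarrow> real \<Rightarrow> real \<Rightarrow> real" where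
  "Zr \<mu> \<theta> \<eta> = \<tau> \<eta> \<bullet> \<nu> \<theta> - \<mu> * \<kappa> \<theta> * (D \<theta> \<eta> \<bullet> \<tau> \<eta>)"

lemma inner_\<nu> [simp]: "\<nu> \<theta> \<bullet> \<nu> \<theta> = 1"
  using norm_\<nu>[of \<theta>] by (simp add: norm_eq_1)

lemmas rot = rotation_inner[OF \<iota>]

lemma \<tau>_deriv: "(\<tau> has_vector_derivative - (\<kappa> \<theta> * \<rho> \<theta>) *\<^sub>R \<nu> \<theta>) (at \<theta>)"
proof -
  have "(\<tau> has_vector_derivative \<iota> * ((\<kappa> \<theta> * \<rho> \<theta>) *\<^sub>R (\<iota> * \<nu> \<theta>))) (at \<theta>)"
    by (rule has_vector_derivative_mult_right[OF \<nu>_deriv])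
  then show ?thesis by (simp add: rot(5))
qed

lemma chain_vec:
  assumes "\<And>\<theta>. (f has_vector_derivative f' \<theta>) (at \<theta>)"
  shows "((\<lambda>h::real. f (\<theta> + a * h)) has_vector_derivative a *\<^sub>R f' (\<theta> + a * h)) (at h)"
proof -
  have "((\<lambda>h. \<theta> + a * h) has_vector_derivative a) (at h)"
    by (auto intro!: derivative_eq_intros)
  from vector_diff_chain_at[OF this assms] show ?thesis by (simp add: o_def)
qed

lemma chain_real:
  assumes "\<And>\<theta>. (f has_real_derivative f' \<theta>) (at \<theta>)"
  shows "((\<lambda>h::real. f (\<theta> + a * h)) has_real_derivative a * f' (\<theta> + a * h)) (at h)"
  using chain_vec[of f f' \<theta> a h] assms by (simp add: has_real_derivative_iff_has_vector_derivative)

section \<open>Derivatives of the two-point function along lines in the parameter plane\<close>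

context
  fixes \<theta> \<eta> a b :: real
begin

abbreviation (input) "x \<equiv> \<lambda>h. \<theta> + a * h"
abbreviation (input) "y \<equiv> \<lambda>h. \<eta> + b * h"

lemma D_line: "((\<lambda>h. D (x h) (y h)) has_vector_derivative
    (a * \<rho> (x h)) *\<^sub>R \<tau> (x h) - (b * \<rho> (y h)) *\<^sub>R \<tau> (y h)) (at h)"
  using has_vector_derivative_diff[OF chain_vec[of \<gamma>, OF \<gamma>_deriv, of \<theta> a h] chain_vec[of \<gamma>, OF \<gamma>_deriv, of \<eta> b h]]
  by simp

lemma \<nu>_line: "((\<lambda>h. \<nu> (x h)) has_vector_derivative (a * (\<kappa> (x h) * \<rho> (x h))) *\<^sub>R \<tau> (x h)) (at h)"
  using chain_vec[of \<nu>, OF \<nu>_deriv, of \<theta> a h] by simp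

lemma \<tau>_line: "((\<lambda>h. \<tau> (x h)) has_vector_derivative (- (a * (\<kappa> (x h) * \<rho> (x h)))) *\<^sub>R \<nu> (x h)) (at h)"
  using chain_vec[of \<tau>, OF \<tau>_deriv, of \<theta> a h] by simp

lemma \<tau>_line': "((\<lambda>h. \<tau> (y h)) has_vector_derivative (- (b * (\<kappa> (y h) * \<rho> (y h)))) *\<^sub>R \<nu> (y h)) (at h)"
  using chain_vec[of \<tau>, OF \<tau>_deriv, of \<eta> b h] by simp

lemmas DD_line = inner_has_real_derivative[OF D_line D_line]
lemmas D\<nu>_line = inner_has_real_derivative[OF D_line \<nu>_line]
lemmas D\<tau>_line = inner_has_real_derivative[OF D_line \<tau>_line]
lemmas D\<tau>'_line = inner_has_real_derivative[OF D_line \<tau>_line']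
lemmas \<tau>\<nu>_line = inner_has_real_derivative[OF \<tau>_line' \<nu>_line]
lemmas \<kappa>_line = chain_real[of \<kappa>, OF \<kappa>_deriv, of \<theta> a]
lemmas k1_line = chain_real[of k1, OF k1_deriv, of \<theta> a]
lemmas \<rho>_line = chain_real[of \<rho>, OF \<rho>_deriv, of \<theta> a]
lemmas \<rho>_line' = chain_real[of \<rho>, OF \<rho>_deriv, of \<eta> b]

lemma Z_line: "((\<lambda>h. Z \<mu> (x h) (y h)) has_real_derivative
    a * \<rho> (x h) * Zs \<mu> (x h) (y h) + b * \<rho> (y h) * Zr \<mu> (x h) (y h)) (at h)"
  unfolding Z_def
  apply (rule DERIV_cong[OF DERIV_diff[OF DERIV_mult[OF DERIV_cdivide[OF DERIV_cmult[OF \<kappa>_line]] DD_line] D\<nu>_line]])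
  apply (simp add: Zs_def Zr_def inner_diff_left inner_diff_right inner_commute rot algebra_simps)
  done

text \<open>The two brackets become \<open>Hss\<close> and \<open>Hsr\<close> below. The second one
  reappears in \<open>Zr_line\<close>, in accordance with the symmetry of the Hessian.\<close>

lemma Zs_line: "((\<lambda>h. Zs \<mu> (x h) (y h)) has_real_derivative
    a * \<rho> (x h) * (\<mu> * k2 (x h) / 2 * (D (x h) (y h) \<bullet> D (x h) (y h))
        + (2 * \<mu> - 1) * k1 (x h) * (D (x h) (y h) \<bullet> \<tau> (x h))
        + (\<mu> - 1) * \<kappa> (x h) * (1 - \<kappa> (x h) * (D (x h) (y h) \<bullet> \<nu> (x h))))
    + b * \<rho> (y h) * (- \<mu> * k1 (x h) * (D (x h) (y h) \<bullet> \<tau> (y h)) - (\<mu> - 1) * \<kappa> (x h) * (\<nu> (x h) \<bullet> \<nu> (y h)))) (at h)"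
  unfolding Zs_def
  apply (rule DERIV_cong[OF DERIV_add[OF DERIV_mult[OF DERIV_cdivide[OF DERIV_cmult[OF k1_line]] DD_line] DERIV_mult[OF DERIV_cmult[OF \<kappa>_line] D\<tau>_line]]])
  apply (simp add: inner_diff_left inner_diff_right inner_commute rot algebra_simps)
  done

lemma Zr_line: "((\<lambda>h. Zr \<mu> (x h) (y h)) has_real_derivative
    a * \<rho> (x h) * (- \<mu> * k1 (x h) * (D (x h) (y h) \<bullet> \<tau> (y h)) - (\<mu> - 1) * \<kappa> (x h) * (\<nu> (x h) \<bullet> \<nu> (y h)))
    + b * \<rho> (y h) * (\<mu> * \<kappa> (x h) - \<kappa> (y h) * (\<nu> (y h) \<bullet> (\<nu> (x h) - (\<mu> * \<kappa> (x h)) *\<^sub>R D (x h) (y h))))) (at h)"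
  unfolding Zr_def
  apply (rule DERIV_cong[OF DERIV_diff[OF \<tau>\<nu>_line DERIV_mult[OF DERIV_cmult[OF \<kappa>_line] D\<tau>'_line]]])
  apply (simp add: inner_diff_left inner_diff_right inner_commute rot algebra_simps)
  done

end

lemma first_order_contact:
  assumes min: "\<And>\<theta> \<eta>. Z \<mu> \<theta> \<eta> \<ge> 0" and zero: "Z \<mu> \<theta> \<eta> = 0"
  shows "Zs \<mu> \<theta> \<eta> = 0" "Zr \<mu> \<theta> \<eta> = 0"
proof -
  have *: "a * \<rho> \<theta> * Zs \<mu> \<theta> \<eta> + b * \<rho> \<eta> * Zr \<mu> \<theta> \<eta> = 0" for a b
  proof -
    have "a * \<rho> (\<theta> + a * 0) * Zs \<mu> (\<theta> + a * 0) (\<eta> + b * 0) + b * \<rho> (\<eta> + b * 0) * Zr \<mu> (\<theta> + a * 0) (\<eta> + b * 0) = 0"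
      by (rule DERIV_local_min[OF Z_line[of \<mu> \<theta> a \<eta> b 0], of 1]) (use min zero in auto)
    then show ?thesis by simp
  qed
  show "Zs \<mu> \<theta> \<eta> = 0" "Zr \<mu> \<theta> \<eta> = 0"
    using *[of 1 0] *[of 0 1] \<rho>_pos[of \<theta>] \<rho>_pos[of \<eta>] by auto
qed

definition Hss :: "real \<Rightarrow> real \<Rightarrow> real \<Rightarrow> real" where
  "Hss \<mu> \<theta> \<eta> = \<mu> * k2 \<theta> * (D \<theta> \<eta> \<bullet> D \<theta> \<eta>) / 2 + (2 * \<mu> - 1) * k1 \<theta> * (D \<theta> \<eta> \<bullet> \<tau> \<theta>)
    + (\<mu> - 1) * \<kappa> \<theta> * (1 - \<kappa> \<theta> * (D \<theta> \<eta> \<bullet> \<nu> \<theta>))"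

definition Hsr :: "real \<Rightarrow> real \<Rightarrow> real \<Rightarrow> real" where
  "Hsr \<mu> \<theta> \<eta> = - \<mu> * k1 \<theta> * (D \<theta> \<eta> \<bullet> \<tau> \<eta>) - (\<mu> - 1) * \<kappa> \<theta> * (\<nu> \<theta> \<bullet> \<nu> \<eta>)"

definition Hrr :: "real \<Rightarrow> real \<Rightarrow> real \<Rightarrow> real" where
  "Hrr \<mu> \<theta> \<eta> = \<mu> * \<kappa> \<theta> - \<kappa> \<eta> * (\<nu> \<eta> \<bullet> (\<nu> \<theta> - (\<mu> * \<kappa> \<theta>) *\<^sub>R D \<theta> \<eta>))"

text \<open>Dividing \<open>a\<close> and \<open>b\<close> by the speeds turns arc length directions
  into parameter directions. The derivatives of the speeds are multiplied by \<open>Zs\<close> and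
  \<open>Zr\<close>, which vanish at a contact, so the second derivative along the line is the arc
  length Hessian.\<close>

lemma second_order_contact:
  assumes min: "\<And>\<theta> \<eta>. Z \<mu> \<theta> \<eta> \<ge> 0" and zero: "Z \<mu> \<theta> \<eta> = 0"
  shows "a\<^sup>2 * Hss \<mu> \<theta> \<eta> + 2 * a * b * Hsr \<mu> \<theta> \<eta> + b\<^sup>2 * Hrr \<mu> \<theta> \<eta> \<ge> 0"
proof -
  define a' b' where "a' = a / \<rho> \<theta>" and "b' = b / \<rho> \<eta>"
  have a': "a' * \<rho> \<theta> = a" and b': "b' * \<rho> \<eta> = b"
    using \<rho>_pos[of \<theta>] \<rho>_pos[of \<eta>] by (auto simp: a'_def b'_def)
  have Z0: "Zs \<mu> \<theta> \<eta> = 0" "Zr \<mu> \<theta> \<eta> = 0" using first_order_contact[OF assms] by auto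
  have d: "((\<lambda>h. a' * \<rho> (\<theta> + a' * h) * Zs \<mu> (\<theta> + a' * h) (\<eta> + b' * h) + b' * \<rho> (\<eta> + b' * h) * Zr \<mu> (\<theta> + a' * h) (\<eta> + b' * h))
     has_real_derivative a * (a * Hss \<mu> \<theta> \<eta> + b * Hsr \<mu> \<theta> \<eta>) + b * (a * Hsr \<mu> \<theta> \<eta> + b * Hrr \<mu> \<theta> \<eta>)) (at 0)"
    apply (rule DERIV_cong[OF DERIV_add[OF DERIV_mult[OF DERIV_cmult[OF \<rho>_line[of \<theta> a' 0]] Zs_line[of \<mu> \<theta> a' \<eta> b' 0]]
       DERIV_mult[OF DERIV_cmult[OF \<rho>_line'[of \<eta> b' 0]] Zr_line[of \<mu> \<theta> a' \<eta> b' 0]]]])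
    apply (simp add: Z0 a' b' Hss_def Hsr_def Hrr_def)
    done
  have "a * (a * Hss \<mu> \<theta> \<eta> + b * Hsr \<mu> \<theta> \<eta>) + b * (a * Hsr \<mu> \<theta> \<eta> + b * Hrr \<mu> \<theta> \<eta>) \<ge> 0"
    by (rule second_derivative_nonneg_at_min(2)[OF Z_line d]) (use min zero in simp)
  then show ?thesis by (simp add: power2_eq_square algebra_simps)
qed

text \<open>
  At a zero of the two-point function the circle of curvature \<open>\<mu> \<kappa>\<close> touching the curve from inside
  at the first point also touches it at the second one.  The support inequality rules out
  the opposite orientation there.
\<close>

lemma contact_normal:
  assumes min: "\<And>\<theta> \<eta>. Z \<mu> \<theta> \<eta> \<ge> 0" and zero: "Z \<mu> \<theta> \<eta> = 0"
    and K: "\<mu> > 0" "\<kappa> \<theta> > 0" and D: "\<gamma> \<theta> \<noteq> \<gamma> \<eta>" and support: "\<nu> \<eta> \<bullet> D \<theta> \<eta> \<le> 0"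
  shows "\<nu> \<eta> = \<nu> \<theta> - (\<mu> * \<kappa> \<theta>) *\<^sub>R D \<theta> \<eta>"
proof -
  define K where "K = \<mu> * \<kappa> \<theta>"
  \<comment> \<open>The circle of radius \<open>1 / K\<close> touching from inside at the first
    point has centre \<open>\<gamma> \<theta> - (1 / K) *\<^sub>R \<nu> \<theta>\<close>. The zero
    of \<open>Z\<close> places \<open>\<gamma> \<eta>\<close> on it, and \<open>w\<close> is its
    outward unit normal there.\<close>
  define w where "w = \<nu> \<theta> - K *\<^sub>R D \<theta> \<eta>"
  have N: "D \<theta> \<eta> \<bullet> \<nu> \<theta> = K * (D \<theta> \<eta> \<bullet> D \<theta> \<eta>) / 2" using zero by (simp add: Z_def K_def)
  have dd: "D \<theta> \<eta> \<bullet> D \<theta> \<eta> > 0" using D by simp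
  have ww: "w \<bullet> w = 1"
  proof -
    have "w \<bullet> w = 1 - 2 * K * (D \<theta> \<eta> \<bullet> \<nu> \<theta>) + K\<^sup>2 * (D \<theta> \<eta> \<bullet> D \<theta> \<eta>)"
      unfolding w_def by (simp add: inner_diff inner_commute algebra_simps power2_eq_square)
    then show ?thesis by (simp add: N power2_eq_square)
  qed
  have "w \<bullet> \<tau> \<eta> = 0"
    using first_order_contact(2)[OF min zero]
    by (simp add: Zr_def w_def K_def inner_diff_left inner_diff_right inner_commute)
  moreover have "\<tau> \<eta> \<noteq> 0" using norm_\<nu>[of \<eta>] rot(6) by (metis mult_eq_0_iff norm_zero zero_neq_one)
  moreover have "\<nu> \<eta> \<bullet> \<tau> \<eta> = 0" by (simp add: rot)
  ultimately have par: "w = (w \<bullet> \<nu> \<eta>) *\<^sub>R \<nu> \<eta>"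
    using orthogonal_parallel norm_\<nu> by blast
  define r where "r = w \<bullet> \<nu> \<eta>"
  have wr: "w = r *\<^sub>R \<nu> \<eta>" using par by (simp add: r_def)
  have "r * r = 1" using ww by (simp add: wr)
  then have "r = 1 \<or> r = -1" by (simp add: square_eq_1_iff)
  moreover have False if "r = -1"
  proof -
    have "D \<theta> \<eta> \<bullet> w = - (D \<theta> \<eta> \<bullet> \<nu> \<eta>)" using wr that by simp
    moreover have "D \<theta> \<eta> \<bullet> w = D \<theta> \<eta> \<bullet> \<nu> \<theta> - K * (D \<theta> \<eta> \<bullet> D \<theta> \<eta>)"
      unfolding w_def by (subst inner_diff_right) simp
    then have "D \<theta> \<eta> \<bullet> w = - (K * (D \<theta> \<eta> \<bullet> D \<theta> \<eta>) / 2)" unfolding N by simp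
    ultimately have "K * (D \<theta> \<eta> \<bullet> D \<theta> \<eta>) \<le> 0" using support by (simp add: inner_commute)
    moreover have "K * (D \<theta> \<eta> \<bullet> D \<theta> \<eta>) > 0" using dd K by (simp add: K_def)
    ultimately show False by simp
  qed
  ultimately show ?thesis using wr by (auto simp: w_def K_def)
qed

text \<open>The expression is the time derivative of \<open>Z\<close> when the points move with
  velocity \<open>- f *\<^sub>R \<nu>\<close>: then \<kappa> changes at rate
  \<open>f2 + \<kappa>\<^sup>2 * f\<close> and \<nu> at rate \<open>f1 *\<^sub>R \<tau>\<close>. It
  is written in data of a single time, so only the geometry of one curve enters;
  \<open>two_point_time_derivative\<close> connects it with the flow.\<close>

lemma time_derivative_positive_at_contact:
  assumes min: "\<And>\<theta> \<eta>. Z \<mu> \<theta> \<eta> \<ge> 0" and zero: "Z \<mu> \<theta> \<eta> = 0"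
    and \<mu>: "\<mu> > 1" and p: "p > 1" and \<kappa>: "\<kappa> \<theta> > 0" "\<kappa> \<eta> > 0"
    and D: "\<gamma> \<theta> \<noteq> \<gamma> \<eta>" and support: "\<nu> \<eta> \<bullet> D \<theta> \<eta> \<le> 0"
    and Q: "\<And>q u. 0 \<le> q \<Longrightarrow> q \<le> 1 \<Longrightarrow> 0 < u \<Longrightarrow> u \<le> \<mu> \<Longrightarrow> \<exists>l. contact_excess p \<mu> q u l > 0"
  defines "f \<equiv> \<lambda>\<theta>. \<kappa> \<theta> powr p" and "f1 \<equiv> p * \<kappa> \<theta> powr (p - 1) * k1 \<theta>"
    and "f2 \<equiv> p * \<kappa> \<theta> powr (p - 1) * k2 \<theta> + p * (p - 1) * \<kappa> \<theta> powr (p - 2) * (k1 \<theta>)\<^sup>2"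
  shows "0 < \<mu> * (f2 + (\<kappa> \<theta>)\<^sup>2 * f \<theta>) / 2 * (D \<theta> \<eta> \<bullet> D \<theta> \<eta>)
      + \<mu> * \<kappa> \<theta> * (D \<theta> \<eta> \<bullet> (f \<eta> *\<^sub>R \<nu> \<eta> - f \<theta> *\<^sub>R \<nu> \<theta>))
      - (f \<eta> *\<^sub>R \<nu> \<eta> - f \<theta> *\<^sub>R \<nu> \<theta>) \<bullet> \<nu> \<theta> - D \<theta> \<eta> \<bullet> (f1 *\<^sub>R \<tau> \<theta>)" (is "0 < ?Zt")
proof -
  define K where "K = \<mu> * \<kappa> \<theta>"
  define d P N where "d = D \<theta> \<eta> \<bullet> D \<theta> \<eta>" and "P = D \<theta> \<eta> \<bullet> \<tau> \<theta>" and "N = D \<theta> \<eta> \<bullet> \<nu> \<theta>"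
  define u where "u = \<kappa> \<eta> / \<kappa> \<theta>"
  define q where "q = K * N / 2"
  have dpos: "d > 0" using D by (simp add: d_def)
  have Kpos: "K > 0" using \<mu> \<kappa> by (simp add: K_def)
  have \<nu>\<eta>: "\<nu> \<eta> = \<nu> \<theta> - K *\<^sub>R D \<theta> \<eta>"
    unfolding K_def by (rule contact_normal[OF min zero _ \<kappa>(1) D support]) (use \<mu> in simp)
  have N: "N = K * d / 2" using zero by (simp add: Z_def K_def N_def d_def)
  have PN: "P\<^sup>2 + N\<^sup>2 = d"
  proof -
    have "(norm (\<nu> \<theta>))\<^sup>2 = 1" by (simp add: norm_\<nu>)
    then have "(Re (\<nu> \<theta>))\<^sup>2 + (Im (\<nu> \<theta>))\<^sup>2 = 1" by (simp add: cmod_power2)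
    moreover have "P\<^sup>2 = (Re (D \<theta> \<eta>) * Im (\<nu> \<theta>) - Im (D \<theta> \<eta>) * Re (\<nu> \<theta>))\<^sup>2"
      using \<iota> unfolding P_def by (auto simp: inner_complex_def power2_eq_square algebra_simps)
    ultimately show ?thesis unfolding N_def d_def inner_complex_def by algebra
  qed
  have \<tau>\<eta>: "\<tau> \<eta> = \<tau> \<theta> - K *\<^sub>R (\<iota> * D \<theta> \<eta>)" unfolding \<nu>\<eta> by (simp add: algebra_simps)
  have D\<tau>\<eta>: "D \<theta> \<eta> \<bullet> \<tau> \<eta> = P" unfolding \<tau>\<eta> P_def by (simp add: inner_diff_right rot)
  have \<nu>\<nu>: "\<nu> \<theta> \<bullet> \<nu> \<eta> = 1 - K * N" unfolding \<nu>\<eta> N_def by (simp add: inner_diff_right inner_commute)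
  have k1: "\<mu> * k1 \<theta> * d = - 2 * (\<mu> - 1) * \<kappa> \<theta> * P"
    using first_order_contact(1)[OF min zero] by (simp add: Zs_def d_def P_def field_simps)
  have D\<nu>\<eta>: "D \<theta> \<eta> \<bullet> \<nu> \<eta> = - N" unfolding \<nu>\<eta> inner_diff_right using N by (simp add: N_def d_def)
  have Hrr: "Hrr \<mu> \<theta> \<eta> = \<mu> * \<kappa> \<theta> - u * \<kappa> \<theta>"
    unfolding Hrr_def K_def[symmetric] \<nu>\<eta>[symmetric] using \<kappa> by (simp add: u_def)
  have Hsr: "Hsr \<mu> \<theta> \<eta> = (\<mu> - 1) * \<kappa> \<theta>"
  proof -
    \<comment> \<open>The factor \<open>d\<close> lets the first-order condition \<open>k1\<close>
      eliminate the derivative of the curvature; the Pythagorean relation \<open>PN\<close> with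
      \<open>2 * N = K * d\<close> then collapses the rest to \<open>d\<close>.\<close>
    have "Hsr \<mu> \<theta> \<eta> * d = - (\<mu> * k1 \<theta> * d) * P - (\<mu> - 1) * \<kappa> \<theta> * (1 - K * N) * d"
      unfolding Hsr_def D\<tau>\<eta> \<nu>\<nu> by (simp add: algebra_simps)
    also have "\<dots> = (\<mu> - 1) * \<kappa> \<theta> * (2 * P\<^sup>2 - (1 - K * N) * d)"
      unfolding k1 by (simp add: algebra_simps power2_eq_square)
    also have "2 * P\<^sup>2 - (1 - K * N) * d = d"
    proof -
      have "2 * N = K * d" using N by simp
      then show ?thesis using PN by algebra
    qed
    finally show ?thesis using dpos by simp
  qed
  \<comment> \<open>By the contact equation \<open>q\<close> equals \<open>N\<^sup>2 / d\<close>,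
    the squared sine of the angle between chord and tangent.\<close>
  have q: "0 \<le> q" "q \<le> 1"
  proof -
    show "0 \<le> q" using Kpos dpos by (simp add: q_def N)
    have "N\<^sup>2 \<le> d" using PN by (metis le_add_same_cancel2 zero_le_power2)
    moreover have "N\<^sup>2 = q * d" by (simp add: q_def N power2_eq_square)
    ultimately show "q \<le> 1" using dpos by simp
  qed
  have u: "0 < u" "u \<le> \<mu>"
  proof -
    show "0 < u" using \<kappa> by (simp add: u_def)
    \<comment> \<open>Second variation in the second point alone: the curve cannot bend more than
      the touching circle where it meets that circle from outside.\<close>
    have "(\<mu> - u) * \<kappa> \<theta> \<ge> 0"
      using second_order_contact[OF min zero, of 0 1] by (simp add: Hrr algebra_simps)
    then show "u \<le> \<mu>" using \<kappa> by (simp add: zero_le_mult_iff)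
  qed
  obtain l where l: "contact_excess p \<mu> q u l > 0" using Q[OF q u] by blast
  have H: "0 \<le> Hss \<mu> \<theta> \<eta> + 2 * l * ((\<mu> - 1) * \<kappa> \<theta>) + l\<^sup>2 * (\<mu> * \<kappa> \<theta> - u * \<kappa> \<theta>)"
    using second_order_contact[OF min zero, of 1 l] by (simp add: Hrr Hsr)
  have "?Zt = \<mu> * d / 2 * (p * \<kappa> \<theta> powr (p - 1) * k2 \<theta> + p * (p - 1) * \<kappa> \<theta> powr (p - 2) * (k1 \<theta>)\<^sup>2
      + (\<kappa> \<theta>)\<^sup>2 * (\<kappa> \<theta> powr p)) - (\<kappa> \<theta> powr p) * (\<mu> * \<kappa> \<theta>) * N + \<kappa> \<theta> powr p - (u * \<kappa> \<theta>) powr p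
      - p * \<kappa> \<theta> powr (p - 1) * k1 \<theta> * P"
  proof -
    have u\<kappa>: "u * \<kappa> \<theta> = \<kappa> \<eta>" using \<kappa> by (simp add: u_def)
    have *: "D \<theta> \<eta> \<bullet> (f \<eta> *\<^sub>R \<nu> \<eta> - f \<theta> *\<^sub>R \<nu> \<theta>) = - f \<eta> * N - f \<theta> * N"
      using D\<nu>\<eta> by (simp only: inner_diff_right inner_scaleR_right N_def[symmetric])
    have **: "(f \<eta> *\<^sub>R \<nu> \<eta> - f \<theta> *\<^sub>R \<nu> \<theta>) \<bullet> \<nu> \<theta> = f \<eta> * (1 - K * N) - f \<theta>"
      using \<nu>\<nu> by (simp only: inner_diff_left inner_scaleR_left inner_commute[of "\<nu> \<eta>"] inner_\<nu>)
    show ?thesis unfolding * ** u\<kappa> inner_scaleR_right P_def[symmetric] d_def[symmetric] K_def[symmetric]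
      by (simp add: f_def f1_def f2_def field_simps)
  qed
  also have "\<dots> = p * \<kappa> \<theta> powr (p - 1) * (Hss \<mu> \<theta> \<eta> + 2 * l * ((\<mu> - 1) * \<kappa> \<theta>) + l\<^sup>2 * (\<mu> * \<kappa> \<theta> - u * \<kappa> \<theta>))
      + \<kappa> \<theta> powr p * contact_excess p \<mu> q u l"
    unfolding q_def K_def Hss_def d_def[symmetric] P_def[symmetric] N_def[symmetric]
    by (rule two_point_identity[OF _ \<kappa>(1) dpos u(1) N[unfolded K_def] PN k1]) (use \<mu> in simp)
  also have "\<dots> > 0"
    using H l \<kappa> p by (intro add_nonneg_pos mult_nonneg_nonneg mult_pos_pos) auto
  finally show ?thesis .
qed

end

section \<open>Normal and curvature of a regular curve\<close>

text \<open>The sign in \<open>\<iota> = \<plusminus>\<i>\<close> records the orientation: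
  \<open>\<i>\<close> for a counterclockwise curve. For fixed \<iota> the normal is an explicit
  function of the velocity and can be differentiated, unlike the description by
  \<open>outward_normal\<close>.\<close>

definition unit_normal :: "complex \<Rightarrow> complex \<Rightarrow> complex" where
  "unit_normal \<iota> v = - (\<iota> * sgn v)"

definition normal_curvature :: "complex \<Rightarrow> complex \<Rightarrow> complex \<Rightarrow> real" where
  "normal_curvature \<iota> v a = - (a \<bullet> unit_normal \<iota> v) / (norm v)\<^sup>2"

lemma rotate_unit_normal:
  assumes "\<iota> = \<i> \<or> \<iota> = -\<i>"
  shows "\<iota> * unit_normal \<iota> v = sgn v"
  unfolding unit_normal_def using rotation_inner(5)[OF assms, of "sgn v"] by (simp only: mult_minus_right minus_minus)

lemma norm_unit_normal:
  assumes "\<iota> = \<i> \<or> \<iota> = -\<i>" "v \<noteq> 0"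
  shows "norm (unit_normal \<iota> v) = 1"
  using rotation_inner(6)[OF assms(1)] assms(2) by (simp add: unit_normal_def norm_mult norm_sgn)

lemma frame_decomposition:
  fixes v n :: complex
  assumes "\<iota> = \<i> \<or> \<iota> = -\<i>" "norm n = 1"
  shows "v = (v \<bullet> n) *\<^sub>R n + (v \<bullet> (\<iota> * n)) *\<^sub>R (\<iota> * n)"
proof -
  obtain a b where v: "v = Complex a b" by (cases v)
  obtain c d where n: "n = Complex c d" by (cases n)
  have "(norm n)\<^sup>2 = 1" using assms(2) by simp
  then have e: "c\<^sup>2 + d\<^sup>2 = 1" by (simp add: n cmod_power2)
  have "a = (a*c + b*d)*c + (a*d - b*c)*d" "b = (a*c + b*d)*d - (a*d - b*c)*c"
    using e by algebra+
  then show ?thesis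
    using assms(1) by (auto simp: v n inner_complex_def complex_eq_iff algebra_simps)
qed

lemma norm_has_real_derivative:
  fixes f :: "real \<Rightarrow> 'a::real_inner"
  assumes "(f has_vector_derivative f') (at x)" "f x \<noteq> 0"
  shows "((\<lambda>s. norm (f s)) has_real_derivative f' \<bullet> sgn (f x)) (at x)"
proof -
  have eq: "inverse (norm (f x)) / 2 * (f x \<bullet> f' + f' \<bullet> f x) = f' \<bullet> sgn (f x)"
    by (simp add: sgn_div_norm inner_commute[of f'])
  have "(sqrt has_real_derivative inverse (sqrt (f x \<bullet> f x)) / 2) (at (f x \<bullet> f x))"
    by (rule DERIV_real_sqrt) (use assms(2) in simp)
  from DERIV_chain2[OF this inner_has_real_derivative[OF assms(1) assms(1)]]
  show ?thesis unfolding norm_eq_sqrt_inner[symmetric] eq .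
qed

lemma unit_normal_has_derivative:
  assumes \<iota>: "\<iota> = \<i> \<or> \<iota> = -\<i>" and v: "(v has_vector_derivative v') (at x)" and nz: "v x \<noteq> 0"
  defines "n \<equiv> unit_normal \<iota> (v x)"
  shows "((\<lambda>s. unit_normal \<iota> (v s)) has_vector_derivative (- (v' \<bullet> n) / norm (v x)) *\<^sub>R (\<iota> * n)) (at x)"
proof -
  define \<rho> where "\<rho> = norm (v x)"
  have \<rho>: "\<rho> > 0" using nz by (simp add: \<rho>_def)
  have n1: "norm n = 1" unfolding n_def by (rule norm_unit_normal[OF \<iota> nz])
  have \<tau>: "sgn (v x) = \<iota> * n" unfolding n_def by (rule rotate_unit_normal[OF \<iota>, symmetric])
  have vx: "v x = \<rho> *\<^sub>R (\<iota> * n)" unfolding \<tau>[symmetric] \<rho>_def using nz by (simp add: sgn_div_norm)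
  have "((\<lambda>s. inverse (norm (v s))) has_real_derivative - (inverse (norm (v x)) * (v' \<bullet> sgn (v x)) * inverse (norm (v x)))) (at x)"
    by (rule DERIV_inverse'[OF norm_has_real_derivative[OF v nz]]) (use nz in simp)
  then have i: "((\<lambda>s. inverse (norm (v s))) has_real_derivative - (v' \<bullet> (\<iota> * n)) / \<rho>\<^sup>2) (at x)"
    unfolding \<tau> by (simp add: \<rho>_def divide_inverse power2_eq_square mult.commute mult.left_commute)
  have "((\<lambda>s. inverse (norm (v s)) *\<^sub>R v s) has_vector_derivative
      inverse \<rho> *\<^sub>R v' + (- (v' \<bullet> (\<iota> * n)) / \<rho>\<^sup>2) *\<^sub>R v x) (at x)"
    using has_vector_derivative_scaleR[OF i v] by (simp add: \<rho>_def)
  then have "((\<lambda>s. - (\<iota> * (inverse (norm (v s)) *\<^sub>R v s))) has_vector_derivative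
      - (\<iota> * (inverse \<rho> *\<^sub>R v' + (- (v' \<bullet> (\<iota> * n)) / \<rho>\<^sup>2) *\<^sub>R v x))) (at x)"
    by (intro has_vector_derivative_minus has_vector_derivative_mult_right)
  moreover have "- (\<iota> * (inverse \<rho> *\<^sub>R v' + (- (v' \<bullet> (\<iota> * n)) / \<rho>\<^sup>2) *\<^sub>R v x)) = (- (v' \<bullet> n) / \<rho>) *\<^sub>R (\<iota> * n)"
  proof -
    have "inverse \<rho> *\<^sub>R v' + (- (v' \<bullet> (\<iota> * n)) / \<rho>\<^sup>2) *\<^sub>R v x
        = inverse \<rho> *\<^sub>R (v' - (v' \<bullet> (\<iota> * n)) *\<^sub>R (\<iota> * n))"
      unfolding vx using \<rho> by (simp add: scaleR_diff_right power2_eq_square divide_inverse)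
    also have "v' - (v' \<bullet> (\<iota> * n)) *\<^sub>R (\<iota> * n) = (v' \<bullet> n) *\<^sub>R n"
      using frame_decomposition[OF \<iota> n1, of v'] by (metis add_diff_cancel_right')
    finally show ?thesis by (simp add: divide_inverse mult.commute)
  qed
  ultimately show ?thesis by (simp only: unit_normal_def sgn_div_norm \<rho>_def[symmetric])
qed

text \<open>No relation between \<open>v\<close> and \<open>a\<close> is assumed, because the
  variable is the curve parameter in one application and time, at a fixed parameter, in
  another.\<close>

lemma normal_curvature_has_derivative:
  assumes \<iota>: "\<iota> = \<i> \<or> \<iota> = -\<i>" and v: "(v has_vector_derivative v') (at x)" and nz: "v x \<noteq> 0"
    and a: "(a has_vector_derivative a') (at x)"
  defines "n \<equiv> unit_normal \<iota> (v x)" and "\<rho> \<equiv> norm (v x)"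
  shows "((\<lambda>s. normal_curvature \<iota> (v s) (a s)) has_real_derivative
    - (a' \<bullet> n) / \<rho>\<^sup>2 + (v' \<bullet> n) * (a x \<bullet> (\<iota> * n)) / \<rho> ^ 3 + 2 * (a x \<bullet> n) * (v' \<bullet> (\<iota> * n)) / \<rho> ^ 3) (at x)"
proof -
  have \<rho>: "\<rho> > 0" using nz by (simp add: \<rho>_def)
  have \<tau>: "sgn (v x) = \<iota> * n" unfolding n_def by (rule rotate_unit_normal[OF \<iota>, symmetric])
  have 1: "((\<lambda>s. - (a s \<bullet> unit_normal \<iota> (v s))) has_real_derivative
      - (a x \<bullet> ((- (v' \<bullet> n) / \<rho>) *\<^sub>R (\<iota> * n)) + a' \<bullet> n)) (at x)"
    unfolding n_def \<rho>_def
    by (rule DERIV_minus[OF inner_has_real_derivative[OF a unit_normal_has_derivative[OF \<iota> v nz]]])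
  have 2: "((\<lambda>s. (norm (v s))\<^sup>2) has_real_derivative 2 * \<rho> * (v' \<bullet> (\<iota> * n))) (at x)"
    using DERIV_power[OF norm_has_real_derivative[OF v nz], of 2] unfolding \<tau> by (simp add: \<rho>_def mult_ac)
  show ?thesis
    unfolding normal_curvature_def
    by (rule DERIV_cong[OF DERIV_divide[OF 1 2]])
      (use \<rho> nz in \<open>simp_all add: n_def[symmetric] \<rho>_def[symmetric] field_simps power2_eq_square power3_eq_cube\<close>)
qed

text \<open>Two derivatives define the curvature, and two more give its first and second arc length
  derivatives.\<close>

locale regular_curve =
  fixes g g1 g2 g3 g4 :: "real \<Rightarrow> complex" and \<iota> :: complex
  assumes \<iota>: "\<iota> = \<i> \<or> \<iota> = -\<i>" and regular: "g1 \<theta> \<noteq> 0"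
    and g: "(g has_vector_derivative g1 \<theta>) (at \<theta>)"
    and g1: "(g1 has_vector_derivative g2 \<theta>) (at \<theta>)"
    and g2: "(g2 has_vector_derivative g3 \<theta>) (at \<theta>)"
    and g3: "(g3 has_vector_derivative g4 \<theta>) (at \<theta>)"
begin

abbreviation "n \<theta> \<equiv> unit_normal \<iota> (g1 \<theta>)"

lemma framed:
  "\<exists>k1 k2. framed_curve g n \<iota> (\<lambda>\<theta>. norm (g1 \<theta>)) (\<lambda>\<theta>. g2 \<theta> \<bullet> (\<iota> * n \<theta>))
      (\<lambda>\<theta>. normal_curvature \<iota> (g1 \<theta>) (g2 \<theta>)) k1 k2"
proof -
  define \<rho> where "\<rho> = (\<lambda>\<theta>. norm (g1 \<theta>))"
  define \<kappa> where "\<kappa> = (\<lambda>\<theta>. normal_curvature \<iota> (g1 \<theta>) (g2 \<theta>))"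
  \<comment> \<open>Along the curve both \<open>v'\<close> and \<open>a\<close> are
    \<open>g2\<close>, so the last two terms of \<open>normal_curvature_has_derivative\<close>
    merge: 1 + 2 = 3.\<close>
  define k1 where "k1 = (\<lambda>\<theta>. (- (g3 \<theta> \<bullet> n \<theta>) / (\<rho> \<theta>)\<^sup>2
    + 3 * (g2 \<theta> \<bullet> n \<theta>) * (g2 \<theta> \<bullet> (\<iota> * n \<theta>)) / \<rho> \<theta> ^ 3) / \<rho> \<theta>)"
  have \<rho>: "\<rho> \<theta> > 0" for \<theta> using regular by (simp add: \<rho>_def)
  have norm_g1: "norm (g1 \<theta>) = \<rho> \<theta>" for \<theta> by (simp add: \<rho>_def)
  have dn: "(n has_vector_derivative (- (g2 \<theta> \<bullet> n \<theta>) / \<rho> \<theta>) *\<^sub>R (\<iota> * n \<theta>)) (at \<theta>)" for \<theta>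
    unfolding \<rho>_def by (rule unit_normal_has_derivative[OF \<iota> g1 regular])
  have d\<rho>: "(\<rho> has_real_derivative g2 \<theta> \<bullet> (\<iota> * n \<theta>)) (at \<theta>)" for \<theta>
    unfolding \<rho>_def rotate_unit_normal[OF \<iota>] by (rule norm_has_real_derivative[OF g1 regular])
  have d\<kappa>: "(\<kappa> has_real_derivative \<rho> \<theta> * k1 \<theta>) (at \<theta>)" for \<theta>
    unfolding \<kappa>_def
    by (rule DERIV_cong[OF normal_curvature_has_derivative[OF \<iota> g1 regular g2]])
      (use \<rho>[of \<theta>] in \<open>simp add: k1_def norm_g1 field_simps power2_eq_square power3_eq_cube\<close>)
  have "\<exists>d. (k1 has_real_derivative d) (at \<theta>)" for \<theta>
  proof -
    note dt = has_vector_derivative_mult_right[OF dn, of \<iota>]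
    note d = inner_has_real_derivative[OF g3[of \<theta>] dn] inner_has_real_derivative[OF g2[of \<theta>] dn]
      inner_has_real_derivative[OF g2[of \<theta>] dt] d\<rho>
    show ?thesis
      unfolding k1_def
      by (rule exI, rule DERIV_divide[OF DERIV_add[OF DERIV_divide[OF DERIV_minus[OF d(1)] DERIV_power[OF d(4)]]
          DERIV_divide[OF DERIV_mult[OF DERIV_cmult[OF d(2)] d(3)] DERIV_power[OF d(4)]]] d(4)])
        (use \<rho>[of \<theta>] in auto)
  qed
  then obtain d where d: "\<And>\<theta>. (k1 has_real_derivative d \<theta>) (at \<theta>)" by metis
  have "framed_curve g n \<iota> \<rho> (\<lambda>\<theta>. g2 \<theta> \<bullet> (\<iota> * n \<theta>)) \<kappa> k1 (\<lambda>\<theta>. d \<theta> / \<rho> \<theta>)"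
  proof
    fix \<theta>
    show "\<iota> = \<i> \<or> \<iota> = -\<i>" by (rule \<iota>)
    show "\<rho> \<theta> > 0" by (rule \<rho>)
    show "norm (n \<theta>) = 1" by (rule norm_unit_normal[OF \<iota> regular])
    show "(\<rho> has_real_derivative g2 \<theta> \<bullet> (\<iota> * n \<theta>)) (at \<theta>)" by (rule d\<rho>)
    show "(g has_vector_derivative \<rho> \<theta> *\<^sub>R (\<iota> * n \<theta>)) (at \<theta>)"
      using g[of \<theta>] regular[of \<theta>] unfolding rotate_unit_normal[OF \<iota>] by (simp add: \<rho>_def sgn_div_norm)
    show "(n has_vector_derivative (\<kappa> \<theta> * \<rho> \<theta>) *\<^sub>R (\<iota> * n \<theta>)) (at \<theta>)"
      using dn[of \<theta>] \<rho>[of \<theta>] by (simp add: \<kappa>_def normal_curvature_def norm_g1 power2_eq_square)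
    show "(\<kappa> has_real_derivative \<rho> \<theta> * k1 \<theta>) (at \<theta>)" by (rule d\<kappa>)
    show "(k1 has_real_derivative \<rho> \<theta> * (d \<theta> / \<rho> \<theta>)) (at \<theta>)" using d[of \<theta>] \<rho>[of \<theta>] by simp
  qed
  then show ?thesis unfolding \<rho>_def \<kappa>_def by blast
qed

end

section \<open>Frame components of the parameter derivatives of the velocity field\<close>

context framed_curve
begin

context
  fixes p :: real and E1 E2 :: "real \<Rightarrow> complex"
  assumes \<kappa>_pos: "\<And>\<theta>. \<kappa> \<theta> > 0"
    and E: "\<And>\<theta>. ((\<lambda>\<theta>. - (\<kappa> \<theta> powr p) *\<^sub>R \<nu> \<theta>) has_vector_derivative E1 \<theta>) (at \<theta>)"
    and E1: "\<And>\<theta>. (E1 has_vector_derivative E2 \<theta>) (at \<theta>)"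
begin

abbreviation (input) "f1 \<theta> \<equiv> p * \<kappa> \<theta> powr (p - 1) * k1 \<theta>"
abbreviation (input) "f2 \<theta> \<equiv> p * \<kappa> \<theta> powr (p - 1) * k2 \<theta> + p * (p - 1) * \<kappa> \<theta> powr (p - 2) * (k1 \<theta>)\<^sup>2"

lemma \<kappa>_powr_deriv: "((\<lambda>\<theta>. \<kappa> \<theta> powr q) has_real_derivative \<rho> \<theta> * (q * \<kappa> \<theta> powr (q - 1) * k1 \<theta>)) (at \<theta>)"
  by (rule DERIV_cong[OF DERIV_fun_powr[OF \<kappa>_deriv \<kappa>_pos]]) simp

lemma E1_eq: "E1 \<theta> = - (\<rho> \<theta> * f1 \<theta>) *\<^sub>R \<nu> \<theta> - (\<kappa> \<theta> powr p * \<kappa> \<theta> * \<rho> \<theta>) *\<^sub>R \<tau> \<theta>"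
proof (rule vector_derivative_unique_at[OF E])
  show "((\<lambda>\<theta>. - (\<kappa> \<theta> powr p) *\<^sub>R \<nu> \<theta>) has_vector_derivative
      - (\<rho> \<theta> * f1 \<theta>) *\<^sub>R \<nu> \<theta> - (\<kappa> \<theta> powr p * \<kappa> \<theta> * \<rho> \<theta>) *\<^sub>R \<tau> \<theta>) (at \<theta>)"
    by (rule has_vector_derivative_eq_rhs[OF has_vector_derivative_scaleR[OF DERIV_minus[OF \<kappa>_powr_deriv] \<nu>_deriv]])
      (simp add: algebra_simps)
qed

lemma E1_\<nu>: "E1 \<theta> \<bullet> \<nu> \<theta> = - (\<rho> \<theta> * f1 \<theta>)"
  unfolding E1_eq by (simp add: inner_diff_left rot)

lemma E1_\<tau>: "E1 \<theta> \<bullet> \<tau> \<theta> = - (\<kappa> \<theta> powr p * \<kappa> \<theta> * \<rho> \<theta>)"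
  unfolding E1_eq by (simp add: inner_diff_left rot)

text \<open>The scalar \<open>E1 \<theta> \<bullet> \<nu> \<theta>\<close> is differentiated in two
  ways: by the product rule, which brings in the known tangential component of \<open>E1\<close>,
  and through its explicit value \<open>E1_\<nu>\<close>.\<close>

lemma E2_\<nu>: "E2 \<theta> \<bullet> \<nu> \<theta> = - (\<rho>' \<theta> * f1 \<theta> + (\<rho> \<theta>)\<^sup>2 * f2 \<theta>) + \<kappa> \<theta> powr p * (\<kappa> \<theta>)\<^sup>2 * (\<rho> \<theta>)\<^sup>2"
proof -
  have "((\<lambda>\<theta>. E1 \<theta> \<bullet> \<nu> \<theta>) has_real_derivative E1 \<theta> \<bullet> ((\<kappa> \<theta> * \<rho> \<theta>) *\<^sub>R \<tau> \<theta>) + E2 \<theta> \<bullet> \<nu> \<theta>) (at \<theta>)"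
    by (rule inner_has_real_derivative[OF E1 \<nu>_deriv])
  moreover have "((\<lambda>\<theta>. E1 \<theta> \<bullet> \<nu> \<theta>) has_real_derivative - (\<rho>' \<theta> * f1 \<theta> + (\<rho> \<theta>)\<^sup>2 * f2 \<theta>)) (at \<theta>)"
    unfolding E1_\<nu>
    by (rule DERIV_cong[OF DERIV_minus[OF DERIV_mult[OF \<rho>_deriv DERIV_mult[OF DERIV_cmult[OF \<kappa>_powr_deriv] k1_deriv]]]])
      (simp add: algebra_simps power2_eq_square)
  ultimately have "E1 \<theta> \<bullet> ((\<kappa> \<theta> * \<rho> \<theta>) *\<^sub>R \<tau> \<theta>) + E2 \<theta> \<bullet> \<nu> \<theta> = - (\<rho>' \<theta> * f1 \<theta> + (\<rho> \<theta>)\<^sup>2 * f2 \<theta>)"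
    by (rule DERIV_unique)
  then show ?thesis by (simp add: E1_\<tau> power2_eq_square algebra_simps)
qed

end

end

section \<open>Convex curves and interior balls\<close>

lemma circle_deriv_cis:
  assumes "((\<lambda>\<theta>. c (cis \<theta>)) has_vector_derivative v) (at \<theta>)"
  shows "circle_deriv c (cis \<theta>) = v"
proof -
  have "((\<lambda>\<phi>. c (cis (\<theta> + \<phi>))) has_vector_derivative v) (at 0)"
  proof -
    have "((\<lambda>\<phi>. \<theta> + \<phi>) has_vector_derivative 1) (at 0)"
      by (auto intro!: derivative_eq_intros)
    then have "((\<lambda>x. c (cis x)) \<circ> (\<lambda>\<phi>. \<theta> + \<phi>) has_vector_derivative 1 *\<^sub>R v) (at 0)"
      by (rule vector_diff_chain_at) (use assms in simp)
    then show ?thesis by (simp add: o_def)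
  qed
  then show ?thesis
    unfolding circle_deriv_def cis_mult by (rule vector_derivative_at)
qed

lemma sphere_eq_cis_interval: "sphere 0 1 = cis ` {0..2*pi}"
proof -
  have "z \<in> cis ` {0..2*pi}" if "norm z = 1" for z
  proof -
    have "(Re z)\<^sup>2 + (Im z)\<^sup>2 = 1" using that by (simp add: cmod_def)
    then obtain s where "0 \<le> s" "s \<le> 2*pi" "Re z = cos s" "Im z = sin s"
      using sincos_total_2pi_le by blast
    then show ?thesis by (intro image_eqI[of _ _ s]) (auto simp: complex_eq_iff)
  qed
  then show ?thesis by (auto simp: norm_cis)
qed

lemma sphere_eq_cis: "sphere 0 1 = range cis"
  using sphere_eq_cis_interval norm_cis by (fastforce simp: image_iff)

lemma curve_eq_range: "curve c = range (\<lambda>\<theta>. c (cis \<theta>))"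
  unfolding curve_def sphere_eq_cis by auto

locale convex_curve =
  fixes c :: "complex \<Rightarrow> complex" and \<gamma>1 :: "real \<Rightarrow> complex"
  assumes emb: "smooth_convex_embedding c"
    and deriv: "\<And>\<theta>. ((\<lambda>\<theta>. c (cis \<theta>)) has_vector_derivative \<gamma>1 \<theta>) (at \<theta>)"
begin

abbreviation "\<gamma> \<equiv> \<lambda>\<theta>. c (cis \<theta>)"
abbreviation "\<nu> \<equiv> \<lambda>\<theta>. outward_normal c (cis \<theta>)"

lemma circle_deriv [simp]: "circle_deriv c (cis \<theta>) = \<gamma>1 \<theta>"
  by (rule circle_deriv_cis) (rule deriv)

lemma \<gamma>1_nonzero: "\<gamma>1 \<theta> \<noteq> 0"
proof -
  have "cis \<theta> \<in> sphere 0 1" by (simp add: norm_cis)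
  then show ?thesis
    using emb circle_deriv unfolding smooth_convex_embedding_def smooth_embedding_def by metis
qed

lemma inj: "inj_on c (sphere 0 1)"
  using emb unfolding smooth_convex_embedding_def smooth_embedding_def by auto

lemma continuous_\<gamma>: "continuous_on UNIV \<gamma>"
  using deriv by (meson continuous_at_imp_continuous_on has_vector_derivative_continuous)

text \<open>The Jordan curve theorem, applied to the curve reparametrized over the unit interval.
  The last identity holds because the curve and its inside together form the closure of the
  region.\<close>

lemma
  shows region_nonempty: "region c \<noteq> {}"
    and open_region: "open (region c)"
    and frontier_region: "frontier (region c) = curve c"
    and outside_curve: "outside (curve c) = - closure (region c)"
proof -
  define g where "g = (\<lambda>s::real. c (cis (2 * pi * s)))"
  have "continuous_on {0..1} g"
    unfolding g_def by (rule continuous_on_compose2[OF continuous_\<gamma>]) (auto intro!: continuous_intros)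
  then have "path g" by (simp add: path_def)
  moreover have "loop_free g"
  proof (unfold loop_free_def, intro ballI impI)
    fix x y :: real assume xy: "x \<in> {0..1}" "y \<in> {0..1}" "g x = g y"
    then have "cis (2*pi*x) = cis (2*pi*y)"
      using inj by (auto simp: g_def inj_on_def norm_cis)
    then have "sin (2*pi*x) = sin (2*pi*y) \<and> cos (2*pi*x) = cos (2*pi*y)"
      by (simp add: complex_eq_iff)
    then obtain k :: int where "2*pi*x = 2*pi*y + 2*pi*k"
      unfolding sin_cos_eq_iff by blast
    then have "2*pi*x = 2*pi*(y + of_int k)" by (simp add: distrib_left)
    then have k: "x = y + of_int k" using mult_left_cancel[of "2*pi" x "y + of_int k"] by simp
    then have "of_int k \<le> (1::real)" "of_int k \<ge> (-1::real)" using xy by auto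
    then have "k \<in> {-1,0,1}" by auto
    then show "x = y \<or> x = 0 \<and> y = 1 \<or> x = 1 \<and> y = 0"
      using k xy by auto
  qed
  ultimately have sp: "simple_path g" by (simp add: simple_path_def)
  have lp: "pathfinish g = pathstart g"
    unfolding pathfinish_def pathstart_def g_def mult_1_right mult_zero_right cis_2pi cis_zero ..
  have img: "path_image g = curve c"
  proof -
    have "g ` {0..1} = c ` cis ` (\<lambda>s. 2 * pi * s) ` {0..1}" by (simp only: image_image g_def)
    also have "(\<lambda>s. 2 * pi * s) ` {0..1} = {0..2*pi}" by (simp add: image_mult_atLeastAtMost)
    finally show ?thesis
      unfolding path_image_def curve_def sphere_eq_cis_interval .
  qed
  show "region c \<noteq> {}" "open (region c)" and f: "frontier (region c) = curve c"
    using Jordan_inside_outside[OF sp lp] by (auto simp: img region_def)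
  show "outside (curve c) = - closure (region c)"
    using f union_with_inside[of "curve c"] closure_Un_frontier[of "region c"]
    by (auto simp: region_def)
qed

lemma convex_region: "convex (region c)"
  using emb unfolding smooth_convex_embedding_def by auto

lemma curve_subset_closure: "\<gamma> \<theta> \<in> closure (region c)"
  using frontier_region closure_Un_frontier curve_eq_range by blast

lemma curve_notin_region: "\<gamma> \<theta> \<notin> region c"
proof -
  have "\<gamma> \<theta> \<in> curve c" by (simp add: curve_eq_range)
  then show ?thesis using inside_no_overlap[of "curve c"] unfolding region_def by blast
qed

lemma support_le_closure:
  assumes "\<And>y. y \<in> region c \<Longrightarrow> n \<bullet> y \<le> b" "y \<in> closure (region c)"
  shows "n \<bullet> y \<le> b"
proof -
  have "closure (region c) \<subseteq> {y. n \<bullet> y \<le> b}"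
    by (rule closure_minimal) (use assms(1) in \<open>auto simp: closed_halfspace_le\<close>)
  then show ?thesis using assms(2) by auto
qed

lemma support_orthogonal:
  assumes "\<And>\<eta>. n \<bullet> \<gamma> \<eta> \<le> n \<bullet> \<gamma> \<theta>"
  shows "n \<bullet> \<gamma>1 \<theta> = 0"
proof -
  have "((\<lambda>\<eta>. n \<bullet> \<gamma> \<eta>) has_vector_derivative n \<bullet> \<gamma>1 \<theta>) (at \<theta>)"
    by (rule bounded_linear.has_vector_derivative[OF bounded_linear_inner_right deriv])
  then have "((\<lambda>\<eta>. n \<bullet> \<gamma> \<eta>) has_real_derivative n \<bullet> \<gamma>1 \<theta>) (at \<theta>)"
    by (simp add: has_real_derivative_iff_has_vector_derivative)
  then show ?thesis
    by (rule DERIV_local_max[of _ _ _ 1]) (use assms in auto)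
qed

lemma open_not_in_halfspace_boundary:
  assumes "n \<noteq> 0" "\<And>y. y \<in> region c \<Longrightarrow> n \<bullet> y \<le> b" "y \<in> region c"
  shows "n \<bullet> y < b"
proof -
  obtain e where e: "e > 0" "ball y e \<subseteq> region c"
    using open_region assms(3) openE by blast
  define y' where "y' = y + (e/2/norm n) *\<^sub>R n"
  have "y' \<in> ball y e" using e(1) assms(1) by (simp add: y'_def dist_norm)
  then have "n \<bullet> y' \<le> b" using e assms by blast
  moreover have "n \<bullet> y' = n \<bullet> y + (e/2/norm n) * (n \<bullet> n)" by (simp add: y'_def inner_add_right)
  moreover have "(e/2/norm n) * (n \<bullet> n) > 0" using e(1) assms(1) by simp
  ultimately show ?thesis by linarith
qed

lemma support_exists:
  obtains n where "norm n = 1" "\<And>y. y \<in> closure (region c) \<Longrightarrow> n \<bullet> y \<le> n \<bullet> \<gamma> \<theta>"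
proof -
  obtain a b where a: "a \<noteq> 0" "\<And>y. y \<in> region c \<Longrightarrow> a \<bullet> y \<le> b" "a \<bullet> \<gamma> \<theta> \<ge> b"
    using separating_hyperplane_sets[OF convex_region, of "{\<gamma> \<theta>}"] region_nonempty curve_notin_region by auto
  have "a \<bullet> y \<le> a \<bullet> \<gamma> \<theta>" if "y \<in> closure (region c)" for y
    using support_le_closure[OF a(2) that] a(3) by linarith
  then show ?thesis
    by (intro that[of "a /\<^sub>R norm a"]) (use a(1) in \<open>auto simp: divide_right_mono\<close>)
qed

text \<open>Were the inward normal ray disjoint from the region, a line would separate them. It
  passes through \<open>\<gamma> \<theta>\<close>, so it is a second supporting line there. As the
  tangent is unique, its normal \<open>a\<close> is a multiple of \<open>n\<close>, a negative one
  since the ray lies on the far side. This contradicts the strict support inequality at points of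
  the open region. Once the ray meets the region, convexity gives all points between.\<close>

lemma inward_points:
  assumes n: "norm n = 1" "\<And>y. y \<in> closure (region c) \<Longrightarrow> n \<bullet> y \<le> n \<bullet> \<gamma> \<theta>"
  shows "\<forall>\<^sub>F s in at_right 0. \<gamma> \<theta> - s *\<^sub>R n \<in> region c"
proof -
  have nn: "n \<bullet> n = 1" using n(1) by (simp add: norm_eq_1)
  have nz: "n \<noteq> 0" using n(1) by auto
  have orth: "n \<bullet> \<gamma>1 \<theta> = 0"
    by (rule support_orthogonal) (use n(2) curve_subset_closure in auto)
  obtain s0 where s0: "s0 > 0" "\<gamma> \<theta> - s0 *\<^sub>R n \<in> region c"
  proof (rule ccontr)
    assume neg: "\<not> thesis"
    define L where "L = (\<lambda>s. \<gamma> \<theta> - s *\<^sub>R n) ` {0<..}"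
    have "L = (\<lambda>y. \<gamma> \<theta> + y) ` (\<lambda>s. s *\<^sub>R (-n)) ` {0<..}" unfolding L_def by (auto simp: image_image)
    moreover have "convex ((\<lambda>s::real. s *\<^sub>R (-n)) ` {0<..})"
      by (rule convex_linear_image[OF bounded_linear.linear[OF bounded_linear_scaleR_left]]) simp
    ultimately have "convex L" by (metis convex_translation)
    moreover have "L \<noteq> {}" "region c \<inter> L = {}" using neg that by (auto simp: L_def)
    ultimately obtain a b where a: "a \<noteq> 0" "\<And>y. y \<in> region c \<Longrightarrow> a \<bullet> y \<le> b"
        "\<And>y. y \<in> L \<Longrightarrow> a \<bullet> y \<ge> b"
      using separating_hyperplane_sets[OF convex_region _ region_nonempty, of L] by metis
    have L: "a \<bullet> \<gamma> \<theta> - s * (a \<bullet> n) \<ge> b" if "s > 0" for s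
      using a(3)[of "\<gamma> \<theta> - s *\<^sub>R n"] that by (auto simp: L_def inner_diff_right)
    have "((\<lambda>s. a \<bullet> \<gamma> \<theta> - s * (a \<bullet> n)) \<longlongrightarrow> a \<bullet> \<gamma> \<theta> - 0 * (a \<bullet> n)) (at_right 0)"
      by (intro tendsto_intros)
    then have "b \<le> a \<bullet> \<gamma> \<theta> - 0 * (a \<bullet> n)"
      by (rule tendsto_lowerbound) (auto simp: eventually_at_right_less L intro!: eventually_at_rightI[of 0 1])
    then have ab: "a \<bullet> \<gamma> \<theta> = b" 
      using support_le_closure[OF a(2) curve_subset_closure, of \<theta>] by auto
    have "a \<bullet> \<gamma>1 \<theta> = 0"
      by (rule support_orthogonal) (use support_le_closure[OF a(2) curve_subset_closure] ab in auto)
    then have par: "a = (a \<bullet> n) *\<^sub>R n"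
      using orthogonal_parallel[OF \<gamma>1_nonzero orth] n(1) by blast
    have "a \<bullet> n \<le> 0" using L[of 1] ab by simp
    then have an: "a \<bullet> n < 0" using par a(1) by (metis less_eq_real_def scaleR_zero_left)
    obtain y where y: "y \<in> region c" using region_nonempty by auto
    have "n \<bullet> y < n \<bullet> \<gamma> \<theta>"
      by (rule open_not_in_halfspace_boundary[OF nz _ y]) (use n(2) closure_subset in blast)
    moreover have "a \<bullet> y \<le> a \<bullet> \<gamma> \<theta>" using a(2)[OF y] ab by simp
    then have "(a \<bullet> n) * (n \<bullet> y) \<le> (a \<bullet> n) * (n \<bullet> \<gamma> \<theta>)"
      using par by (metis inner_scaleR_left)
    ultimately show False using an by (simp add: mult_le_cancel_left)
  qed
  have "\<gamma> \<theta> - s *\<^sub>R n \<in> region c" if s: "s \<in> {0<..<s0}" for s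
  proof -
    have "\<gamma> \<theta> - s0 *\<^sub>R n \<in> interior (region c)" using s0 open_region by (simp add: interior_open)
    then have "\<gamma> \<theta> - (s/s0) *\<^sub>R (\<gamma> \<theta> - (\<gamma> \<theta> - s0 *\<^sub>R n)) \<in> interior (region c)"
      by (rule mem_interior_closure_convex_shrink[OF convex_region]) (use curve_subset_closure s in auto)
    then show ?thesis using s interior_subset by auto
  qed
  then show ?thesis using s0(1) by (intro eventually_at_rightI) auto
qed

text \<open>Any competitor is orthogonal to the tangent, hence \<open>n\<close> or
  \<open>-n\<close>. The support inequality puts the ray along \<open>n\<close> outside, while
  \<open>inward_points\<close> puts the beginning of the opposite ray inside.\<close>

lemma outward_normal_unique:
  assumes n: "norm n = 1" "\<And>y. y \<in> closure (region c) \<Longrightarrow> n \<bullet> y \<le> n \<bullet> \<gamma> \<theta>"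
  shows "\<nu> \<theta> = n"
  unfolding outward_normal_def
proof (rule the_equality, intro conjI)
  have nn: "n \<bullet> n = 1" using n(1) by (simp add: norm_eq_1)
  have orth: "n \<bullet> \<gamma>1 \<theta> = 0"
    by (rule support_orthogonal) (use n(2) curve_subset_closure in auto)
  show "norm n = 1" by fact
  show "n \<bullet> circle_deriv c (cis \<theta>) = 0" using orth by simp
  have out: "\<gamma> \<theta> + s *\<^sub>R n \<in> outside (curve c)" if "s > 0" for s
    using n(2)[of "\<gamma> \<theta> + s *\<^sub>R n"] that unfolding outside_curve by (auto simp: inner_add_right nn)
  then show "\<forall>\<^sub>F s in at_right 0. \<gamma> \<theta> + s *\<^sub>R n \<in> outside (curve c)"
    by (auto simp: eventually_at_right_less intro!: eventually_at_rightI[of 0 1])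
  fix m assume m: "norm m = 1 \<and> m \<bullet> circle_deriv c (cis \<theta>) = 0 \<and>
    (\<forall>\<^sub>F s in at_right 0. \<gamma> \<theta> + s *\<^sub>R m \<in> outside (curve c))"
  then have par: "m = (m \<bullet> n) *\<^sub>R n"
    using orthogonal_parallel[OF \<gamma>1_nonzero orth] n(1) by auto
  then have "\<bar>m \<bullet> n\<bar> = 1" using m n(1) by (metis mult.right_neutral norm_scaleR real_norm_def)
  then consider "m \<bullet> n = 1" | "m \<bullet> n = -1" by linarith
  then show "m = n"
  proof cases
    case 2
    then have "m = -n" using par by simp
    then have "\<forall>\<^sub>F s in at_right 0. \<gamma> \<theta> + s *\<^sub>R (-n) \<in> outside (curve c)" using m by blast
    moreover have "\<forall>\<^sub>F s in at_right 0. \<gamma> \<theta> - s *\<^sub>R n \<in> region c" by (rule inward_points[OF n])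
    ultimately have "\<forall>\<^sub>F s in at_right (0::real). False"
    proof eventually_elim
      case (elim s)
      then have "\<gamma> \<theta> - s *\<^sub>R n \<in> inside (curve c) \<inter> outside (curve c)"
        by (intro IntI) (simp_all add: region_def)
      then show ?case by (simp only: inside_Int_outside empty_iff)
    qed
    then show ?thesis by simp
  qed (use par in simp)
qed

lemma normal:
  shows norm_normal: "norm (\<nu> \<theta>) = 1"
    and normal_support: "y \<in> closure (region c) \<Longrightarrow> \<nu> \<theta> \<bullet> y \<le> \<nu> \<theta> \<bullet> \<gamma> \<theta>"
    and normal_inward: "\<forall>\<^sub>F s in at_right 0. \<gamma> \<theta> - s *\<^sub>R \<nu> \<theta> \<in> region c"
    and normal_orth: "\<nu> \<theta> \<bullet> \<gamma>1 \<theta> = 0"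
proof -
  obtain n where n: "norm n = 1" "\<And>y. y \<in> closure (region c) \<Longrightarrow> n \<bullet> y \<le> n \<bullet> \<gamma> \<theta>"
    using support_exists by blast
  have e: "\<nu> \<theta> = n" by (rule outward_normal_unique[OF n])
  show "norm (\<nu> \<theta>) = 1" "y \<in> closure (region c) \<Longrightarrow> \<nu> \<theta> \<bullet> y \<le> \<nu> \<theta> \<bullet> \<gamma> \<theta>"
     "\<forall>\<^sub>F s in at_right 0. \<gamma> \<theta> - s *\<^sub>R \<nu> \<theta> \<in> region c"
    using n inward_points[OF n] by (auto simp: e)
  show "\<nu> \<theta> \<bullet> \<gamma>1 \<theta> = 0"
    unfolding e by (rule support_orthogonal) (use n(2) curve_subset_closure in auto)
qed

lemma normal_support_curve: "\<nu> \<theta> \<bullet> (\<gamma> \<eta> - \<gamma> \<theta>) \<le> 0"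
  using normal_support[OF curve_subset_closure, of \<theta> \<eta>] by (simp add: inner_diff_right)

text \<open>Otherwise the curve lies in its tangent line. At an extreme point along that line the
  velocity is orthogonal both to the normal and to the line, hence zero, which regularity excludes.
  The strict inequality makes the choice of normal stable in
  \<open>orientation_constant\<close>.\<close>

lemma normal_support_strict: "\<exists>\<eta>. \<nu> \<theta> \<bullet> (\<gamma> \<eta> - \<gamma> \<theta>) < 0"
proof (rule ccontr)
  assume "\<not> ?thesis"
  then have e: "\<nu> \<theta> \<bullet> \<gamma> \<eta> = \<nu> \<theta> \<bullet> \<gamma> \<theta>" for \<eta>
    using normal_support_curve[of \<theta> \<eta>] by (auto simp: inner_diff_right not_less intro: antisym)
  have o: "\<nu> \<theta> \<bullet> \<gamma>1 \<eta> = 0" for \<eta>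
    by (rule support_orthogonal) (metis e order_refl)
  have "\<exists>\<eta>. \<forall>\<phi>. (\<i> * \<nu> \<theta>) \<bullet> \<gamma> \<phi> \<le> (\<i> * \<nu> \<theta>) \<bullet> \<gamma> \<eta>"
  proof -
    have "compact (curve c)"
    proof -
      have "curve c = \<gamma> ` {0..2*pi}"
        by (simp add: curve_def sphere_eq_cis_interval image_image)
      then show ?thesis
        using compact_continuous_image[OF continuous_on_subset[OF continuous_\<gamma> subset_UNIV]] by simp
    qed
    moreover have "curve c \<noteq> {}" by (simp add: curve_eq_range)
    moreover have "continuous_on (curve c) (\<lambda>z. (\<i> * \<nu> \<theta>) \<bullet> z)" by (intro continuous_intros)
    ultimately obtain y where "y \<in> curve c" "\<forall>z\<in>curve c. (\<i> * \<nu> \<theta>) \<bullet> z \<le> (\<i> * \<nu> \<theta>) \<bullet> y"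
      using continuous_attains_sup by blast
    then show ?thesis by (auto simp: curve_eq_range)
  qed
  then obtain \<eta> where "\<And>\<phi>. (\<i> * \<nu> \<theta>) \<bullet> \<gamma> \<phi> \<le> (\<i> * \<nu> \<theta>) \<bullet> \<gamma> \<eta>" by blast
  then have "(\<i> * \<nu> \<theta>) \<bullet> \<gamma>1 \<eta> = 0" by (rule support_orthogonal)
  then have "\<i> * \<nu> \<theta> = ((\<i> * \<nu> \<theta>) \<bullet> \<nu> \<theta>) *\<^sub>R \<nu> \<theta>"
    by (intro orthogonal_parallel[OF \<gamma>1_nonzero[of \<eta>]]) (use o norm_normal in auto)
  moreover have "(\<i> * \<nu> \<theta>) \<bullet> \<nu> \<theta> = 0" by (simp add: inner_complex_def)
  ultimately show False using norm_normal[of \<theta>] by auto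
qed

text \<open>A ball inside the region contains no curve point, so \<open>\<gamma> \<theta>\<close> is
  a curve point closest to its centre. The centre is thus on the normal line, and on the inner side
  by the support inequality. Conversely, the inequality keeps the curve out of the ball centred at
  \<open>\<gamma> \<theta> - r *\<^sub>R \<nu> \<theta>\<close>; this connected set meets the region
  near \<open>\<gamma> \<theta>\<close> and misses its frontier, so it lies inside.\<close>

lemma interior_ball_iff:
  assumes r: "r > 0"
  shows "(\<exists>a. ball a r \<subseteq> region c \<and> \<gamma> \<theta> \<in> frontier (ball a r)) \<longleftrightarrow>
    (\<forall>\<eta>. (norm (\<gamma> \<theta> - \<gamma> \<eta>))\<^sup>2 \<ge> 2 * r * ((\<gamma> \<theta> - \<gamma> \<eta>) \<bullet> \<nu> \<theta>))"
proof -
  have nn: "\<nu> \<theta> \<bullet> \<nu> \<theta> = 1" using norm_normal[of \<theta>] by (simp add: norm_eq_1)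
  have key: "(norm (\<gamma> \<eta> - (\<gamma> \<theta> - r *\<^sub>R \<nu> \<theta>)))\<^sup>2 =
      r\<^sup>2 + ((norm (\<gamma> \<theta> - \<gamma> \<eta>))\<^sup>2 - 2 * r * ((\<gamma> \<theta> - \<gamma> \<eta>) \<bullet> \<nu> \<theta>))" for \<eta>
    unfolding power2_norm_eq_inner
    by (simp add: inner_diff_left inner_diff_right nn algebra_simps power2_eq_square inner_commute)
  show ?thesis
  proof
    assume "\<exists>a. ball a r \<subseteq> region c \<and> \<gamma> \<theta> \<in> frontier (ball a r)"
    then obtain a where a: "ball a r \<subseteq> region c" "dist a (\<gamma> \<theta>) = r"
      using r by auto
    have far: "dist a (\<gamma> \<eta>) \<ge> r" for \<eta>
    proof (rule ccontr)
      assume "\<not> ?thesis"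
      then have "\<gamma> \<eta> \<in> region c" using a(1) by (auto simp: not_le)
      then show False using curve_notin_region by blast
    qed
    have "((\<lambda>\<eta>. (\<gamma> \<eta> - a) \<bullet> (\<gamma> \<eta> - a)) has_vector_derivative
        (\<gamma> \<theta> - a) \<bullet> (\<gamma>1 \<theta>) + (\<gamma>1 \<theta>) \<bullet> (\<gamma> \<theta> - a)) (at \<theta>)"
      using deriv[of \<theta>] by (auto intro!: derivative_eq_intros bounded_bilinear.has_vector_derivative[OF bounded_bilinear_inner])
    then have "((\<lambda>\<eta>. (\<gamma> \<eta> - a) \<bullet> (\<gamma> \<eta> - a)) has_real_derivative
        (\<gamma> \<theta> - a) \<bullet> (\<gamma>1 \<theta>) + (\<gamma>1 \<theta>) \<bullet> (\<gamma> \<theta> - a)) (at \<theta>)"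
      by (simp add: has_real_derivative_iff_has_vector_derivative)
    then have "(\<gamma> \<theta> - a) \<bullet> (\<gamma>1 \<theta>) + (\<gamma>1 \<theta>) \<bullet> (\<gamma> \<theta> - a) = 0"
      by (rule DERIV_local_min[of _ _ _ 1])
        (use far a(2) in \<open>auto simp: dot_square_norm dist_norm norm_minus_commute\<close>)
    then have "(\<gamma> \<theta> - a) \<bullet> \<gamma>1 \<theta> = 0" by (simp add: inner_commute)
    then have par: "\<gamma> \<theta> - a = ((\<gamma> \<theta> - a) \<bullet> \<nu> \<theta>) *\<^sub>R \<nu> \<theta>"
      using orthogonal_parallel[OF \<gamma>1_nonzero normal_orth] norm_normal by blast
    have "\<bar>(\<gamma> \<theta> - a) \<bullet> \<nu> \<theta>\<bar> = r"
      using a(2) par norm_normal[of \<theta>] by (metis dist_norm dist_commute mult.right_neutral norm_scaleR real_norm_def)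
    moreover have "(\<gamma> \<theta> - a) \<bullet> \<nu> \<theta> \<ge> 0"
    proof -
      have "a \<in> closure (region c)" using a(1) r closure_subset by fastforce
      then show ?thesis using normal_support[of a \<theta>] by (simp add: inner_diff_left inner_diff_right inner_commute)
    qed
    ultimately have "a = \<gamma> \<theta> - r *\<^sub>R \<nu> \<theta>" using par by (simp add: algebra_simps)
    then have "r\<^sup>2 \<le> (norm (\<gamma> \<eta> - (\<gamma> \<theta> - r *\<^sub>R \<nu> \<theta>)))\<^sup>2" for \<eta>
      using far[of \<eta>] r by (intro power_mono) (auto simp: dist_norm norm_minus_commute)
    then show "\<forall>\<eta>. (norm (\<gamma> \<theta> - \<gamma> \<eta>))\<^sup>2 \<ge> 2 * r * ((\<gamma> \<theta> - \<gamma> \<eta>) \<bullet> \<nu> \<theta>)"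
      unfolding key by simp
  next
    assume R: "\<forall>\<eta>. (norm (\<gamma> \<theta> - \<gamma> \<eta>))\<^sup>2 \<ge> 2 * r * ((\<gamma> \<theta> - \<gamma> \<eta>) \<bullet> \<nu> \<theta>)"
    define a where "a = \<gamma> \<theta> - r *\<^sub>R \<nu> \<theta>"
    have "r\<^sup>2 \<le> (norm (\<gamma> \<eta> - a))\<^sup>2" for \<eta> using R key[of \<eta>] by (simp add: a_def)
    then have "r \<le> norm (\<gamma> \<eta> - a)" for \<eta> using power2_le_imp_le norm_ge_zero by blast
    then have "\<gamma> \<eta> \<notin> ball a r" for \<eta>
      by (metis dist_commute dist_norm linorder_not_le mem_ball)
    then have disj: "ball a r \<inter> frontier (region c) = {}"
      unfolding frontier_region curve_eq_range by blast
    have "\<forall>\<^sub>F s in at_right 0. s < r" using r eventually_at_right_real[OF r] by (auto elim: eventually_mono)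
    with normal_inward[of \<theta>] eventually_at_right_less[of 0]
    have "\<forall>\<^sub>F s in at_right 0. \<gamma> \<theta> - s *\<^sub>R \<nu> \<theta> \<in> region c \<and> 0 < s \<and> s < r"
      by eventually_elim auto
    then obtain s where s: "\<gamma> \<theta> - s *\<^sub>R \<nu> \<theta> \<in> region c" "0 < s" "s < r"
      using eventually_happens'[OF trivial_limit_at_right_real] by blast
    have "a - (\<gamma> \<theta> - s *\<^sub>R \<nu> \<theta>) = (s - r) *\<^sub>R \<nu> \<theta>" by (simp add: a_def algebra_simps)
    then have "\<gamma> \<theta> - s *\<^sub>R \<nu> \<theta> \<in> ball a r"
      using s norm_normal[of \<theta>] by (simp add: dist_norm)
    then have "ball a r \<subseteq> region c"
      using connected_Int_frontier[of "ball a r" "region c"] s(1) disj by fastforce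
    moreover have "\<gamma> \<theta> \<in> frontier (ball a r)"
      using r norm_normal[of \<theta>] by (simp add: a_def dist_norm)
    ultimately show "\<exists>a. ball a r \<subseteq> region c \<and> \<gamma> \<theta> \<in> frontier (ball a r)" by blast
  qed
qed

lemma non_collapsed_iff:
  assumes \<mu>: "\<mu> > 0"
  shows "non_collapsed \<mu> c \<longleftrightarrow> (\<forall>\<theta>. curvature c (cis \<theta>) > 0 \<and>
    (\<forall>\<eta>. 0 \<le> \<mu> * curvature c (cis \<theta>) / 2 * (norm (\<gamma> \<theta> - \<gamma> \<eta>))\<^sup>2 - (\<gamma> \<theta> - \<gamma> \<eta>) \<bullet> \<nu> \<theta>))"
proof -
  have "(\<exists>a. ball a (1 / (\<mu> * curvature c (cis \<theta>))) \<subseteq> region c \<and>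
      \<gamma> \<theta> \<in> frontier (ball a (1 / (\<mu> * curvature c (cis \<theta>))))) \<longleftrightarrow>
    (\<forall>\<eta>. 0 \<le> \<mu> * curvature c (cis \<theta>) / 2 * (norm (\<gamma> \<theta> - \<gamma> \<eta>))\<^sup>2 - (\<gamma> \<theta> - \<gamma> \<eta>) \<bullet> \<nu> \<theta>)"
    if "curvature c (cis \<theta>) > 0" for \<theta>
    by (subst interior_ball_iff) (use that \<mu> in \<open>auto simp: field_simps\<close>)
  then show ?thesis
    unfolding non_collapsed_def sphere_eq_cis by auto
qed

end

section \<open>Partial derivatives of smooth functions\<close>

lemma Ck_on_imp_continuous_on: "Ck_on k S f \<Longrightarrow> continuous_on S f"
  by (cases k) (auto intro: has_derivative_continuous_on)

text \<open>The partial derivatives are the total derivative evaluated at (1, 0) and (0, 1), and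
  \<open>Ck_on\<close> grants regularity to exactly such evaluations.\<close>

lemma Ck_on_partials:
  fixes f :: "real \<times> real \<Rightarrow> 'b::real_normed_vector"
  assumes "Ck_on (Suc k) (UNIV \<times> I) f"
  obtains f1 f2 where "Ck_on k (UNIV \<times> I) f1" "Ck_on k (UNIV \<times> I) f2"
    "\<And>\<theta> t. t \<in> I \<Longrightarrow> ((\<lambda>\<theta>. f (\<theta>, t)) has_vector_derivative f1 (\<theta>, t)) (at \<theta>)"
    "\<And>\<theta> t. t \<in> I \<Longrightarrow> ((\<lambda>t. f (\<theta>, t)) has_vector_derivative f2 (\<theta>, t)) (at t within I)"
proof -
  obtain f' where f': "\<And>z. z \<in> UNIV \<times> I \<Longrightarrow> (f has_derivative f' z) (at z within UNIV \<times> I)"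
    and Ck: "\<And>v. Ck_on k (UNIV \<times> I) (\<lambda>z. f' z v)"
    using assms by auto
  have 1: "((\<lambda>\<theta>. f (\<theta>, t)) has_vector_derivative f' (\<theta>, t) (1, 0)) (at \<theta>)" if "t \<in> I" for \<theta> t
  proof -
    have "((\<lambda>\<theta>. f (\<theta>, t)) has_derivative (\<lambda>s. f' (\<theta>, t) (s, 0))) (at \<theta> within UNIV)"
      by (rule has_derivative_in_compose2[OF f', where s = UNIV])
        (use that in \<open>auto intro!: derivative_eq_intros\<close>)
    moreover have "(\<lambda>s. f' (\<theta>, t) (s, 0)) = (\<lambda>s. s *\<^sub>R f' (\<theta>, t) (1, 0))"
    proof
      fix s :: real
      have "linear (f' (\<theta>, t))" by (rule has_derivative_linear[OF f']) (use that in simp)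
      then have "f' (\<theta>, t) (s *\<^sub>R (1, 0)) = s *\<^sub>R f' (\<theta>, t) (1, 0)" by (rule linear_scale)
      then show "f' (\<theta>, t) (s, 0) = s *\<^sub>R f' (\<theta>, t) (1, 0)" by (simp only: scaleR_Pair scaleR_zero_right real_scaleR_def mult_1_right mult_zero_right)
    qed
    ultimately show ?thesis by (simp only: has_vector_derivative_def)
  qed
  have 2: "((\<lambda>t. f (\<theta>, t)) has_vector_derivative f' (\<theta>, t) (0, 1)) (at t within I)" if "t \<in> I" for \<theta> t
  proof -
    have "((\<lambda>t. f (\<theta>, t)) has_derivative (\<lambda>s. f' (\<theta>, t) (0, s))) (at t within I)"
      by (rule has_derivative_in_compose2[OF f', where s = I])
        (use that in \<open>auto intro!: derivative_eq_intros\<close>)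
    moreover have "(\<lambda>s. f' (\<theta>, t) (0, s)) = (\<lambda>s. s *\<^sub>R f' (\<theta>, t) (0, 1))"
    proof
      fix s :: real
      have "linear (f' (\<theta>, t))" by (rule has_derivative_linear[OF f']) (use that in simp)
      then have "f' (\<theta>, t) (s *\<^sub>R (0, 1)) = s *\<^sub>R f' (\<theta>, t) (0, 1)" by (rule linear_scale)
      then show "f' (\<theta>, t) (0, s) = s *\<^sub>R f' (\<theta>, t) (0, 1)" by (simp only: scaleR_Pair scaleR_zero_right real_scaleR_def mult_1_right mult_zero_right)
    qed
    ultimately show ?thesis by (simp only: has_vector_derivative_def)
  qed
  show ?thesis by (rule that[OF Ck Ck 1 2])
qed

text \<open>The second difference \<open>\<Delta>\<close> over a square of side \<open>h\<close> is,
  by the mean value theorem used in either order, \<open>h * h\<close> times each mixed derivative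
  at some point of the square. Were the two derivatives different at the corner, continuity would
  keep them apart on a small square.\<close>

lemma mixed_partials_real:
  fixes u u1 u2 u12 u21 :: "real \<Rightarrow> real \<Rightarrow> real"
  assumes J: "open J" "t \<in> J"
    and u1: "\<And>\<theta> t. t \<in> J \<Longrightarrow> ((\<lambda>\<theta>. u \<theta> t) has_real_derivative u1 \<theta> t) (at \<theta>)"
    and u12: "\<And>\<theta> t. t \<in> J \<Longrightarrow> ((\<lambda>t. u1 \<theta> t) has_real_derivative u12 \<theta> t) (at t)"
    and u2: "\<And>\<theta> t. t \<in> J \<Longrightarrow> ((\<lambda>t. u \<theta> t) has_real_derivative u2 \<theta> t) (at t)"
    and u21: "\<And>\<theta> t. t \<in> J \<Longrightarrow> ((\<lambda>\<theta>. u2 \<theta> t) has_real_derivative u21 \<theta> t) (at \<theta>)"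
    and c12: "continuous_on (UNIV \<times> J) (\<lambda>(\<theta>, t). u12 \<theta> t)"
    and c21: "continuous_on (UNIV \<times> J) (\<lambda>(\<theta>, t). u21 \<theta> t)"
  shows "u12 \<theta> t = u21 \<theta> t"
proof (rule ccontr)
  assume neq: "u12 \<theta> t \<noteq> u21 \<theta> t"
  define e where "e = \<bar>u12 \<theta> t - u21 \<theta> t\<bar> / 2"
  have e: "e > 0" using neq by (simp add: e_def)
  have U: "(\<theta>, t) \<in> UNIV \<times> J" using J by simp
  obtain d1 where d1: "d1 > 0" "\<And>z. z \<in> UNIV \<times> J \<Longrightarrow> dist z (\<theta>, t) < d1 \<Longrightarrow>
      dist (u12 (fst z) (snd z)) (u12 \<theta> t) < e"
    using c12[unfolded continuous_on_iff, rule_format, OF U e] by (auto simp: case_prod_beta)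
  obtain d2 where d2: "d2 > 0" "\<And>z. z \<in> UNIV \<times> J \<Longrightarrow> dist z (\<theta>, t) < d2 \<Longrightarrow>
      dist (u21 (fst z) (snd z)) (u21 \<theta> t) < e"
    using c21[unfolded continuous_on_iff, rule_format, OF U e] by (auto simp: case_prod_beta)
  obtain d3 where d3: "d3 > 0" "ball t d3 \<subseteq> J" using J openE by blast
  define h where "h = min (min d1 d2) d3 / 3"
  have h: "h > 0" "2 * h < d1" "2 * h < d2" "h < d3" using d1(1) d2(1) d3(1) by (auto simp: h_def)
  have tJ: "s \<in> J" if "t \<le> s" "s \<le> t + h" for s
    using d3(2) that h by (auto simp: dist_real_def)
  have near: "dist (\<xi>, \<zeta>) (\<theta>, t) \<le> 2 * h" if "\<theta> < \<xi>" "\<xi> < \<theta> + h" "t < \<zeta>" "\<zeta> < t + h" for \<xi> \<zeta>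
    using that sqrt_sum_squares_le_sum_abs[of "\<xi> - \<theta>" "\<zeta> - t"] by (simp add: dist_Pair_Pair dist_real_def)
  define \<Delta> where "\<Delta> = u (\<theta> + h) (t + h) - u (\<theta> + h) t - u \<theta> (t + h) + u \<theta> t"
  obtain \<xi> \<zeta> where 1: "\<theta> < \<xi>" "\<xi> < \<theta> + h" "t < \<zeta>" "\<zeta> < t + h" "\<Delta> = h * h * u12 \<xi> \<zeta>"
  proof -
    have "((\<lambda>s. u s (t + h) - u s t) has_real_derivative u1 s (t + h) - u1 s t) (at s)" for s
      using u1[of "t + h" s] u1[of t s] tJ[of t] tJ[of "t + h"] h(1) by (intro DERIV_diff) auto
    then obtain \<xi> where \<xi>: "\<theta> < \<xi>" "\<xi> < \<theta> + h" "\<Delta> = h * (u1 \<xi> (t + h) - u1 \<xi> t)"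
      using MVT2[of \<theta> "\<theta> + h" "\<lambda>s. u s (t + h) - u s t" "\<lambda>s. u1 s (t + h) - u1 s t"] h(1)
      by (auto simp: \<Delta>_def algebra_simps)
    obtain \<zeta> where "t < \<zeta>" "\<zeta> < t + h" "u1 \<xi> (t + h) - u1 \<xi> t = h * u12 \<xi> \<zeta>"
      using MVT2[of t "t + h" "u1 \<xi>" "u12 \<xi>"] h(1) u12 tJ by auto
    then show ?thesis using \<xi> that by simp
  qed
  obtain \<xi>' \<zeta>' where 2: "\<theta> < \<xi>'" "\<xi>' < \<theta> + h" "t < \<zeta>'" "\<zeta>' < t + h" "\<Delta> = h * h * u21 \<xi>' \<zeta>'"
  proof -
    have "((\<lambda>s. u (\<theta> + h) s - u \<theta> s) has_real_derivative u2 (\<theta> + h) s - u2 \<theta> s) (at s)"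
      if "t \<le> s" "s \<le> t + h" for s
      using u2[of s] tJ[OF that] by (intro DERIV_diff) auto
    then obtain \<zeta> where \<zeta>: "t < \<zeta>" "\<zeta> < t + h" "\<Delta> = h * (u2 (\<theta> + h) \<zeta> - u2 \<theta> \<zeta>)"
      using MVT2[of t "t + h" "\<lambda>s. u (\<theta> + h) s - u \<theta> s" "\<lambda>s. u2 (\<theta> + h) s - u2 \<theta> s"] h(1)
      by (auto simp: \<Delta>_def algebra_simps)
    obtain \<xi> where "\<theta> < \<xi>" "\<xi> < \<theta> + h" "u2 (\<theta> + h) \<zeta> - u2 \<theta> \<zeta> = h * u21 \<xi> \<zeta>"
      using MVT2[of \<theta> "\<theta> + h" "\<lambda>s. u2 s \<zeta>" "\<lambda>s. u21 s \<zeta>"] h(1) u21 tJ[of \<zeta>] \<zeta> by auto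
    then show ?thesis using \<zeta> that by simp
  qed
  have eq: "u12 \<xi> \<zeta> = u21 \<xi>' \<zeta>'" using 1(5) 2(5) h(1) by simp
  have a: "dist (u12 \<xi> \<zeta>) (u12 \<theta> t) < e"
    using d1(2)[of "(\<xi>, \<zeta>)"] near[OF 1(1-4)] h(2) tJ[of \<zeta>] 1 by auto
  have b: "dist (u12 \<xi> \<zeta>) (u21 \<theta> t) < e"
    unfolding eq using d2(2)[of "(\<xi>', \<zeta>')"] near[OF 2(1-4)] h(3) tJ[of \<zeta>'] 2 by auto
  have "dist (u12 \<theta> t) (u21 \<theta> t) \<le> dist (u12 \<xi> \<zeta>) (u12 \<theta> t) + dist (u12 \<xi> \<zeta>) (u21 \<theta> t)"
    by (rule dist_triangle3)
  moreover have "dist (u12 \<theta> t) (u21 \<theta> t) = e + e" by (simp add: e_def dist_real_def)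
  ultimately show False using a b by linarith
qed

text \<open>The mean value theorem requires real values, hence the passage to components along an
  arbitrary \<open>w\<close>, chosen at the end as the difference itself.\<close>

lemma mixed_partials:
  fixes u u1 u2 u12 u21 :: "real \<Rightarrow> real \<Rightarrow> 'a::real_inner"
  assumes J: "open J" "t \<in> J"
    and u1: "\<And>\<theta> t. t \<in> J \<Longrightarrow> ((\<lambda>\<theta>. u \<theta> t) has_vector_derivative u1 \<theta> t) (at \<theta>)"
    and u12: "\<And>\<theta> t. t \<in> J \<Longrightarrow> ((\<lambda>t. u1 \<theta> t) has_vector_derivative u12 \<theta> t) (at t)"
    and u2: "\<And>\<theta> t. t \<in> J \<Longrightarrow> ((\<lambda>t. u \<theta> t) has_vector_derivative u2 \<theta> t) (at t)"
    and u21: "\<And>\<theta> t. t \<in> J \<Longrightarrow> ((\<lambda>\<theta>. u2 \<theta> t) has_vector_derivative u21 \<theta> t) (at \<theta>)"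
    and c12: "continuous_on (UNIV \<times> J) (\<lambda>(\<theta>, t). u12 \<theta> t)"
    and c21: "continuous_on (UNIV \<times> J) (\<lambda>(\<theta>, t). u21 \<theta> t)"
  shows "u12 \<theta> t = u21 \<theta> t"
proof -
  have d: "((\<lambda>s. f s \<bullet> w) has_real_derivative f' \<bullet> w) (at x)"
    if "(f has_vector_derivative f') (at x)" for f :: "real \<Rightarrow> 'a" and f' x w
    using bounded_linear.has_vector_derivative[OF bounded_linear_inner_left that]
    by (simp add: has_real_derivative_iff_has_vector_derivative)
  have "u12 \<theta> t \<bullet> w = u21 \<theta> t \<bullet> w" for w
  proof (rule mixed_partials_real[OF J, of "\<lambda>\<theta> t. u \<theta> t \<bullet> w" "\<lambda>\<theta> t. u1 \<theta> t \<bullet> w"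
      "\<lambda>\<theta> t. u12 \<theta> t \<bullet> w" "\<lambda>\<theta> t. u2 \<theta> t \<bullet> w" "\<lambda>\<theta> t. u21 \<theta> t \<bullet> w"])
    show "continuous_on (UNIV \<times> J) (\<lambda>(\<theta>, t). u12 \<theta> t \<bullet> w)"
      using continuous_on_inner[OF c12 continuous_on_const[of _ w]] by (simp add: case_prod_beta)
    show "continuous_on (UNIV \<times> J) (\<lambda>(\<theta>, t). u21 \<theta> t \<bullet> w)"
      using continuous_on_inner[OF c21 continuous_on_const[of _ w]] by (simp add: case_prod_beta)
    fix \<theta> t assume t: "t \<in> J"
    show "((\<lambda>\<theta>. u \<theta> t \<bullet> w) has_real_derivative u1 \<theta> t \<bullet> w) (at \<theta>)" by (rule d[OF u1[OF t]])
    show "((\<lambda>t. u1 \<theta> t \<bullet> w) has_real_derivative u12 \<theta> t \<bullet> w) (at t)" by (rule d[OF u12[OF t]])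
    show "((\<lambda>t. u \<theta> t \<bullet> w) has_real_derivative u2 \<theta> t \<bullet> w) (at t)" by (rule d[OF u2[OF t]])
    show "((\<lambda>\<theta>. u2 \<theta> t \<bullet> w) has_real_derivative u21 \<theta> t \<bullet> w) (at \<theta>)" by (rule d[OF u21[OF t]])
  qed
  then have "(u12 \<theta> t - u21 \<theta> t) \<bullet> (u12 \<theta> t - u21 \<theta> t) = 0" by (simp add: inner_diff_left)
  then show ?thesis by simp
qed

section \<open>Evolution of normal and curvature\<close>

lemma zero_in_time_interval: "0 < T \<Longrightarrow> 0 \<in> time_interval T"
  by (simp add: time_interval_def zero_ereal_def)

lemma time_interval_downward: "t \<in> time_interval T \<Longrightarrow> 0 \<le> s \<Longrightarrow> s \<le> t \<Longrightarrow> s \<in> time_interval T"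
  unfolding time_interval_def by (auto intro: le_less_trans[of "ereal s" "ereal t"])

lemma convex_time_interval: "convex (time_interval T)"
  unfolding is_interval_convex_1[symmetric] is_interval_1
  by (auto simp: time_interval_def) (metis ereal_less_eq(3) le_less_trans)

text \<open>At positive times derivatives within the interval become ordinary ones. Time 0 enters
  the maximum principles through continuity and the initial condition, since every first violation
  occurs later.\<close>

lemma open_positive_times: "open (time_interval T \<inter> {0<..})"
proof (cases T)
  case (real r)
  then have "time_interval T \<inter> {0<..} = {0<..<r}" by (auto simp: time_interval_def)
  then show ?thesis by simp
next
  case PInf
  then have "time_interval T \<inter> {0<..} = {0<..}" by (auto simp: time_interval_def)
  then show ?thesis by simp
next
  case MInf
  then have "time_interval T \<inter> {0<..} = {}" by (auto simp: time_interval_def)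
  then show ?thesis by simp
qed

lemma at_within_time_interval:
  assumes "t \<in> time_interval T" "0 < t"
  shows "at t within time_interval T = at t"
  by (rule at_within_open_subset[OF _ open_positive_times[of T]]) (use assms in auto)

text \<open>Smoothness is reduced to finitely many named derivatives. That \<open>G1t\<close> and
  \<open>G2t\<close> each occur both as a time derivative and as a parameter derivative builds in
  the equality of mixed derivatives.\<close>

locale curvature_flow =
  fixes p :: real and T :: ereal and X :: "complex \<Rightarrow> real \<Rightarrow> complex"
    and G1 G2 G3 G4 Gt G1t G2t :: "real \<Rightarrow> real \<Rightarrow> complex"
  assumes p: "p > 1" and T: "0 < T" and flow: "power_curvature_flow p T X"
    and G1: "t \<in> time_interval T \<Longrightarrow> ((\<lambda>\<theta>. X (cis \<theta>) t) has_vector_derivative G1 \<theta> t) (at \<theta>)"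
    and G2: "t \<in> time_interval T \<Longrightarrow> ((\<lambda>\<theta>. G1 \<theta> t) has_vector_derivative G2 \<theta> t) (at \<theta>)"
    and G3: "t \<in> time_interval T \<Longrightarrow> ((\<lambda>\<theta>. G2 \<theta> t) has_vector_derivative G3 \<theta> t) (at \<theta>)"
    and G4: "t \<in> time_interval T \<Longrightarrow> ((\<lambda>\<theta>. G3 \<theta> t) has_vector_derivative G4 \<theta> t) (at \<theta>)"
    and continuous_G: "continuous_on (UNIV \<times> time_interval T) (\<lambda>z. X (cis (fst z)) (snd z))"
    and continuous_G1: "continuous_on (UNIV \<times> time_interval T) (\<lambda>z. G1 (fst z) (snd z))"
    and continuous_G2: "continuous_on (UNIV \<times> time_interval T) (\<lambda>z. G2 (fst z) (snd z))"
    and Gt: "t \<in> time_interval T \<Longrightarrow> 0 < t \<Longrightarrow> ((\<lambda>t. X (cis \<theta>) t) has_vector_derivative Gt \<theta> t) (at t)"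
    and G1t: "t \<in> time_interval T \<Longrightarrow> 0 < t \<Longrightarrow> ((\<lambda>t. G1 \<theta> t) has_vector_derivative G1t \<theta> t) (at t)"
    and G2t: "t \<in> time_interval T \<Longrightarrow> 0 < t \<Longrightarrow> ((\<lambda>t. G2 \<theta> t) has_vector_derivative G2t \<theta> t) (at t)"
    and Gt1: "t \<in> time_interval T \<Longrightarrow> 0 < t \<Longrightarrow> ((\<lambda>\<theta>. Gt \<theta> t) has_vector_derivative G1t \<theta> t) (at \<theta>)"
    and Gt2: "t \<in> time_interval T \<Longrightarrow> 0 < t \<Longrightarrow> ((\<lambda>\<theta>. G1t \<theta> t) has_vector_derivative G2t \<theta> t) (at \<theta>)"

lemma power_curvature_flow_imp_curvature_flow:
  assumes p: "p > 1" and T: "0 < T" and flow: "power_curvature_flow p T X"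
  shows "\<exists>G1 G2 G3 G4 Gt G1t G2t. curvature_flow p T X G1 G2 G3 G4 Gt G1t G2t"
proof -
  define I where "I = time_interval T"
  define G where "G = (\<lambda>(\<theta>, t). X (cis \<theta>) t)"
  have G: "Ck_on (Suc (Suc (Suc (Suc 0)))) (UNIV \<times> I) G"
    using flow unfolding power_curvature_flow_def smooth_on_def G_def I_def by blast
  obtain g1 gt where g1: "Ck_on (Suc (Suc (Suc 0))) (UNIV \<times> I) g1"
    and gt: "Ck_on (Suc (Suc (Suc 0))) (UNIV \<times> I) gt"
    and dg1: "\<And>\<theta> t. t \<in> I \<Longrightarrow> ((\<lambda>\<theta>. G (\<theta>, t)) has_vector_derivative g1 (\<theta>, t)) (at \<theta>)"
    and dgt: "\<And>\<theta> t. t \<in> I \<Longrightarrow> ((\<lambda>t. G (\<theta>, t)) has_vector_derivative gt (\<theta>, t)) (at t within I)"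
    by (rule Ck_on_partials[OF G]) (rule that; assumption)
  obtain g2 g1t where g2: "Ck_on (Suc (Suc 0)) (UNIV \<times> I) g2" and g1t: "Ck_on (Suc (Suc 0)) (UNIV \<times> I) g1t"
    and dg2: "\<And>\<theta> t. t \<in> I \<Longrightarrow> ((\<lambda>\<theta>. g1 (\<theta>, t)) has_vector_derivative g2 (\<theta>, t)) (at \<theta>)"
    and dg1t: "\<And>\<theta> t. t \<in> I \<Longrightarrow> ((\<lambda>t. g1 (\<theta>, t)) has_vector_derivative g1t (\<theta>, t)) (at t within I)"
    by (rule Ck_on_partials[OF g1]) (rule that; assumption)
  obtain g3 g2t where g3: "Ck_on (Suc 0) (UNIV \<times> I) g3" and g2t: "Ck_on (Suc 0) (UNIV \<times> I) g2t"
    and dg3: "\<And>\<theta> t. t \<in> I \<Longrightarrow> ((\<lambda>\<theta>. g2 (\<theta>, t)) has_vector_derivative g3 (\<theta>, t)) (at \<theta>)"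
    and dg2t: "\<And>\<theta> t. t \<in> I \<Longrightarrow> ((\<lambda>t. g2 (\<theta>, t)) has_vector_derivative g2t (\<theta>, t)) (at t within I)"
    by (rule Ck_on_partials[OF g2]) (rule that; assumption)
  obtain g4 g3t where "Ck_on 0 (UNIV \<times> I) g4" "Ck_on 0 (UNIV \<times> I) g3t"
    and dg4: "\<And>\<theta> t. t \<in> I \<Longrightarrow> ((\<lambda>\<theta>. g3 (\<theta>, t)) has_vector_derivative g4 (\<theta>, t)) (at \<theta>)"
    and "\<And>\<theta> t. t \<in> I \<Longrightarrow> ((\<lambda>t. g3 (\<theta>, t)) has_vector_derivative g3t (\<theta>, t)) (at t within I)"
    by (rule Ck_on_partials[OF g3]) (rule that; assumption)
  obtain gt1 gtt where gt1: "Ck_on (Suc (Suc 0)) (UNIV \<times> I) gt1"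
    and "Ck_on (Suc (Suc 0)) (UNIV \<times> I) gtt"
    and dgt1: "\<And>\<theta> t. t \<in> I \<Longrightarrow> ((\<lambda>\<theta>. gt (\<theta>, t)) has_vector_derivative gt1 (\<theta>, t)) (at \<theta>)"
    and "\<And>\<theta> t. t \<in> I \<Longrightarrow> ((\<lambda>t. gt (\<theta>, t)) has_vector_derivative gtt (\<theta>, t)) (at t within I)"
    by (rule Ck_on_partials[OF gt]) (rule that; assumption)
  obtain g1t1 g1tt where g1t1: "Ck_on (Suc 0) (UNIV \<times> I) g1t1"
    and "Ck_on (Suc 0) (UNIV \<times> I) g1tt"
    and dg1t1: "\<And>\<theta> t. t \<in> I \<Longrightarrow> ((\<lambda>\<theta>. g1t (\<theta>, t)) has_vector_derivative g1t1 (\<theta>, t)) (at \<theta>)"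
    and "\<And>\<theta> t. t \<in> I \<Longrightarrow> ((\<lambda>t. g1t (\<theta>, t)) has_vector_derivative g1tt (\<theta>, t)) (at t within I)"
    by (rule Ck_on_partials[OF g1t]) (rule that; assumption)
  define J where "J = I \<inter> {0<..}"
  have J: "open J" unfolding J_def I_def by (rule open_positive_times)
  have at: "at t within I = at t" if "t \<in> J" for t
    using at_within_time_interval that unfolding I_def J_def by auto
  have JI: "t \<in> I" if "t \<in> J" for t using that by (simp add: J_def)
  have cont: "continuous_on (UNIV \<times> J) (\<lambda>(\<theta>, t). u (\<theta>, t))" if "Ck_on k (UNIV \<times> I) u"
    for k and u :: "real \<times> real \<Rightarrow> complex"
  proof -
    have "continuous_on (UNIV \<times> J) u"
      by (rule continuous_on_subset[OF Ck_on_imp_continuous_on[OF that]]) (auto simp: J_def)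
    then show ?thesis by simp
  qed
  have e1: "g1t (\<theta>, t) = gt1 (\<theta>, t)" if "t \<in> J" for \<theta> t
  proof (rule mixed_partials[OF J that, of "\<lambda>\<theta> t. G (\<theta>, t)" "\<lambda>\<theta> t. g1 (\<theta>, t)" "\<lambda>\<theta> t. g1t (\<theta>, t)"
      "\<lambda>\<theta> t. gt (\<theta>, t)" "\<lambda>\<theta> t. gt1 (\<theta>, t)"])
    show "continuous_on (UNIV \<times> J) (\<lambda>(\<theta>, t). g1t (\<theta>, t))" by (rule cont[OF g1t])
    show "continuous_on (UNIV \<times> J) (\<lambda>(\<theta>, t). gt1 (\<theta>, t))" by (rule cont[OF gt1])
    fix \<theta> t assume t: "t \<in> J"
    show "((\<lambda>\<theta>. G (\<theta>, t)) has_vector_derivative g1 (\<theta>, t)) (at \<theta>)" by (rule dg1[OF JI[OF t]])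
    show "((\<lambda>\<theta>. gt (\<theta>, t)) has_vector_derivative gt1 (\<theta>, t)) (at \<theta>)" by (rule dgt1[OF JI[OF t]])
    show "((\<lambda>t. g1 (\<theta>, t)) has_vector_derivative g1t (\<theta>, t)) (at t)"
      using dg1t[OF JI[OF t]] unfolding at[OF t] .
    show "((\<lambda>t. G (\<theta>, t)) has_vector_derivative gt (\<theta>, t)) (at t)"
      using dgt[OF JI[OF t]] unfolding at[OF t] .
  qed
  have e2: "g2t (\<theta>, t) = g1t1 (\<theta>, t)" if "t \<in> J" for \<theta> t
  proof (rule mixed_partials[OF J that, of "\<lambda>\<theta> t. g1 (\<theta>, t)" "\<lambda>\<theta> t. g2 (\<theta>, t)" "\<lambda>\<theta> t. g2t (\<theta>, t)"
      "\<lambda>\<theta> t. g1t (\<theta>, t)" "\<lambda>\<theta> t. g1t1 (\<theta>, t)"])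
    show "continuous_on (UNIV \<times> J) (\<lambda>(\<theta>, t). g2t (\<theta>, t))" by (rule cont[OF g2t])
    show "continuous_on (UNIV \<times> J) (\<lambda>(\<theta>, t). g1t1 (\<theta>, t))" by (rule cont[OF g1t1])
    fix \<theta> t assume t: "t \<in> J"
    show "((\<lambda>\<theta>. g1 (\<theta>, t)) has_vector_derivative g2 (\<theta>, t)) (at \<theta>)" by (rule dg2[OF JI[OF t]])
    show "((\<lambda>\<theta>. g1t (\<theta>, t)) has_vector_derivative g1t1 (\<theta>, t)) (at \<theta>)" by (rule dg1t1[OF JI[OF t]])
    show "((\<lambda>t. g2 (\<theta>, t)) has_vector_derivative g2t (\<theta>, t)) (at t)"
      using dg2t[OF JI[OF t]] unfolding at[OF t] .
    show "((\<lambda>t. g1 (\<theta>, t)) has_vector_derivative g1t (\<theta>, t)) (at t)"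
      using dg1t[OF JI[OF t]] unfolding at[OF t] .
  qed
  have c: "continuous_on (UNIV \<times> I) u" if "Ck_on k (UNIV \<times> I) u" for k and u :: "real \<times> real \<Rightarrow> complex"
    by (rule Ck_on_imp_continuous_on[OF that])
  have "curvature_flow p T X (\<lambda>\<theta> t. g1 (\<theta>, t)) (\<lambda>\<theta> t. g2 (\<theta>, t)) (\<lambda>\<theta> t. g3 (\<theta>, t)) (\<lambda>\<theta> t. g4 (\<theta>, t))
      (\<lambda>\<theta> t. gt (\<theta>, t)) (\<lambda>\<theta> t. g1t (\<theta>, t)) (\<lambda>\<theta> t. g2t (\<theta>, t))"
  proof
    show "p > 1" "0 < T" "power_curvature_flow p T X" by fact+
    show "continuous_on (UNIV \<times> time_interval T) (\<lambda>z. X (cis (fst z)) (snd z))"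
      using c[OF G] by (simp add: G_def I_def case_prod_beta)
    show "continuous_on (UNIV \<times> time_interval T) (\<lambda>z. g1 (fst z, snd z))"
      "continuous_on (UNIV \<times> time_interval T) (\<lambda>z. g2 (fst z, snd z))"
      using c[OF g1] c[OF g2] by (simp_all add: I_def)
    fix \<theta> t assume "t \<in> time_interval T"
    then have t: "t \<in> I" by (simp add: I_def)
    show "((\<lambda>\<theta>. X (cis \<theta>) t) has_vector_derivative g1 (\<theta>, t)) (at \<theta>)"
      using dg1[OF t] by (simp add: G_def)
    show "((\<lambda>\<theta>. g1 (\<theta>, t)) has_vector_derivative g2 (\<theta>, t)) (at \<theta>)" by (rule dg2[OF t])
    show "((\<lambda>\<theta>. g2 (\<theta>, t)) has_vector_derivative g3 (\<theta>, t)) (at \<theta>)" by (rule dg3[OF t])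
    show "((\<lambda>\<theta>. g3 (\<theta>, t)) has_vector_derivative g4 (\<theta>, t)) (at \<theta>)" by (rule dg4[OF t])
    assume "0 < t"
    then have tJ: "t \<in> J" using t by (simp add: J_def)
    show "((\<lambda>t. X (cis \<theta>) t) has_vector_derivative gt (\<theta>, t)) (at t)"
      using dgt[OF t] unfolding at[OF tJ] by (simp add: G_def)
    show "((\<lambda>t. g1 (\<theta>, t)) has_vector_derivative g1t (\<theta>, t)) (at t)"
      using dg1t[OF t] unfolding at[OF tJ] .
    show "((\<lambda>t. g2 (\<theta>, t)) has_vector_derivative g2t (\<theta>, t)) (at t)"
      using dg2t[OF t] unfolding at[OF tJ] .
    show "((\<lambda>\<theta>. gt (\<theta>, t)) has_vector_derivative g1t (\<theta>, t)) (at \<theta>)"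
      unfolding e1[OF tJ] by (rule dgt1[OF t])
    show "((\<lambda>\<theta>. g1t (\<theta>, t)) has_vector_derivative g2t (\<theta>, t)) (at \<theta>)"
      unfolding e2[OF tJ] by (rule dg1t1[OF t])
  qed
  then show ?thesis by blast
qed

section \<open>Constant orientation along the flow and the evolution equations\<close>

context curvature_flow
begin

abbreviation "I \<equiv> time_interval T"
abbreviation "\<Gamma> \<theta> t \<equiv> X (cis \<theta>) t"
abbreviation "N \<theta> t \<equiv> outward_normal (\<lambda>x. X x t) (cis \<theta>)"
abbreviation "K \<theta> t \<equiv> curvature (\<lambda>x. X x t) (cis \<theta>)"

lemma convex_curve_at: "t \<in> I \<Longrightarrow> convex_curve (\<lambda>x. X x t) (\<lambda>\<theta>. G1 \<theta> t)"
  using flow G1 unfolding power_curvature_flow_def by unfold_locales auto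

lemma G1_nonzero: "t \<in> I \<Longrightarrow> G1 \<theta> t \<noteq> 0"
  by (rule convex_curve.\<gamma>1_nonzero[OF convex_curve_at])

text \<open>The continuity of \<open>outward_normal\<close> in space and time is not yet known, so
  the orientation is shown to be locally constant on the connected set of all parameters and times,
  by way of the support inequality.\<close>

lemma orientation_constant:
  "\<exists>\<iota>. (\<iota> = \<i> \<or> \<iota> = -\<i>) \<and> (\<forall>t\<in>I. \<forall>\<theta>. N \<theta> t = unit_normal \<iota> (G1 \<theta> t))"
proof -
  \<comment> \<open>Since \<open>N\<close> is a unit vector, this is the tangent divided by the
    normal, hence \<open>\<i>\<close> or \<open>-\<i>\<close>.\<close>
  define j where "j = (\<lambda>z. sgn (G1 (fst z) (snd z)) * cnj (N (fst z) (snd z)))"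
  have j: "j (\<theta>, t) = \<i> \<or> j (\<theta>, t) = -\<i>" "N \<theta> t = unit_normal (j (\<theta>, t)) (G1 \<theta> t)" if t: "t \<in> I" for \<theta> t
  proof -
    interpret convex_curve "\<lambda>x. X x t" "\<lambda>\<theta>. G1 \<theta> t" by (rule convex_curve_at[OF t])
    let ?n = "N \<theta> t"
    have n1: "norm ?n = 1" by (rule norm_normal)
    have "Re (j (\<theta>, t)) = sgn (G1 \<theta> t) \<bullet> ?n" by (simp add: j_def inner_complex_def)
    also have "\<dots> = 0" using normal_orth[of \<theta>] by (simp add: sgn_div_norm inner_commute)
    finally have re: "Re (j (\<theta>, t)) = 0" .
    have "norm (j (\<theta>, t)) = 1" using n1 \<gamma>1_nonzero by (simp add: j_def norm_mult norm_sgn)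
    then have "\<bar>Im (j (\<theta>, t))\<bar> = 1" using re by (simp add: cmod_def)
    then show ji: "j (\<theta>, t) = \<i> \<or> j (\<theta>, t) = -\<i>" using re by (auto simp: complex_eq_iff)
    have "?n * cnj ?n = 1" using n1 by (simp add: complex_norm_square[symmetric])
    then have "j (\<theta>, t) * ?n = sgn (G1 \<theta> t)" by (simp add: j_def mult_ac)
    then have "unit_normal (j (\<theta>, t)) (G1 \<theta> t) = - (j (\<theta>, t) * (j (\<theta>, t) * ?n))" by (simp add: unit_normal_def)
    then show "?n = unit_normal (j (\<theta>, t)) (G1 \<theta> t)" using rotation_inner(5)[OF ji, of ?n] by simp
  qed
  have "j z = j z'" if z: "z \<in> UNIV \<times> I" and z': "z' \<in> UNIV \<times> I" for z z'
  proof (rule connected_local_const[OF _ z z'])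
    show "connected (UNIV \<times> I :: (real \<times> real) set)"
      by (intro convex_connected convex_Times convex_UNIV convex_time_interval)
    show "\<forall>a\<in>UNIV \<times> I. \<forall>\<^sub>F b in at a within UNIV \<times> I. j a = j b"
    proof safe
      fix \<theta> t assume t: "t \<in> I"
      obtain \<eta> where \<eta>: "N \<theta> t \<bullet> (\<Gamma> \<eta> t - \<Gamma> \<theta> t) < 0"
        using convex_curve.normal_support_strict[OF convex_curve_at[OF t]] by blast
      \<comment> \<open>The normal is formed here with the orientation frozen at
        \<open>(\<theta>, t)\<close>, so \<open>w\<close> is continuous and stays negative nearby. A
        flipped orientation there would make the true normal violate the support inequality at
        \<open>\<eta>\<close>.\<close>
      define w where "w = (\<lambda>z. unit_normal (j (\<theta>, t)) (G1 (fst z) (snd z)) \<bullet> (\<Gamma> \<eta> (snd z) - \<Gamma> (fst z) (snd z)))"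
      have "continuous_on (UNIV \<times> I) (\<lambda>z. X (cis (fst (\<eta>, snd z))) (snd (\<eta>, snd z)))"
        by (rule continuous_on_compose2[OF continuous_G]) (auto intro!: continuous_intros)
      then have c\<eta>: "continuous_on (UNIV \<times> I) (\<lambda>z. \<Gamma> \<eta> (snd z))" by simp
      have "continuous_on (UNIV \<times> I) w"
        unfolding w_def unit_normal_def
        by (intro continuous_intros continuous_G continuous_G1 c\<eta>) (use G1_nonzero in auto)
      then have "(w \<longlongrightarrow> w (\<theta>, t)) (at (\<theta>, t) within UNIV \<times> I)"
        using t by (simp add: continuous_on_def)
      moreover have "w (\<theta>, t) < 0" using \<eta> j(2)[OF t, of \<theta>] by (simp add: w_def)
      ultimately have "\<forall>\<^sub>F z in at (\<theta>, t) within UNIV \<times> I. w z < 0" by (rule order_tendstoD(2))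
      moreover have "\<forall>\<^sub>F z in at (\<theta>, t) within UNIV \<times> I. z \<in> UNIV \<times> I"
        by (simp add: eventually_at_filter)
      ultimately show "\<forall>\<^sub>F b in at (\<theta>, t) within UNIV \<times> I. j (\<theta>, t) = j b"
      proof eventually_elim
        case (elim z)
        obtain \<phi> s where z: "z = (\<phi>, s)" by (cases z)
        have s: "s \<in> I" using elim(2) z by simp
        show ?case
        proof (rule ccontr)
          assume "j (\<theta>, t) \<noteq> j z"
          then have "j z = - j (\<theta>, t)" using j(1)[OF t, of \<theta>] j(1)[OF s, of \<phi>] z by auto
          then have "N \<phi> s = - unit_normal (j (\<theta>, t)) (G1 \<phi> s)"
            using j(2)[OF s, of \<phi>] z by (simp add: unit_normal_def)
          then have "N \<phi> s \<bullet> (\<Gamma> \<eta> s - \<Gamma> \<phi> s) > 0" using elim(1) z by (simp add: w_def)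
          then show False
            using convex_curve.normal_support_curve[OF convex_curve_at[OF s], of \<phi> \<eta>] by simp
        qed
      qed
    qed
  qed
  then have "j (\<theta>, t) = j (0, 0)" if "t \<in> I" for \<theta> t
    using that zero_in_time_interval[OF T] by blast
  then show ?thesis
    using j zero_in_time_interval[OF T] by (intro exI[of _ "j (0, 0)"]) metis
qed

definition \<iota> :: complex where
  "\<iota> = (SOME \<iota>. (\<iota> = \<i> \<or> \<iota> = -\<i>) \<and> (\<forall>t\<in>I. \<forall>\<theta>. N \<theta> t = unit_normal \<iota> (G1 \<theta> t)))"

lemma \<iota>: "\<iota> = \<i> \<or> \<iota> = -\<i>"
  and normal_eq: "t \<in> I \<Longrightarrow> N \<theta> t = unit_normal \<iota> (G1 \<theta> t)"
  using someI_ex[OF orientation_constant] unfolding \<iota>_def[symmetric] by blast+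

lemma curvature_eq:
  assumes "t \<in> I"
  shows "K \<theta> t = normal_curvature \<iota> (G1 \<theta> t) (G2 \<theta> t)"
proof -
  have 1: "circle_deriv (\<lambda>x. X x t) (cis \<theta>) = G1 \<theta> t" for \<theta>
    by (rule circle_deriv_cis[OF G1[OF assms]])
  have "circle_deriv (circle_deriv (\<lambda>x. X x t)) (cis \<theta>) = G2 \<theta> t"
    by (rule circle_deriv_cis) (use G2[OF assms] in \<open>simp add: 1\<close>)
  then show ?thesis by (simp add: curvature_def normal_curvature_def 1 normal_eq[OF assms])
qed

lemma continuous_normal: "continuous_on (UNIV \<times> I) (\<lambda>z. N (fst z) (snd z))"
proof -
  have "continuous_on (UNIV \<times> I) (\<lambda>z. unit_normal \<iota> (G1 (fst z) (snd z)))"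
    unfolding unit_normal_def by (intro continuous_intros continuous_G1) (use G1_nonzero in auto)
  then show ?thesis by (rule continuous_on_eq) (auto simp: normal_eq)
qed

lemma continuous_curvature: "continuous_on (UNIV \<times> I) (\<lambda>z. K (fst z) (snd z))"
proof -
  have "continuous_on (UNIV \<times> I) (\<lambda>z. normal_curvature \<iota> (G1 (fst z) (snd z)) (G2 (fst z) (snd z)))"
    unfolding normal_curvature_def unit_normal_def
    by (intro continuous_intros continuous_G1 continuous_G2) (use G1_nonzero in auto)
  then show ?thesis by (rule continuous_on_eq) (auto simp: curvature_eq)
qed

lemma framed_at:
  assumes t: "t \<in> I"
  obtains k1 k2 where "framed_curve (\<lambda>\<theta>. \<Gamma> \<theta> t) (\<lambda>\<theta>. N \<theta> t) \<iota> (\<lambda>\<theta>. norm (G1 \<theta> t))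
    (\<lambda>\<theta>. G2 \<theta> t \<bullet> (\<iota> * N \<theta> t)) (\<lambda>\<theta>. K \<theta> t) k1 k2"
proof -
  interpret regular_curve "\<lambda>\<theta>. \<Gamma> \<theta> t" "\<lambda>\<theta>. G1 \<theta> t" "\<lambda>\<theta>. G2 \<theta> t" "\<lambda>\<theta>. G3 \<theta> t" "\<lambda>\<theta>. G4 \<theta> t" \<iota>
    by unfold_locales (use \<iota> G1_nonzero G1 G2 G3 G4 t in auto)
  show ?thesis using framed that unfolding normal_eq[OF t] curvature_eq[OF t] by blast
qed

lemma velocity_eq:
  assumes t: "t \<in> I" "0 < t"
  shows "Gt \<theta> t = - (K \<theta> t powr p) *\<^sub>R N \<theta> t"
proof (rule vector_derivative_unique_at[OF Gt[OF t]])
  have "cis \<theta> \<in> sphere 0 1" by (simp add: norm_cis)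
  then have "((\<lambda>s. \<Gamma> \<theta> s) has_vector_derivative - (K \<theta> t powr p) *\<^sub>R N \<theta> t) (at t within I)"
    using flow t(1) unfolding power_curvature_flow_def by blast
  then show "((\<lambda>s. \<Gamma> \<theta> s) has_vector_derivative - (K \<theta> t powr p) *\<^sub>R N \<theta> t) (at t)"
    unfolding at_within_time_interval[OF t] .
qed

context
  fixes t :: real and k1 k2 :: "real \<Rightarrow> real"
  assumes t: "t \<in> I" "0 < t" and pos: "\<And>\<theta>. K \<theta> t > 0"
    and framed: "framed_curve (\<lambda>\<theta>. \<Gamma> \<theta> t) (\<lambda>\<theta>. N \<theta> t) \<iota> (\<lambda>\<theta>. norm (G1 \<theta> t))
      (\<lambda>\<theta>. G2 \<theta> t \<bullet> (\<iota> * N \<theta> t)) (\<lambda>\<theta>. K \<theta> t) k1 k2"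
begin

interpretation framed_curve "\<lambda>\<theta>. \<Gamma> \<theta> t" "\<lambda>\<theta>. N \<theta> t" \<iota> "\<lambda>\<theta>. norm (G1 \<theta> t)"
  "\<lambda>\<theta>. G2 \<theta> t \<bullet> (\<iota> * N \<theta> t)" "\<lambda>\<theta>. K \<theta> t" k1 k2
  by (rule framed)

lemma velocity_deriv: "((\<lambda>\<theta>. - (K \<theta> t powr p) *\<^sub>R N \<theta> t) has_vector_derivative G1t \<theta> t) (at \<theta>)"
  using Gt1[OF t, of \<theta>] by (simp only: velocity_eq[OF t])

lemmas G1t_normal = E1_\<nu>[where \<theta> = \<theta> for \<theta>, OF pos velocity_deriv Gt2[OF t]]
lemmas G1t_tangent = E1_\<tau>[where \<theta> = \<theta> for \<theta>, OF pos velocity_deriv Gt2[OF t]]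
lemmas G2t_normal = E2_\<nu>[where \<theta> = \<theta> for \<theta>, OF pos velocity_deriv Gt2[OF t]]

text \<open>The equation \<nu>_t = (\<kappa>^p)_s \<tau>: only the normal part of \<open>G1t\<close>
  rotates the unit normal.\<close>

lemma normal_evolution:
  "((\<lambda>s. N \<theta> s) has_vector_derivative (p * K \<theta> t powr (p - 1) * k1 \<theta>) *\<^sub>R (\<iota> * N \<theta> t)) (at t)"
proof -
  have "((\<lambda>s. unit_normal \<iota> (G1 \<theta> s)) has_vector_derivative
      (p * K \<theta> t powr (p - 1) * k1 \<theta>) *\<^sub>R (\<iota> * N \<theta> t)) (at t)"
    by (rule has_vector_derivative_eq_rhs[OF unit_normal_has_derivative[OF \<iota> G1t[OF t] G1_nonzero[OF t(1)]]])
      (use G1_nonzero[OF t(1)] in \<open>simp add: normal_eq[OF t(1), symmetric] G1t_normal\<close>)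
  then show ?thesis
    by (rule has_vector_derivative_transform_within_open[OF _ open_positive_times[of T]])
      (use t in \<open>auto simp: normal_eq\<close>)
qed

text \<open>The equation \<kappa>_t = (\<kappa>^p)_ss + \<kappa>^(p+2) at a fixed parameter. The
  terms with the derivative of the speed cancel; the reaction term appears once with coefficient -1,
  from \<open>G2t\<close>, and once with 2, from the change of the speed.\<close>

lemma curvature_evolution:
  "((\<lambda>s. K \<theta> s) has_real_derivative
    p * K \<theta> t powr (p - 1) * k2 \<theta> + p * (p - 1) * K \<theta> t powr (p - 2) * (k1 \<theta>)\<^sup>2
      + (K \<theta> t)\<^sup>2 * K \<theta> t powr p) (at t)"
proof -
  define \<rho> where "\<rho> = norm (G1 \<theta> t)"
  have \<rho>: "\<rho> > 0" using G1_nonzero[OF t(1)] by (simp add: \<rho>_def)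
  have a: "G2 \<theta> t \<bullet> N \<theta> t = - (K \<theta> t * \<rho>\<^sup>2)"
    using \<rho> by (simp add: curvature_eq[OF t(1)] normal_curvature_def normal_eq[OF t(1)] \<rho>_def)
  have "((\<lambda>s. normal_curvature \<iota> (G1 \<theta> s) (G2 \<theta> s)) has_real_derivative
    p * K \<theta> t powr (p - 1) * k2 \<theta> + p * (p - 1) * K \<theta> t powr (p - 2) * (k1 \<theta>)\<^sup>2
      + (K \<theta> t)\<^sup>2 * K \<theta> t powr p) (at t)"
    by (rule DERIV_cong[OF normal_curvature_has_derivative[OF \<iota> G1t[OF t] G1_nonzero[OF t(1)] G2t[OF t]]])
      (use \<rho> in \<open>simp add: normal_eq[OF t(1), symmetric] \<rho>_def[symmetric] G1t_normal G1t_tangent G2t_normal a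
        field_simps power2_eq_square power3_eq_cube\<close>)
  then show ?thesis
    unfolding has_real_derivative_iff_has_vector_derivative
    by (rule has_vector_derivative_transform_within_open[OF _ open_positive_times[of T]])
      (use t in \<open>auto simp: curvature_eq\<close>)
qed

end

end

section \<open>Maximum principle\<close>

lemma left_limit_ge:
  fixes f :: "real \<Rightarrow> real"
  assumes "continuous_on {0..t} f" "0 < t" "\<And>s. 0 \<le> s \<Longrightarrow> s < t \<Longrightarrow> m \<le> f s"
  shows "m \<le> f t"
  by (rule continuous_ge_on_closure[of "{0..<t}"]) (use assms in auto)

lemma positive_of_second_derivative_right:
  fixes g g' g'' :: "real \<Rightarrow> real"
  assumes "\<And>h. (g has_real_derivative g' h) (at h)" "\<And>h. (g' has_real_derivative g'' h) (at h)"
    and "g 0 = 0" "g' 0 = 0" "\<And>s. 0 < s \<Longrightarrow> s < h \<Longrightarrow> g'' s > 0" "0 < h"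
  shows "g h > 0"
proof -
  obtain s where s: "0 < s" "s < h" "g h - g 0 = (h - 0) * g' s"
    using MVT2[OF \<open>0 < h\<close>, of g g'] assms(1) by blast
  obtain r where r: "0 < r" "r < s" "g' s - g' 0 = (s - 0) * g'' r"
    using MVT2[OF s(1), of g' g''] assms(2) by blast
  have "g'' r > 0" using r s assms(5) by auto
  then have "g' s > 0" using r s(1) assms(4) by simp
  then show ?thesis using s(3) assms(3) \<open>0 < h\<close> by simp
qed

lemma positive_of_second_derivative:
  fixes g g' g'' :: "real \<Rightarrow> real"
  assumes d: "\<And>h. (g has_real_derivative g' h) (at h)" "\<And>h. (g' has_real_derivative g'' h) (at h)"
    and z: "g 0 = 0" "g' 0 = 0" and pos: "\<And>s. \<bar>s\<bar> < \<delta> \<Longrightarrow> g'' s > 0" and h: "h \<noteq> 0" "\<bar>h\<bar> < \<delta>"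
  shows "g h > 0"
proof (cases "h > 0")
  case True
  show ?thesis
    by (rule positive_of_second_derivative_right[OF d z _ True]) (use h in \<open>auto intro!: pos\<close>)
next
  case False
  have "((\<lambda>s. g (- s)) has_real_derivative - g' (- s)) (at s)" for s
    using DERIV_mirror[of g "g' (-s)" s] d(1)[of "-s"] by simp
  moreover have "((\<lambda>s. - g' (- s)) has_real_derivative g'' (- s)) (at s)" for s
    using DERIV_minus[OF DERIV_mirror[THEN iffD1, OF d(2)[of "-s"]]] by simp
  ultimately have "g (- (- h)) > 0"
    by (rule positive_of_second_derivative_right[where g = "\<lambda>s. g (- s)"]) (use z h False in \<open>auto intro!: pos\<close>)
  then show ?thesis by simp
qed

text \<open>Writing a pair of distinct points as base point and increment makes the parameters
  bounded; the diagonal sits at both ends \<open>h = 0\<close> and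
  \<open>h = 2 * pi\<close>.\<close>

lemma cis_representatives:
  assumes "cis \<theta> \<noteq> cis \<eta>"
  obtains \<phi> h where "\<phi> \<in> {0..2*pi}" "0 < h" "h < 2*pi" "cis \<phi> = cis \<theta>" "cis (\<phi> + h) = cis \<eta>"
proof -
  have "cis \<theta> \<in> cis ` {0..2*pi}" "cis (\<eta> - \<theta>) \<in> cis ` {0..2*pi}"
    unfolding sphere_eq_cis_interval[symmetric] by (simp_all add: norm_cis)
  then obtain \<phi> h where \<phi>: "\<phi> \<in> {0..2*pi}" "cis \<phi> = cis \<theta>"
    and h: "h \<in> {0..2*pi}" "cis h = cis (\<eta> - \<theta>)" by force
  have e: "cis (\<phi> + h) = cis \<eta>"
  proof -
    have "cis (\<phi> + h) = cis \<theta> * cis (\<eta> - \<theta>)" by (simp only: cis_mult[symmetric] \<phi> h)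
    then show ?thesis by (simp add: cis_mult)
  qed
  have "h \<noteq> 0" "h \<noteq> 2*pi" using e \<phi>(2) assms cis_mult[of \<phi> h] by auto
  then show ?thesis using that[OF \<phi>(1) _ _ \<phi>(2) e] h(1) by auto
qed

lemma cis_shift_neq:
  assumes "0 < h" "h < 2 * pi"
  shows "cis (\<theta> + h) \<noteq> cis \<theta>"
proof
  assume "cis (\<theta> + h) = cis \<theta>"
  then have "sin (\<theta> + h) = sin \<theta> \<and> cos (\<theta> + h) = cos \<theta>" by (simp add: complex_eq_iff)
  then obtain k :: int where "\<theta> + h = \<theta> + 2 * pi * k" unfolding sin_cos_eq_iff by blast
  then have k: "h = 2 * pi * k" by simp
  have "0 < k" using k assms(1) by (simp add: zero_less_mult_iff)
  moreover have "2 * pi * k < 2 * pi * 1" using k assms(2) by simp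
  then have "k < 1" by (simp add: mult_less_cancel_left)
  ultimately show False by simp
qed

section \<open>First-time arguments along the flow\<close>

context curvature_flow
begin

lemma interval_subset: "t1 \<in> I \<Longrightarrow> {0..t1} \<subseteq> I"
  using time_interval_downward by auto

lemma continuous_in_time: "continuous_on I (\<lambda>s. \<Gamma> \<theta> s)" "continuous_on I (\<lambda>s. N \<theta> s)" "continuous_on I (\<lambda>s. K \<theta> s)"
proof -
  have c: "continuous_on I (\<lambda>s. (\<theta>, s))" by (intro continuous_intros)
  show "continuous_on I (\<lambda>s. \<Gamma> \<theta> s)" using continuous_on_compose2[OF continuous_G c] by auto
  show "continuous_on I (\<lambda>s. N \<theta> s)" using continuous_on_compose2[OF continuous_normal c] by auto
  show "continuous_on I (\<lambda>s. K \<theta> s)" using continuous_on_compose2[OF continuous_curvature c] by auto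
qed

lemma parameter_in_period: obtains \<phi> where "\<phi> \<in> {0..2*pi}" "cis \<phi> = cis \<theta>"
proof -
  have "cis \<theta> \<in> cis ` {0..2*pi}" unfolding sphere_eq_cis_interval[symmetric] by (simp add: norm_cis)
  then show ?thesis using that by force
qed

text \<open>At the first time the curvature reaches a positive level \<open>m\<close>, it has a
  spatial minimum there, so its diffusion term is nonnegative. The reaction term is strictly
  positive at \<kappa> = m, so the curvature was smaller just before. Up to that time \<kappa> is at
  least \<open>m\<close>, hence \<open>powr\<close> has a positive base.\<close>

lemma curvature_stays_positive:
  assumes pos0: "\<And>\<theta>. K \<theta> 0 > 0" and t1: "t1 \<in> I"
  shows "K \<theta> t1 > 0"
proof -
  have "continuous_on {0..2*pi} (\<lambda>\<theta>. (\<theta>, 0::real))" "(\<lambda>\<theta>. (\<theta>, 0)) ` {0..2*pi} \<subseteq> UNIV \<times> I"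
    using zero_in_time_interval[OF T] by (auto intro!: continuous_intros)
  from continuous_on_compose2[OF continuous_curvature this]
  have "continuous_on {0..2*pi} (\<lambda>\<theta>. K \<theta> 0)" by simp
  then obtain \<theta>m where \<theta>m: "\<And>\<theta>. \<theta> \<in> {0..2*pi} \<Longrightarrow> K \<theta>m 0 \<le> K \<theta> 0"
    using continuous_attains_inf[OF compact_Icc, of 0 "2*pi" "\<lambda>\<theta>. K \<theta> 0"] by force
  \<comment> \<open>Half the initial minimum, so that the level \<open>m\<close> is not attained at
    time 0.\<close>
  define m where "m = K \<theta>m 0 / 2"
  have m: "m > 0" using pos0 by (simp add: m_def)
  have m0: "m < K \<theta> 0" for \<theta>
  proof -
    obtain \<phi> where "\<phi> \<in> {0..2*pi}" "cis \<phi> = cis \<theta>" by (rule parameter_in_period)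
    then show ?thesis using \<theta>m[of \<phi>] m by (simp add: m_def)
  qed
  have "m < K \<theta> t" if "t \<in> {0..t1}" for \<theta> t
  proof (rule ccontr)
    assume bad: "\<not> m < K \<theta> t"
    define C where "C = {z \<in> {0..2*pi} \<times> {0..t1}. K (fst z) (snd z) \<le> m}"
    have "continuous_on ({0..2*pi} \<times> {0..t1}) (\<lambda>z. K (fst z) (snd z))"
      by (rule continuous_on_subset[OF continuous_curvature]) (use interval_subset[OF t1] in auto)
    then have "closed C" unfolding C_def
      by (intro continuous_on_closed_Collect_le continuous_on_const closed_Times) auto
    moreover have "C \<subseteq> {0..2*pi} \<times> {0..t1}" by (auto simp: C_def)
    moreover have "compact ({0..2*pi} \<times> {0..t1})" by (intro compact_Times compact_Icc)
    ultimately have "compact C"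
      using compact_Int_closed[of "{0..2*pi} \<times> {0..t1}" C] by (simp add: Int_absorb1)
    moreover have "C \<noteq> {}"
    proof -
      obtain \<phi> where "\<phi> \<in> {0..2*pi}" "cis \<phi> = cis \<theta>" by (rule parameter_in_period)
      then have "(\<phi>, t) \<in> C" using bad that by (simp add: C_def)
      then show ?thesis by blast
    qed
    ultimately have "\<exists>z\<in>C. \<forall>y\<in>C. snd z \<le> snd y"
      by (rule continuous_attains_inf) (rule continuous_on_snd[OF continuous_on_id])
    then obtain z where z: "z \<in> C" "\<And>y. y \<in> C \<Longrightarrow> snd z \<le> snd y"
      by blast
    define \<theta>0 t0 where "\<theta>0 = fst z" and "t0 = snd z"
    have t0: "t0 \<in> {0..t1}" and K0: "K \<theta>0 t0 \<le> m" using z(1) by (auto simp: C_def \<theta>0_def t0_def)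
    have tI: "t0 \<in> I" using t0 interval_subset[OF t1] by auto
    have tpos: "t0 > 0" using t0 K0 m0[of \<theta>0] by (cases "t0 = 0") auto
    have before: "m < K \<eta> s" if "0 \<le> s" "s < t0" for \<eta> s
    proof (rule ccontr)
      assume *: "\<not> m < K \<eta> s"
      obtain \<phi> where "\<phi> \<in> {0..2*pi}" "cis \<phi> = cis \<eta>" by (rule parameter_in_period)
      then have "(\<phi>, s) \<in> C" using * that t0 by (simp add: C_def)
      then show False using z(2)[of "(\<phi>, s)"] that by (simp add: t0_def)
    qed
    \<comment> \<open>At \<open>t0\<close> itself only the weak inequality survives, as a limit from
      earlier times.\<close>
    have now: "m \<le> K \<eta> t0" for \<eta>
      by (rule left_limit_ge[OF _ tpos])
        (use before continuous_on_subset[OF continuous_in_time(3) interval_subset[OF tI]] in \<open>auto intro: less_imp_le\<close>)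
    then have pos: "K \<eta> t0 > 0" for \<eta> using m by (meson less_le_trans)
    have eq: "K \<theta>0 t0 = m" using K0 now by (auto intro: antisym)
    obtain k1 k2 where framed: "framed_curve (\<lambda>\<theta>. \<Gamma> \<theta> t0) (\<lambda>\<theta>. N \<theta> t0) \<iota> (\<lambda>\<theta>. norm (G1 \<theta> t0))
        (\<lambda>\<theta>. G2 \<theta> t0 \<bullet> (\<iota> * N \<theta> t0)) (\<lambda>\<theta>. K \<theta> t0) k1 k2"
      by (rule framed_at[OF tI])
    interpret framed_curve "\<lambda>\<theta>. \<Gamma> \<theta> t0" "\<lambda>\<theta>. N \<theta> t0" \<iota> "\<lambda>\<theta>. norm (G1 \<theta> t0)"
        "\<lambda>\<theta>. G2 \<theta> t0 \<bullet> (\<iota> * N \<theta> t0)" "\<lambda>\<theta>. K \<theta> t0" k1 k2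
      by (rule framed)
    note d2 = DERIV_mult[OF \<rho>_deriv[of \<theta>0] k1_deriv[of \<theta>0]]
    have k1: "norm (G1 \<theta>0 t0) * k1 \<theta>0 = 0"
      by (rule second_derivative_nonneg_at_min(1)[OF \<kappa>_deriv d2]) (simp add: eq now)
    then have k1': "k1 \<theta>0 = 0" using \<rho>_pos[of \<theta>0] by auto
    have "0 \<le> (G2 \<theta>0 t0 \<bullet> (\<iota> * N \<theta>0 t0)) * k1 \<theta>0 + norm (G1 \<theta>0 t0) * k2 \<theta>0 * norm (G1 \<theta>0 t0)"
      by (rule second_derivative_nonneg_at_min(2)[OF \<kappa>_deriv d2]) (simp add: eq now)
    then have k2: "k2 \<theta>0 \<ge> 0" using \<rho>_pos[of \<theta>0] by (simp add: k1' zero_le_mult_iff)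
    have "p * K \<theta>0 t0 powr (p - 1) * k2 \<theta>0 + p * (p - 1) * K \<theta>0 t0 powr (p - 2) * (k1 \<theta>0)\<^sup>2
        + (K \<theta>0 t0)\<^sup>2 * K \<theta>0 t0 powr p > 0"
      using k2 p pos[of \<theta>0] by (intro add_nonneg_pos add_nonneg_nonneg mult_nonneg_nonneg mult_pos_pos) auto
    then obtain d where d: "d > 0" "\<And>h. h > 0 \<Longrightarrow> h < d \<Longrightarrow> K \<theta>0 (t0 - h) < K \<theta>0 t0"
      using DERIV_pos_inc_left[OF curvature_evolution[OF tI tpos pos framed, of \<theta>0]] by blast
    define h where "h = min d t0 / 2"
    have "h > 0" "h < d" "h < t0" using d(1) tpos by (auto simp: h_def)
    then have "K \<theta>0 (t0 - h) < m" using d(2) eq by auto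
    moreover have "m < K \<theta>0 (t0 - h)" using before[of "t0 - h" \<theta>0] \<open>h > 0\<close> \<open>h < t0\<close> by simp
    ultimately show False by simp
  qed
  then show ?thesis using t1 m less_trans by (fastforce simp: time_interval_def)
qed

definition two_point :: "real \<Rightarrow> real \<Rightarrow> real \<Rightarrow> real \<Rightarrow> real" where
  "two_point \<mu> \<theta> \<eta> t = \<mu> * K \<theta> t / 2 * ((\<Gamma> \<theta> t - \<Gamma> \<eta> t) \<bullet> (\<Gamma> \<theta> t - \<Gamma> \<eta> t)) - (\<Gamma> \<theta> t - \<Gamma> \<eta> t) \<bullet> N \<theta> t"

lemma two_point_cong: "cis \<theta> = cis \<theta>' \<Longrightarrow> cis \<eta> = cis \<eta>' \<Longrightarrow> two_point \<mu> \<theta> \<eta> t = two_point \<mu> \<theta>' \<eta>' t"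
  by (simp add: two_point_def)

lemma two_point_diagonal: "cis \<theta> = cis \<eta> \<Longrightarrow> two_point \<mu> \<theta> \<eta> t = 0"
  by (simp add: two_point_def)

lemma non_collapsed_iff_two_point:
  assumes "t \<in> I" "\<mu> > 0"
  shows "non_collapsed \<mu> (\<lambda>x. X x t) \<longleftrightarrow> (\<forall>\<theta>. K \<theta> t > 0 \<and> (\<forall>\<eta>. 0 \<le> two_point \<mu> \<theta> \<eta> t))"
  unfolding convex_curve.non_collapsed_iff[OF convex_curve_at[OF assms(1)] assms(2)] two_point_def power2_norm_eq_inner ..

lemma continuous_shifted:
  fixes u :: "real \<times> real \<Rightarrow> 'b::topological_space"
  assumes "continuous_on (UNIV \<times> I) u"
  shows "continuous_on (UNIV \<times> UNIV \<times> I) (\<lambda>z. u (fst z, snd (snd z)))"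
    and "continuous_on (UNIV \<times> UNIV \<times> I) (\<lambda>z. u (fst z + fst (snd z), snd (snd z)))"
  by (rule continuous_on_compose2[OF assms]; auto intro!: continuous_intros)+

lemmas continuous_shifts =
  continuous_shifted[OF continuous_G, simplified] continuous_shifted[OF continuous_G1, simplified]
  continuous_shifted[OF continuous_G2, simplified] continuous_shifted[OF continuous_normal, simplified]
  continuous_shifted[OF continuous_curvature, simplified]

lemma continuous_two_point:
  "continuous_on (UNIV \<times> UNIV \<times> I) (\<lambda>z. two_point \<mu> (fst z) (fst z + fst (snd z)) (snd (snd z)))"
  unfolding two_point_def by (intro continuous_intros continuous_shifts) auto

text \<open>
  Near the diagonal the two-point function is strictly convex in the second point: its second
  derivative on the diagonal is \<open>(\<mu> - 1) * \<kappa>\<close> times the squared speed.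
\<close>

lemma two_point_near_diagonal:
  assumes pos: "\<And>\<theta> t. t \<in> {0..t1} \<Longrightarrow> K \<theta> t > 0" and t1: "t1 \<in> I" and \<mu>: "\<mu> > 1"
  obtains \<delta> where "\<delta> > 0"
    "\<And>\<theta> h t. \<theta> \<in> {0..2*pi} \<Longrightarrow> t \<in> {0..t1} \<Longrightarrow> h \<noteq> 0 \<Longrightarrow> \<bar>h\<bar> < \<delta> \<Longrightarrow> two_point \<mu> \<theta> (\<theta> + h) t > 0"
proof -
  \<comment> \<open>The second derivative in \<open>h\<close> of
    \<open>two_point \<mu> \<theta> (\<theta> + h) t\<close>, at the point
    \<open>(\<theta>, h, t)\<close>.\<close>
  define W where "W = (\<lambda>z. \<mu> * K (fst z) (snd (snd z)) * (G1 (fst z + fst (snd z)) (snd (snd z)) \<bullet> G1 (fst z + fst (snd z)) (snd (snd z))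
      - (\<Gamma> (fst z) (snd (snd z)) - \<Gamma> (fst z + fst (snd z)) (snd (snd z))) \<bullet> G2 (fst z + fst (snd z)) (snd (snd z)))
      + G2 (fst z + fst (snd z)) (snd (snd z)) \<bullet> N (fst z) (snd (snd z)))"
  have cW: "continuous_on (UNIV \<times> UNIV \<times> I) W"
    unfolding W_def by (intro continuous_intros continuous_shifts)
  have t1': "0 \<le> t1" using t1 by (simp add: time_interval_def)
  define B :: "(real \<times> real \<times> real) set" where "B = {0..2*pi} \<times> {-1..1} \<times> {0..t1}"
  define B0 :: "(real \<times> real \<times> real) set" where "B0 = {0..2*pi} \<times> {0} \<times> {0..t1}"
  have BI: "B \<subseteq> UNIV \<times> UNIV \<times> I" and B0B: "B0 \<subseteq> B" using interval_subset[OF t1] by (auto simp: B_def B0_def)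
  have comp: "compact B" "compact B0" unfolding B_def B0_def by (auto intro!: compact_Times)
  have cB: "continuous_on B W" "continuous_on B0 W"
    using continuous_on_subset[OF cW] BI B0B by (blast intro: subset_trans)+
  have diag: "W (\<theta>, 0, t) > 0" if "t \<in> {0..t1}" for \<theta> t
  proof -
    have tI: "t \<in> I" using that interval_subset[OF t1] by auto
    have "W (\<theta>, 0, t) = (\<mu> - 1) * K \<theta> t * (norm (G1 \<theta> t))\<^sup>2"
      using G1_nonzero[OF tI, of \<theta>]
      by (simp add: W_def curvature_eq[OF tI] normal_curvature_def normal_eq[OF tI] power2_norm_eq_inner[symmetric] field_simps)
    then show ?thesis using \<mu> pos[OF that] G1_nonzero[OF tI] by simp
  qed
  have "B0 \<noteq> {}" using t1' by (auto simp: B0_def)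
  then obtain z0 where z0: "z0 \<in> B0" "\<And>z. z \<in> B0 \<Longrightarrow> W z0 \<le> W z"
    using continuous_attains_inf[OF comp(2) _ cB(2)] by blast
  have w0: "W z0 > 0" using z0(1) diag by (auto simp: B0_def)
  \<comment> \<open>On \<open>B0\<close> the values are at least \<open>W z0 > 0\<close>, so a
    variation below \<open>W z0\<close> preserves positivity. The minimum with 1 in
    \<open>\<delta>\<close> keeps \<open>h\<close> within \<open>B\<close>.\<close>
  have "uniformly_continuous_on B W" by (rule compact_uniformly_continuous[OF cB(1) comp(1)])
  then obtain \<delta>0 where \<delta>0: "\<delta>0 > 0" "\<And>x x'. x \<in> B \<Longrightarrow> x' \<in> B \<Longrightarrow> dist x' x < \<delta>0 \<Longrightarrow> dist (W x') (W x) < W z0"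
    using w0 unfolding uniformly_continuous_on_def by meson
  define \<delta> where "\<delta> = min \<delta>0 1"
  have Wpos: "W (\<theta>, h, t) > 0" if "\<theta> \<in> {0..2*pi}" "t \<in> {0..t1}" "\<bar>h\<bar> < \<delta>" for \<theta> h t
  proof -
    have "(\<theta>, 0, t) \<in> B0" "(\<theta>, h, t) \<in> B" "(\<theta>, 0, t) \<in> B" using that by (auto simp: B_def B0_def \<delta>_def)
    moreover have "dist (\<theta>, h, t) (\<theta>, 0, t) < \<delta>0" using that by (simp add: dist_Pair_Pair \<delta>_def)
    ultimately have "dist (W (\<theta>, h, t)) (W (\<theta>, 0, t)) < W z0" "W z0 \<le> W (\<theta>, 0, t)" using \<delta>0(2) z0(2) by auto
    then show ?thesis by (simp add: dist_real_def abs_less_iff)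
  qed
  have "two_point \<mu> \<theta> (\<theta> + h) t > 0" if a: "\<theta> \<in> {0..2*pi}" "t \<in> {0..t1}" "h \<noteq> 0" "\<bar>h\<bar> < \<delta>" for \<theta> h t
  proof -
    have tI: "t \<in> I" using a(2) interval_subset[OF t1] by auto
    have shift: "((\<lambda>h. u (\<theta> + h)) has_vector_derivative u' (\<theta> + h)) (at h)"
      if "\<And>\<phi>. (u has_vector_derivative u' \<phi>) (at \<phi>)" for u u' :: "real \<Rightarrow> complex" and h
    proof -
      have "((\<lambda>h. \<theta> + h) has_vector_derivative 1) (at h)" by (auto intro!: derivative_eq_intros)
      from vector_diff_chain_at[OF this that] show ?thesis by (simp add: o_def)
    qed
    define D where "D = (\<lambda>h. \<Gamma> \<theta> t - \<Gamma> (\<theta> + h) t)"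
    define g' where "g' = (\<lambda>h. - (\<mu> * K \<theta> t * (D h \<bullet> G1 (\<theta> + h) t)) + G1 (\<theta> + h) t \<bullet> N \<theta> t)"
    have dD: "(D has_vector_derivative - G1 (\<theta> + h) t) (at h)" for h
      using has_vector_derivative_diff[OF has_vector_derivative_const shift[OF G1[OF tI], of h], of "\<Gamma> \<theta> t"]
      unfolding D_def by simp
    note dG1 = shift[of "\<lambda>\<theta>. G1 \<theta> t" "\<lambda>\<theta>. G2 \<theta> t", OF G2[OF tI]]
    have d1: "((\<lambda>h. two_point \<mu> \<theta> (\<theta> + h) t) has_real_derivative g' h) (at h)" for h
      unfolding two_point_def D_def[symmetric, unfolded fun_eq_iff, rule_format]
      by (rule DERIV_cong[OF DERIV_diff[OF DERIV_cmult[OF inner_has_real_derivative[OF dD dD]]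
            inner_has_real_derivative[OF dD has_vector_derivative_const]]])
        (simp add: g'_def inner_commute)
    have d2: "(g' has_real_derivative W (\<theta>, h, t)) (at h)" for h
      unfolding g'_def
      by (rule DERIV_cong[OF DERIV_add[OF DERIV_minus[OF DERIV_cmult[OF inner_has_real_derivative[OF dD dG1]]]
            inner_has_real_derivative[OF dG1 has_vector_derivative_const]]])
        (simp add: W_def D_def algebra_simps)
    show ?thesis
    proof (rule positive_of_second_derivative[OF d1 d2])
      show "two_point \<mu> \<theta> (\<theta> + 0) t = 0" by (simp add: two_point_def)
      show "g' 0 = 0"
        using convex_curve.normal_orth[OF convex_curve_at[OF tI], of \<theta>] by (simp add: g'_def D_def inner_commute)
    qed (use a Wpos in auto)
  qed
  then show ?thesis using that[of \<delta>] \<delta>0(1) by (simp add: \<delta>_def)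
qed

text \<open>The evolution equations for position, normal and curvature identify the derivative with
  the expression of \<open>time_derivative_positive_at_contact\<close>. Convexity supplies the
  support inequality at the second point, and injectivity a nonzero chord.\<close>

lemma two_point_time_derivative:
  assumes min: "\<And>\<theta> \<eta>. two_point \<mu> \<theta> \<eta> t \<ge> 0" and zero: "two_point \<mu> \<theta> \<eta> t = 0"
    and t: "t \<in> I" "0 < t" and pos: "\<And>\<theta>. K \<theta> t > 0" and \<mu>: "\<mu> > 1" and neq: "cis \<theta> \<noteq> cis \<eta>"
    and Q: "\<And>q u. 0 \<le> q \<Longrightarrow> q \<le> 1 \<Longrightarrow> 0 < u \<Longrightarrow> u \<le> \<mu> \<Longrightarrow> \<exists>l. contact_excess p \<mu> q u l > 0"
  shows "\<exists>l>0. ((\<lambda>s. two_point \<mu> \<theta> \<eta> s) has_real_derivative l) (at t)"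
proof -
  obtain k1 k2 where framed: "framed_curve (\<lambda>\<theta>. \<Gamma> \<theta> t) (\<lambda>\<theta>. N \<theta> t) \<iota> (\<lambda>\<theta>. norm (G1 \<theta> t))
      (\<lambda>\<theta>. G2 \<theta> t \<bullet> (\<iota> * N \<theta> t)) (\<lambda>\<theta>. K \<theta> t) k1 k2"
    by (rule framed_at[OF t(1)])
  interpret framed_curve "\<lambda>\<theta>. \<Gamma> \<theta> t" "\<lambda>\<theta>. N \<theta> t" \<iota> "\<lambda>\<theta>. norm (G1 \<theta> t)"
      "\<lambda>\<theta>. G2 \<theta> t \<bullet> (\<iota> * N \<theta> t)" "\<lambda>\<theta>. K \<theta> t" k1 k2
    by (rule framed)
  have Z: "Z \<mu> \<theta> \<eta> = two_point \<mu> \<theta> \<eta> t" for \<theta> \<eta> by (simp add: Z_def two_point_def)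
  interpret cc: convex_curve "\<lambda>x. X x t" "\<lambda>\<theta>. G1 \<theta> t" by (rule convex_curve_at[OF t(1)])
  have D: "\<Gamma> \<theta> t \<noteq> \<Gamma> \<eta> t"
    using cc.inj neq by (auto simp: inj_on_def norm_cis)
  have sup: "N \<eta> t \<bullet> (\<Gamma> \<theta> t - \<Gamma> \<eta> t) \<le> 0" by (rule cc.normal_support_curve)
  note l = time_derivative_positive_at_contact[of \<mu>, unfolded Z, OF min zero \<mu> p pos pos D sup Q]
  have dD: "((\<lambda>s. \<Gamma> \<theta> s - \<Gamma> \<eta> s) has_vector_derivative
      (K \<eta> t powr p) *\<^sub>R N \<eta> t - (K \<theta> t powr p) *\<^sub>R N \<theta> t) (at t)"
    using has_vector_derivative_diff[OF Gt[OF t, of \<theta>] Gt[OF t, of \<eta>]] by (simp add: velocity_eq[OF t])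
  show ?thesis
    by (intro exI conjI, rule l, assumption+, unfold two_point_def,
      rule DERIV_cong[OF DERIV_diff[OF DERIV_mult[OF DERIV_cdivide[OF DERIV_cmult[OF curvature_evolution[OF t pos framed]]]
        inner_has_real_derivative[OF dD dD]] inner_has_real_derivative[OF dD normal_evolution[OF t pos framed]]]])
      (simp add: algebra_simps inner_commute)
qed

text \<open>With the band around the diagonal removed, the nonpositive set \<open>C\<close> is
  compact and has an earliest time \<open>t0\<close>, which is positive. At \<open>t0\<close> the
  function is nonnegative everywhere and zero at one pair, where its time derivative is positive; so
  it was negative just before, contrary to the choice of \<open>t0\<close>.\<close>

lemma two_point_stays_positive:
  assumes pos: "\<And>\<theta> t. t \<in> {0..t1} \<Longrightarrow> K \<theta> t > 0" and t1: "t1 \<in> I" and \<mu>: "\<mu> > 1"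
    and Q: "\<And>q u. 0 \<le> q \<Longrightarrow> q \<le> 1 \<Longrightarrow> 0 < u \<Longrightarrow> u \<le> \<mu> \<Longrightarrow> \<exists>l. contact_excess p \<mu> q u l > 0"
    and init: "\<And>\<theta> \<eta>. cis \<theta> \<noteq> cis \<eta> \<Longrightarrow> two_point \<mu> \<theta> \<eta> 0 > 0"
    and neq: "cis \<theta> \<noteq> cis \<eta>"
  shows "two_point \<mu> \<theta> \<eta> t1 > 0"
proof (rule ccontr)
  assume bad: "\<not> two_point \<mu> \<theta> \<eta> t1 > 0"
  obtain \<delta> where \<delta>: "\<delta> > 0"
    "\<And>\<theta> h t. \<theta> \<in> {0..2*pi} \<Longrightarrow> t \<in> {0..t1} \<Longrightarrow> h \<noteq> 0 \<Longrightarrow> \<bar>h\<bar> < \<delta> \<Longrightarrow> two_point \<mu> \<theta> (\<theta> + h) t > 0"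
    using two_point_near_diagonal[OF pos t1 \<mu>] by metis
  have t1': "0 \<le> t1" using t1 by (simp add: time_interval_def)
  define B :: "(real \<times> real \<times> real) set" where "B = {0..2*pi} \<times> {\<delta>..2*pi-\<delta>} \<times> {0..t1}"
  define C where "C = {z \<in> B. two_point \<mu> (fst z) (fst z + fst (snd z)) (snd (snd z)) \<le> 0}"
  \<comment> \<open>Every violation off the diagonal has a representative in \<open>C\<close>.
    Increments near \<open>2 * pi\<close> are again close to the diagonal and are excluded by
    shifting them by a full period.\<close>
  have inC: "\<exists>z\<in>C. snd (snd z) = s" if a: "cis \<phi> \<noteq> cis \<psi>" "two_point \<mu> \<phi> \<psi> s \<le> 0" "s \<in> {0..t1}" for \<phi> \<psi> s
  proof -
    obtain \<phi>' h where h: "\<phi>' \<in> {0..2*pi}" "0 < h" "h < 2*pi" "cis \<phi>' = cis \<phi>" "cis (\<phi>' + h) = cis \<psi>"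
      by (rule cis_representatives[OF a(1)])
    have Z: "two_point \<mu> \<phi>' (\<phi>' + h) s \<le> 0" using a(2) two_point_cong[OF h(4,5)] by simp
    have "\<delta> \<le> h" using \<delta>(2)[OF h(1) a(3), of h] Z h(2) by fastforce
    moreover have "\<delta> \<le> 2*pi - h"
    proof (rule ccontr)
      assume "\<not> \<delta> \<le> 2*pi - h"
      then have "two_point \<mu> \<phi>' (\<phi>' + (h - 2*pi)) s > 0" using h by (intro \<delta>(2) a(3)) auto
      moreover have "cis (\<phi>' + (h - 2*pi)) = cis (\<phi>' + h) / cis (2*pi)"
        by (simp only: cis_divide add_diff_eq)
      then have "cis (\<phi>' + (h - 2*pi)) = cis (\<phi>' + h)" by simp
      then have "two_point \<mu> \<phi>' (\<phi>' + (h - 2*pi)) s = two_point \<mu> \<phi>' (\<phi>' + h) s"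
        by (rule two_point_cong[OF refl])
      ultimately show False using Z by linarith
    qed
    ultimately have "(\<phi>', h, s) \<in> C" using h a(3) Z by (auto simp: C_def B_def)
    then show ?thesis by force
  qed
  have "continuous_on B (\<lambda>z. two_point \<mu> (fst z) (fst z + fst (snd z)) (snd (snd z)))"
    by (rule continuous_on_subset[OF continuous_two_point]) (use interval_subset[OF t1] in \<open>auto simp: B_def\<close>)
  then have "closed C" unfolding C_def
    by (intro continuous_on_closed_Collect_le continuous_on_const) (auto simp: B_def intro!: closed_Times)
  moreover have "compact B" unfolding B_def by (auto intro!: compact_Times)
  moreover have "C \<subseteq> B" by (auto simp: C_def)
  ultimately have "compact C" using compact_Int_closed[of B C] by (simp add: Int_absorb1)
  moreover have "C \<noteq> {}" using inC[OF neq, of t1] bad t1' by auto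
  ultimately have "\<exists>z\<in>C. \<forall>y\<in>C. snd (snd z) \<le> snd (snd y)"
    by (rule continuous_attains_inf) (rule continuous_on_snd[OF continuous_on_snd[OF continuous_on_id]])
  then obtain z where z: "z \<in> C" "\<And>y. y \<in> C \<Longrightarrow> snd (snd z) \<le> snd (snd y)"
    by blast
  define \<theta>0 h0 t0 where "\<theta>0 = fst z" and "h0 = fst (snd z)" and "t0 = snd (snd z)"
  have t0: "t0 \<in> {0..t1}" and h0: "0 < h0" "h0 < 2*pi" and Z0: "two_point \<mu> \<theta>0 (\<theta>0 + h0) t0 \<le> 0"
    using z(1) \<delta>(1) by (auto simp: C_def B_def \<theta>0_def h0_def t0_def)
  have tI: "t0 \<in> I" using t0 interval_subset[OF t1] by auto
  have neq0: "cis \<theta>0 \<noteq> cis (\<theta>0 + h0)" using cis_shift_neq[OF h0] by metis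
  have tpos: "t0 > 0" using t0 Z0 init[OF neq0] by (cases "t0 = 0") auto
  have before: "two_point \<mu> \<phi> \<psi> s > 0" if a: "cis \<phi> \<noteq> cis \<psi>" "0 \<le> s" "s < t0" for \<phi> \<psi> s
  proof (rule ccontr)
    assume "\<not> ?thesis"
    then obtain y where "y \<in> C" "snd (snd y) = s" using inC[OF a(1), of s] a t0 by auto
    then show False using z(2)[of y] a by (simp add: t0_def)
  qed
  have now: "0 \<le> two_point \<mu> \<phi> \<psi> t0" for \<phi> \<psi>
  proof (cases "cis \<phi> = cis \<psi>")
    case True
    then show ?thesis by (simp add: two_point_diagonal)
  next
    case False
    have "continuous_on I (two_point \<mu> \<phi> \<psi>)"
      unfolding two_point_def by (intro continuous_intros continuous_in_time) auto
    then have "continuous_on {0..t0} (two_point \<mu> \<phi> \<psi>)"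
      by (rule continuous_on_subset) (rule interval_subset[OF tI])
    then show ?thesis
      by (rule left_limit_ge[OF _ tpos]) (use before[OF False] in \<open>auto intro: less_imp_le\<close>)
  qed
  have zero: "two_point \<mu> \<theta>0 (\<theta>0 + h0) t0 = 0" using Z0 now by (auto intro: antisym)
  have "\<exists>l>0. ((\<lambda>s. two_point \<mu> \<theta>0 (\<theta>0 + h0) s) has_real_derivative l) (at t0)"
    by (rule two_point_time_derivative[OF now zero tI tpos pos[OF t0] \<mu> neq0 Q])
  then obtain d where d: "d > 0"
      "\<And>h. h > 0 \<Longrightarrow> h < d \<Longrightarrow> two_point \<mu> \<theta>0 (\<theta>0 + h0) (t0 - h) < two_point \<mu> \<theta>0 (\<theta>0 + h0) t0"
    using DERIV_pos_inc_left by blast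
  define h where "h = min d t0 / 2"
  have "h > 0" "h < d" "h < t0" using d(1) tpos by (auto simp: h_def)
  then have "two_point \<mu> \<theta>0 (\<theta>0 + h0) (t0 - h) < 0" using d(2) zero by auto
  moreover have "0 < two_point \<mu> \<theta>0 (\<theta>0 + h0) (t0 - h)" using before[OF neq0, of "t0 - h"] \<open>h > 0\<close> \<open>h < t0\<close> by simp
  ultimately show False by simp
qed

text \<open>
  Enlarging \<open>\<mu>\<close> a little makes the two-point function strictly positive off the diagonal at time 0,
  which the first-time argument needs.
\<close>

lemma non_collapsed_preserved:
  assumes Q: "\<And>\<mu> q u. 1 < \<mu> \<Longrightarrow> \<mu> \<le> \<mu>1 \<Longrightarrow> 0 \<le> q \<Longrightarrow> q \<le> 1 \<Longrightarrow> 0 < u \<Longrightarrow> u \<le> \<mu> \<Longrightarrow> \<exists>l. contact_excess p \<mu> q u l > 0"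
    and \<mu>: "1 \<le> \<mu>" "\<mu> < \<mu>1" and t1: "t1 \<in> I" and nc: "non_collapsed \<mu> (\<lambda>x. X x 0)"
  shows "non_collapsed \<mu> (\<lambda>x. X x t1)"
proof -
  have 0: "K \<theta> 0 > 0" "0 \<le> two_point \<mu> \<theta> \<eta> 0" for \<theta> \<eta>
    using nc \<mu>(1) zero_in_time_interval[OF T] by (auto simp: non_collapsed_iff_two_point)
  have pos: "K \<theta> t > 0" if "t \<in> {0..t1}" for \<theta> t
    by (rule curvature_stays_positive[OF 0(1)]) (use that interval_subset[OF t1] in auto)
  have t1': "t1 \<in> {0..t1}" using t1 by (simp add: time_interval_def)
  \<comment> \<open>The two-point function is affine in \<mu>, with positive slope off the diagonal
    where the curvature is positive. This yields strictness at time 0 and the limit from larger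
    parameters at time \<open>t1\<close>.\<close>
  have split: "two_point \<mu>' \<theta> \<eta> t = two_point \<mu> \<theta> \<eta> t
      + (\<mu>' - \<mu>) * (K \<theta> t / 2 * ((\<Gamma> \<theta> t - \<Gamma> \<eta> t) \<bullet> (\<Gamma> \<theta> t - \<Gamma> \<eta> t)))" for \<mu>' \<theta> \<eta> t
  proof -
    have "\<mu>' * k / 2 * d - n = (\<mu> * k / 2 * d - n) + (\<mu>' - \<mu>) * (k / 2 * d)" for k d n :: real
      by (simp add: field_simps)
    then show ?thesis unfolding two_point_def .
  qed
  have near: "0 \<le> two_point \<mu>' \<theta> \<eta> t1" if \<mu>': "\<mu> < \<mu>'" "\<mu>' < \<mu>1" for \<mu>' \<theta> \<eta>
  proof (cases "cis \<theta> = cis \<eta>")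
    case True
    then show ?thesis by (simp add: two_point_diagonal)
  next
    case False
    have "0 < two_point \<mu>' \<theta> \<eta> t1"
    proof (rule two_point_stays_positive[OF pos t1 _ _ _ False])
      show "1 < \<mu>'" using \<mu> \<mu>' by simp
      show "\<exists>l. contact_excess p \<mu>' q u l > 0" if "0 \<le> q" "q \<le> 1" "0 < u" "u \<le> \<mu>'" for q u
        using Q[of \<mu>' q u] that \<mu> \<mu>' by auto
      fix \<phi> \<psi> assume neq: "cis \<phi> \<noteq> cis \<psi>"
      have "\<Gamma> \<phi> 0 \<noteq> \<Gamma> \<psi> 0"
        using convex_curve.inj[OF convex_curve_at[OF zero_in_time_interval[OF T]]] neq
        by (auto simp: inj_on_def norm_cis)
      then have "0 < (\<mu>' - \<mu>) * (K \<phi> 0 / 2 * ((\<Gamma> \<phi> 0 - \<Gamma> \<psi> 0) \<bullet> (\<Gamma> \<phi> 0 - \<Gamma> \<psi> 0)))"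
        using \<mu>' 0(1) by simp
      then show "0 < two_point \<mu>' \<phi> \<psi> 0" using 0(2)[of \<phi> \<psi>] split[of \<mu>' \<phi> \<psi> 0] by simp
    qed
    then show ?thesis by simp
  qed
  have "0 \<le> two_point \<mu> \<theta> \<eta> t1" for \<theta> \<eta>
  proof (rule tendsto_lowerbound)
    have "((\<lambda>\<mu>'. two_point \<mu> \<theta> \<eta> t1 + (\<mu>' - \<mu>) * (K \<theta> t1 / 2 * ((\<Gamma> \<theta> t1 - \<Gamma> \<eta> t1) \<bullet> (\<Gamma> \<theta> t1 - \<Gamma> \<eta> t1))))
        \<longlongrightarrow> two_point \<mu> \<theta> \<eta> t1 + (\<mu> - \<mu>) * (K \<theta> t1 / 2 * ((\<Gamma> \<theta> t1 - \<Gamma> \<eta> t1) \<bullet> (\<Gamma> \<theta> t1 - \<Gamma> \<eta> t1)))) (at_right \<mu>)"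
      by (intro tendsto_intros)
    then show "((\<lambda>\<mu>'. two_point \<mu>' \<theta> \<eta> t1) \<longlongrightarrow> two_point \<mu> \<theta> \<eta> t1) (at_right \<mu>)"
      by (simp only: split[symmetric])
    show "\<forall>\<^sub>F \<mu>' in at_right \<mu>. 0 \<le> two_point \<mu>' \<theta> \<eta> t1"
      by (rule eventually_at_rightI[OF _ \<mu>(2)]) (use near in auto)
  qed auto
  then show ?thesis using pos[OF t1'] t1 \<mu>(1) by (simp add: non_collapsed_iff_two_point)
qed

end

theorem theorem0p2:
  fixes p :: real
  assumes "p > 1"
  shows "\<exists>\<mu>\<^sub>0::real. \<mu>\<^sub>0 > 1 \<and>
    (\<forall>(T::ereal) (X :: complex \<Rightarrow> real \<Rightarrow> complex) (\<mu>::real).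
       0 < T \<longrightarrow> power_curvature_flow p T X \<longrightarrow> 1 \<le> \<mu> \<longrightarrow> \<mu> \<le> \<mu>\<^sub>0 \<longrightarrow>
       non_collapsed \<mu> (\<lambda>x. X x 0) \<longrightarrow>
       (\<forall>t\<in>time_interval T. non_collapsed \<mu> (\<lambda>x. X x t)))"
proof -
  obtain \<mu>1 where \<mu>1: "\<mu>1 > 1" and Q: "\<And>\<mu> q u. 1 < \<mu> \<Longrightarrow> \<mu> \<le> \<mu>1 \<Longrightarrow> 0 \<le> q \<Longrightarrow> q \<le> 1 \<Longrightarrow> 0 < u \<Longrightarrow> u \<le> \<mu> \<Longrightarrow>
      \<exists>l. contact_excess p \<mu> q u l > 0"
    using contact_excess_positive[OF assms] by blast
  show ?thesis
  \<comment> \<open>The witness lies strictly between 1 and \<open>\<mu>1\<close>, which leaves room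
    to enlarge \<mu> within the range of \<open>Q\<close>.\<close>
  proof (intro exI[of _ "(1 + \<mu>1) / 2"] conjI allI impI ballI)
    show "(1 + \<mu>1) / 2 > 1" using \<mu>1 by simp
    fix T :: ereal and X :: "complex \<Rightarrow> real \<Rightarrow> complex" and \<mu> t :: real
    assume a: "0 < T" "power_curvature_flow p T X" "1 \<le> \<mu>" "\<mu> \<le> (1 + \<mu>1) / 2"
      "non_collapsed \<mu> (\<lambda>x. X x 0)" "t \<in> time_interval T"
    obtain G1 G2 G3 G4 Gt G1t G2t where "curvature_flow p T X G1 G2 G3 G4 Gt G1t G2t"
      using power_curvature_flow_imp_curvature_flow[OF assms a(1,2)] by blast
    then interpret curvature_flow p T X G1 G2 G3 G4 Gt G1t G2t .
    show "non_collapsed \<mu> (\<lambda>x. X x t)"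
      by (rule non_collapsed_preserved[OF Q a(3) _ a(6,5)]) (use a(4) \<mu>1 in auto)
  qed
qed

end
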